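(* Let $\sigma(\mathscr L)=\sigma(N,V)=\mathbb R_+$ for some $V\in\mathscr H$. Then $V=0$.
   Context: Fix $N\ge2$. $\mathscr H$ is the real Hilbert space of 1-periodic functions $V$ on $\mathbb R$ with values in the real symmetric $N\times N$ matrices, with $\|V\|^2=\int_0^1\mathrm{Tr}\,V^2(t)\,dt<\infty$. $\mathscr L y=-y''+V(t)y$ is the self-adjoint operator in $L^2(\mathbb R)^N$, $\sigma(\mathscr L)$ its spectrum (absolutely continuous), and $\sigma(m,V)$ denotes the spectrum of $\mathscr L$ of multiplicity $2m$, $m\ge0$. $\mathbb R_+=[0,\infty)$. Standing normalization: the bottom of the spectrum is $\lambda_0^+=0$ and $\int_0^1V(t)dt=\mathrm{diag}\{V_1^0,\dots,V_N^0\}$ with $V_1^0\le\dots\le V_N^0$. *)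

theory Defs
  imports "HOL-Analysis.Analysis"
begin

section \<open>Potentials\<close>

text \<open>The index type \<open>'n\<close> has \<open>N = CARD('n)\<close> elements. Elements of the Hilbert space are
  represented by functions; equality in it is equality almost everywhere.\<close>

definition periodic_potentials :: "(real \<Rightarrow> real ^ 'n ^ 'n::finite) set" where
  "periodic_potentials =
     {V. V \<in> borel_measurable lebesgue \<and>
         (\<forall>t. V (t + 1) = V t) \<and>
         (\<forall>t. transpose (V t) = V t) \<and>
         set_integrable lebesgue {0..1} (\<lambda>t. trace (V t ** V t))}"


section \<open>The Schroedinger operator in \<open>L\<^sup>2(\<real>; \<complex>\<^sup>N)\<close>\<close>

definition L2 :: "(real \<Rightarrow> complex ^ 'n::finite) set" where
  "L2 = {f. f \<in> borel_measurable lebesgue \<and> integrable lebesgue (\<lambda>t. (norm (f t))\<^sup>2)}"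

definition sqnorm :: "(real \<Rightarrow> complex ^ 'n::finite) \<Rightarrow> real" where
  "sqnorm f = (LINT t|lebesgue. (norm (f t))\<^sup>2)"

text \<open>\<open>u\<close> is continuously differentiable with locally absolutely continuous derivative,
  whose almost everywhere derivative is \<open>w\<close>.\<close>

definition has_weak_second_derivative ::
    "(real \<Rightarrow> complex ^ 'n::finite) \<Rightarrow> (real \<Rightarrow> complex ^ 'n) \<Rightarrow> bool" where
  "has_weak_second_derivative u w \<longleftrightarrow>
     (\<exists>u'. (\<forall>t. (u has_vector_derivative u' t) (at t)) \<and>
           (\<forall>a b. a \<le> b \<longrightarrow>
              w absolutely_integrable_on {a..b} \<and> (w has_integral (u' b - u' a)) {a..b}))"

definition complex_matrix :: "real ^ 'n ^ 'n \<Rightarrow> complex ^ 'n ^ 'n::finite" where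
  "complex_matrix A = (\<chi> i j. complex_of_real (A $ i $ j))"

text \<open>\<open>schroedinger V y f\<close> says that \<open>y\<close> lies in the domain of \<open>L = - d\<^sup>2/dt\<^sup>2 + V\<close> and \<open>L y = f\<close>.
  The domain is the maximal one. For a periodic, locally square integrable, symmetric \<open>V\<close> the
  equation is in the limit point case at both ends, so this is the self-adjoint realization.
  The relation is closed under changing \<open>y\<close> and \<open>f\<close> on null sets.\<close>

definition schroedinger ::
    "(real \<Rightarrow> real ^ 'n ^ 'n) \<Rightarrow> (real \<Rightarrow> complex ^ 'n) \<Rightarrow> (real \<Rightarrow> complex ^ 'n::finite) \<Rightarrow> bool" where
  "schroedinger V y f \<longleftrightarrow>
     y \<in> L2 \<and> f \<in> L2 \<and>
     (\<exists>u w. (AE t in lebesgue. y t = u t) \<and> has_weak_second_derivative u w \<and>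
            (AE t in lebesgue. f t = - w t + complex_matrix (V t) *v u t))"


section \<open>Spectrum\<close>

text \<open>A number \<open>z\<close> is in the resolvent set iff \<open>L - z\<close> maps its domain bijectively onto \<open>L\<^sup>2\<close>,
  with bounded inverse; \<open>(L - z) y = f\<close> is written as \<open>L y = f + z y\<close>.\<close>

definition resolvent_set :: "(real \<Rightarrow> real ^ 'n ^ 'n::finite) \<Rightarrow> complex set" where
  "resolvent_set V =
     {z. \<exists>C. \<forall>f\<in>L2. \<exists>y.
           schroedinger V y (\<lambda>t. f t + z *s y t) \<and>
           sqnorm y \<le> C * sqnorm f \<and>
           (\<forall>y'. schroedinger V y' (\<lambda>t. f t + z *s y' t) \<longrightarrow> (AE t in lebesgue. y' t = y t))}"

definition spectrum :: "(real \<Rightarrow> real ^ 'n ^ 'n::finite) \<Rightarrow> complex set" where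
  "spectrum V = - resolvent_set V"


section \<open>Spectral multiplicity\<close>

text \<open>Given a measure \<open>\<mu>\<close> on the real line and a multiplicity function \<open>n\<close>, the direct integral
  of the spaces \<open>\<complex>\<^bsup>n x\<^esup>\<close> with respect to \<open>\<mu>\<close>. Only the components \<open>h x k\<close> with \<open>k < n x\<close> matter.\<close>

definition fibre_L2 :: "real measure \<Rightarrow> (real \<Rightarrow> nat) \<Rightarrow> (real \<Rightarrow> nat \<Rightarrow> complex) set" where
  "fibre_L2 \<mu> n =
     {h. (\<forall>k. (\<lambda>x. h x k) \<in> borel_measurable \<mu>) \<and>
         integrable \<mu> (\<lambda>x. \<Sum>k<n x. (cmod (h x k))\<^sup>2)}"

definition fibre_eq ::
    "real measure \<Rightarrow> (real \<Rightarrow> nat) \<Rightarrow> (real \<Rightarrow> nat \<Rightarrow> complex) \<Rightarrow> (real \<Rightarrow> nat \<Rightarrow> complex) \<Rightarrow> bool" where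
  "fibre_eq \<mu> n g h \<longleftrightarrow> (AE x in \<mu>. \<forall>k<n x. g x k = h x k)"

text \<open>\<open>U\<close> is a unitary map of \<open>L\<^sup>2(\<real>; \<complex>\<^sup>N)\<close> onto this direct integral which takes \<open>L\<close>, domain
  included, to multiplication by the independent variable. By the spectral theorem in multiplicity
  form, \<open>\<mu>\<close> is determined up to mutual absolute continuity and \<open>n\<close> up to \<open>\<mu>\<close>-null sets. Finite
  values of \<open>n\<close> suffice, since \<open>- y'' + V y = x y\<close> has a solution space of dimension \<open>2 N\<close>.\<close>

definition spectral_representation ::
    "(real \<Rightarrow> real ^ 'n ^ 'n::finite) \<Rightarrow> real measure \<Rightarrow> (real \<Rightarrow> nat) \<Rightarrow>
     ((real \<Rightarrow> complex ^ 'n) \<Rightarrow> real \<Rightarrow> nat \<Rightarrow> complex) \<Rightarrow> bool" where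
  "spectral_representation V \<mu> n U \<longleftrightarrow>
     sets \<mu> = sets borel \<and> sigma_finite_measure \<mu> \<and>
     n \<in> measurable \<mu> (count_space UNIV) \<and> (AE x in \<mu>. n x \<ge> 1) \<and>
     (\<forall>f\<in>L2. U f \<in> fibre_L2 \<mu> n) \<and>
     (\<forall>f\<in>L2. \<forall>g\<in>L2. \<forall>a b.
        fibre_eq \<mu> n (U (\<lambda>t. a *s f t + b *s g t)) (\<lambda>x k. a * U f x k + b * U g x k)) \<and>
     (\<forall>f\<in>L2. (LINT x|\<mu>. (\<Sum>k<n x. (cmod (U f x k))\<^sup>2)) = sqnorm f) \<and>
     (\<forall>h\<in>fibre_L2 \<mu> n. \<exists>f\<in>L2. fibre_eq \<mu> n (U f) h) \<and>
     (\<forall>f\<in>L2. \<forall>g\<in>L2.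
        schroedinger V f g \<longleftrightarrow> fibre_eq \<mu> n (U g) (\<lambda>x k. complex_of_real x * U f x k))"

text \<open>\<open>mult_spectrum m V\<close> is the spectrum of multiplicity \<open>2 m\<close>, that is, the spectrum of the part
  of \<open>L\<close> of uniform multiplicity \<open>2 m\<close>: the closed support of \<open>\<mu>\<close> restricted to \<open>{x. n x = 2 m}\<close>.
  The support is taken because \<open>n\<close> is defined only up to null sets; by uniqueness, the choice of
  spectral representation does not matter.\<close>

definition mult_spectrum :: "nat \<Rightarrow> (real \<Rightarrow> real ^ 'n ^ 'n::finite) \<Rightarrow> real set" where
  "mult_spectrum m V =
     {l. \<exists>\<mu> n U. spectral_representation V \<mu> n U \<and>
          (\<forall>e>0. emeasure \<mu> {x. \<bar>x - l\<bar> < e \<and> n x = 2 * m} > 0)}"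


section \<open>Normalization\<close>

text \<open>The bottom of the spectrum is \<open>0\<close>, and the mean of \<open>V\<close> is diagonal with nondecreasing
  diagonal entries.\<close>

definition normalized :: "(real \<Rightarrow> real ^ 'n::{finite,linorder} ^ 'n::{finite,linorder}) \<Rightarrow> bool" where
  "normalized V \<longleftrightarrow>
     0 \<in> spectrum V \<and> (\<forall>z\<in>spectrum V. 0 \<le> Re z) \<and>
     (\<exists>d. mono d \<and> integral {0..1} V = (\<chi> i j. if i = j then d i else 0))"

end

theory Submission
  imports Defs "HOL-Complex_Analysis.Complex_Analysis" "HOL-Real_Asymp.Real_Asymp"
    "Jordan_Normal_Form.Schur_Decomposition"
begin

text \<open>
  Write \<open>N\<close> for the size of the matrices and \<open>\<Delta>(\<lambda>)\<close> for the trace of the \<open>2 N \<times> 2 N\<close> monodromy matrix of \<open>- y'' + V y = \<lambda> y\<close>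
  over one period. Two inequalities for the mean of \<open>V\<close> pull in opposite directions.

  First, full multiplicity \<open>2 N\<close> on the half-line forces \<open>|\<Delta>(\<lambda>)| \<le> 2 N\<close> for all \<open>\<lambda> \<ge> 0\<close>: where the multiplicity is \<open>2 N\<close>, all solutions are
  generalized eigenfunctions, these grow at most polynomially, and so all Floquet multipliers lie in the unit disc. An abstract
  spectral representation does not provide eigenfunctions. Their boundary values are recovered as \<open>boundary_form\<close>, by applying the representation
  to one-sided cut-offs; they are square integrable in the energy with uniform bounds (\<open>boundary_form_L2\<close>), the transfer matrix acts on them
  (\<open>basis_form_transfer\<close>), and they are injective on the fibres (\<open>kernel_section_trivial\<close>). The trace bound follows in
  \<open>transfer_trace_bound\<close>. Now \<open>\<Delta>(z\<^sup>2) = 2 N cos z + q sin z / z + O(exp |Im z| / |z|\<^sup>2)\<close>, where \<open>q\<close> is the trace of the mean of \<open>V\<close>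
  (\<open>transfer_trace_asymptotics\<close>). Integrating \<open>(\<Delta>(z\<^sup>2) / 2 - N cos z) / sin z\<close> over large circles expresses \<open>q / 2\<close> as the limit of sums of the
  residues \<open>\<plusminus> \<Delta>(k\<^sup>2 \<pi>\<^sup>2) / 2 - N\<close>, whose real parts are at most \<open>0\<close>. Hence \<open>q \<le> 0\<close> (\<open>mean_trace_nonpos\<close>).

  Second, a spectrum in \<open>[0, \<infinity>)\<close> makes the quadratic form of the operator nonnegative (\<open>schroedinger_nonneg\<close>). Cutting periodic functions off to long intervals
  shows that the form over a single period is nonnegative on them (\<open>periodic_test_function\<close>). Constant functions give that every diagonal entry of the mean is
  nonnegative. As the trace is at most \<open>0\<close> and the mean is diagonal, the mean vanishes.

  Finally, the constants then minimize the form, and its first variation in the direction of a periodic \<open>g\<close> with \<open>g'' = V e\<close> is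
  \<open>- 2 \<integral> |g'|\<^sup>2\<close>. So \<open>g\<close> is constant and \<open>V e = 0\<close> for every constant vector \<open>e\<close> (\<open>V_vanishes_if_mean_zero\<close>).
\<close>

section \<open>Matrices whose powers grow at most linearly\<close>

text \<open>The trace is cyclic: \<open>tr (X B Y) = tr (Y X B)\<close> and \<open>Y X = 1\<close>.\<close>

lemma trace_similar_mat:
  fixes M :: "complex mat"
  assumes M: "M \<in> carrier_mat d d" and sim: "similar_mat_wit M B X Y"
  shows "(\<Sum>i<d. M $$ (i,i)) = (\<Sum>i<d. B $$ (i,i))"
proof -
  have c: "B \<in> carrier_mat d d" "X \<in> carrier_mat d d" "Y \<in> carrier_mat d d"
    and YX: "Y * X = 1\<^sub>m d" and MXY: "M = X * B * Y"
    using sim M unfolding similar_mat_wit_def by (auto simp: Let_def)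
  have XB: "X * B \<in> carrier_mat d d" using c by auto
  have "(\<Sum>i<d. M $$ (i,i)) = (\<Sum>i<d. \<Sum>k<d. (X * B) $$ (i,k) * Y $$ (k,i))"
    unfolding MXY using c XB by (intro sum.cong refl)
      (auto simp: times_mat_def scalar_prod_def lessThan_atLeast0 simp del: index_mult_mat)
  also have "\<dots> = (\<Sum>k<d. \<Sum>i<d. Y $$ (k,i) * (X * B) $$ (i,k))"
    by (subst sum.swap) (simp add: mult.commute)
  also have "\<dots> = (\<Sum>k<d. (Y * (X * B)) $$ (k,k))"
    using c XB by (intro sum.cong refl)
      (auto simp: times_mat_def scalar_prod_def lessThan_atLeast0 simp del: index_mult_mat)
  also have "Y * (X * B) = B"
    using c YX by (simp add: assoc_mult_mat[symmetric, of Y d d X d B d])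
  finally show ?thesis .
qed

lemma geometric_le_linear_imp_le_1:
  fixes r c C :: real
  assumes "\<And>n. r ^ n * c \<le> C * (real n + 1)" and "c > 0"
  shows "r \<le> 1"
proof (rule ccontr)
  assume "\<not> r \<le> 1"
  hence r: "r > 1" by simp
  have "filterlim (\<lambda>n. r ^ n / (real n + 1)) at_top sequentially"
    using r by real_asymp
  hence "eventually (\<lambda>n. r ^ n / (real n + 1) > C / c) sequentially"
    by (simp add: filterlim_at_top_dense)
  then obtain n where n: "r ^ n / (real n + 1) > C / c"
    using eventually_happens trivial_limit_sequentially by blast
  hence "r ^ n * c > C * (real n + 1)"
    using \<open>c > 0\<close> by (simp add: field_simps)
  with assms(1)[of n] show False by simp
qed

text \<open>Every eigenvalue \<open>e\<close> of \<open>P\<close> has \<open>|e| \<le> 1\<close>: for a left eigenvector \<open>w\<close>, the row \<open>w A\<^sub>n = e\<^sup>n w A\<^sub>0\<close> grows at most linearly in \<open>n\<close>,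
  and \<open>w A\<^sub>0 \<noteq> 0\<close> because \<open>A\<^sub>0\<close> is a square matrix without kernel. A Schur decomposition turns the
  bound on the eigenvalues into one on the trace. Later \<open>P\<close> is a transfer matrix over one period and the columns of
  \<open>A n\<close> are the data, \<open>n\<close> periods away, of polynomially bounded generalized eigenfunctions.\<close>

lemma norm_trace_le_if_powers_grow_linearly:
  fixes P :: "'m::finite \<Rightarrow> 'm \<Rightarrow> complex" and A :: "nat \<Rightarrow> 'm \<Rightarrow> nat \<Rightarrow> complex"
  assumes rec: "\<And>n j k. k < CARD('m) \<Longrightarrow> A (Suc n) j k = (\<Sum>i\<in>UNIV. P j i * A n i k)"
    and bound: "\<And>n j k. k < CARD('m) \<Longrightarrow> cmod (A n j k) \<le> C * (real n + 1)"
    and inj: "\<And>c. (\<forall>j. (\<Sum>k<CARD('m). c k * A 0 j k) = 0) \<Longrightarrow> (\<forall>k<CARD('m). c k = 0)"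
  shows "cmod (\<Sum>j\<in>UNIV. P j j) \<le> CARD('m)"
proof -
  define d where "d = CARD('m)"
  \<comment> \<open>The matrix theory indexes by natural numbers; \<open>h\<close> transports the index type.\<close>
  obtain h where "bij_betw h {0..<d} (UNIV :: 'm set)"
    using ex_bij_betw_nat_finite[of "UNIV :: 'm set"] d_def by auto
  hence h: "bij_betw h {..<d} (UNIV :: 'm set)" by (simp add: lessThan_atLeast0)
  define M where "M = mat d d (\<lambda>(i,j). P (h i) (h j))"
  have M: "M \<in> carrier_mat d d" by (simp add: M_def)
  obtain as where as: "char_poly M = (\<Prod>a\<leftarrow>as. [:- a, 1:])" "length as = d"
    using char_poly_factorized[OF M] by blast
  obtain B X Y where BXY: "schur_decomposition M as = (B, X, Y)" by (metis prod_cases3)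
  have sch: "similar_mat_wit M B X Y" "diag_mat B = as"
    using schur_decomposition[OF M as(1) BXY] by auto
  have B: "B \<in> carrier_mat d d"
    using sch(1) M unfolding similar_mat_wit_def by (auto simp: Let_def)
  have unit: "cmod e \<le> 1" if "e \<in> set as" for e
  proof -
    have "poly (char_poly (transpose_mat M)) e = 0"
      using that char_poly_transpose_mat[OF M] as(1) by (simp add: poly_prod_list prod_list_zero_iff)
    hence "eigenvalue (transpose_mat M) e"
      using eigenvalue_root_char_poly[of "transpose_mat M" d] M by simp
    then obtain v where v: "v \<in> carrier_vec d" "v \<noteq> 0\<^sub>v d" "transpose_mat M *\<^sub>v v = e \<cdot>\<^sub>v v"
      using M unfolding eigenvalue_def eigenvector_def by auto
    define w where "w j = vec_index v (inv_into {..<d} h j)" for j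
    have wh: "w (h i) = vec_index v i" if "i < d" for i
      using that h by (simp add: w_def bij_betw_inv_into_left)
    have reindex: "(\<Sum>j\<in>UNIV. f j) = (\<Sum>i<d. f (h i))" for f :: "'m \<Rightarrow> complex"
      using sum.reindex_bij_betw[OF h, of f] by simp
    have eig: "(\<Sum>j\<in>UNIV. w j * P j i) = e * w i" for i
    proof -
      obtain i' where i': "i' < d" "i = h i'" using h by (metis UNIV_I bij_betw_iff_bijections lessThan_iff)
      have "vec_index (transpose_mat M *\<^sub>v v) i' = (\<Sum>j<d. M $$ (j, i') * vec_index v j)"
        using i' v(1) M by (simp add: scalar_prod_def lessThan_atLeast0)
      also have "\<dots> = (\<Sum>j<d. w (h j) * P (h j) i)"
        using i' by (intro sum.cong refl) (simp add: M_def wh mult.commute)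
      finally show ?thesis using i' v by (simp add: reindex wh)
    qed
    have pow: "(\<Sum>j\<in>UNIV. w j * A n j k) = e ^ n * (\<Sum>j\<in>UNIV. w j * A 0 j k)" if k: "k < d" for n k
    proof (induction n)
      case (Suc n)
      have "(\<Sum>j\<in>UNIV. w j * A (Suc n) j k) = (\<Sum>j\<in>UNIV. \<Sum>i\<in>UNIV. w j * P j i * A n i k)"
        using rec k by (simp add: d_def sum_distrib_left mult.assoc)
      also have "\<dots> = (\<Sum>i\<in>UNIV. (\<Sum>j\<in>UNIV. w j * P j i) * A n i k)"
        by (subst sum.swap) (simp add: sum_distrib_right)
      also have "\<dots> = e * (\<Sum>i\<in>UNIV. w i * A n i k)"
        by (simp add: eig sum_distrib_left mult.assoc)
      finally show ?case using Suc by simp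
    qed simp
    have "\<exists>k<d. (\<Sum>j\<in>UNIV. w j * A 0 j k) \<noteq> 0"
    proof (rule ccontr)
      assume neg: "\<not> ?thesis"
      have zero: "(\<Sum>j<d. vec_index v j * A 0 (h j) k) = 0" if "k < d" for k
      proof -
        have "(\<Sum>j\<in>UNIV. w j * A 0 j k) = (\<Sum>j<d. vec_index v j * A 0 (h j) k)"
          unfolding reindex by (intro sum.cong refl) (simp add: wh)
        with neg that show ?thesis by auto
      qed
      define A0 where "A0 = mat d d (\<lambda>(i,k). A 0 (h i) k)"
      have A0: "A0 \<in> carrier_mat d d" by (simp add: A0_def)
      have "transpose_mat A0 *\<^sub>v v = 0\<^sub>v d"
        using v(1) zero by (intro eq_vecI) (auto simp: A0_def scalar_prod_def lessThan_atLeast0 mult.commute)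
      hence "det (transpose_mat A0) = 0"
        using det_0_iff_vec_prod_zero[of "transpose_mat A0" d] A0 v by auto
      hence "det A0 = 0" using det_transpose[OF A0] by simp
      then obtain u where u: "u \<in> carrier_vec d" "u \<noteq> 0\<^sub>v d" "A0 *\<^sub>v u = 0\<^sub>v d"
        using det_0_iff_vec_prod_zero[OF A0] by auto
      have "(\<Sum>k<d. vec_index u k * A 0 j k) = 0" for j
      proof -
        obtain i where i: "i < d" "j = h i" using h by (metis UNIV_I bij_betw_iff_bijections lessThan_iff)
        have "vec_index (A0 *\<^sub>v u) i = (\<Sum>k<d. A 0 j k * vec_index u k)"
          using i u(1) by (simp add: A0_def scalar_prod_def lessThan_atLeast0)
        thus ?thesis using u i by (simp add: mult.commute)
      qed
      hence "\<forall>k<d. vec_index u k = 0" using inj[of "vec_index u"] d_def by blast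
      hence "u = 0\<^sub>v d" using u(1) by (intro eq_vecI) auto
      with u show False by simp
    qed
    then obtain k where k: "k < d" "(\<Sum>j\<in>UNIV. w j * A 0 j k) \<noteq> 0" by blast
    have growth: "cmod e ^ n * cmod (\<Sum>j\<in>UNIV. w j * A 0 j k) \<le> ((\<Sum>j\<in>UNIV. cmod (w j)) * C) * (real n + 1)" for n
    proof -
      have "cmod e ^ n * cmod (\<Sum>j\<in>UNIV. w j * A 0 j k) = cmod (\<Sum>j\<in>UNIV. w j * A n j k)"
        by (simp add: pow[OF k(1), of n] norm_mult norm_power)
      also have "\<dots> \<le> (\<Sum>j\<in>UNIV. cmod (w j) * (C * (real n + 1)))"
        using bound[of k n] k(1) unfolding d_def
        by (intro order_trans[OF norm_sum] sum_mono) (simp add: norm_mult mult_left_mono)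
      also have "\<dots> = ((\<Sum>j\<in>UNIV. cmod (w j)) * C) * (real n + 1)"
        unfolding sum_distrib_right mult.assoc ..
      finally show ?thesis .
    qed
    show ?thesis
      by (rule geometric_le_linear_imp_le_1[OF growth]) (use k(2) in simp)
  qed
  have "(\<Sum>j\<in>UNIV. P j j) = (\<Sum>i<d. M $$ (i,i))"
    using sum.reindex_bij_betw[OF h, of "\<lambda>j. P j j"] by (simp add: M_def)
  also have "\<dots> = (\<Sum>i<d. B $$ (i,i))" by (rule trace_similar_mat[OF M sch(1)])
  also have "cmod \<dots> \<le> (\<Sum>i<d. 1)"
  proof (intro order_trans[OF norm_sum] sum_mono)
    fix i assume "i \<in> {..<d}"
    hence "B $$ (i,i) \<in> set as" using B sch(2) unfolding diag_mat_def by auto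
    thus "cmod (B $$ (i,i)) \<le> 1" by (rule unit)
  qed
  finally show ?thesis by (simp add: d_def)
qed

text \<open>From here on, vectors and matrices are the finite Cartesian ones.\<close>

no_notation Matrix.vec_index (infixl \<open>$\<close> 100)
no_notation Matrix.scalar_prod (infix \<open>\<bullet>\<close> 70)
hide_type (open) Matrix.vec Matrix.mat
hide_const (open) Matrix.mat Matrix.vec Determinant.det Matrix.transpose_mat Matrix.row Matrix.col

hide_fact (open) Matrix.vec_eq_iff Matrix.mat_def

section \<open>Integration by parts for absolutely continuous functions\<close>

lemma sigma_finite_lebesgue: "sigma_finite_measure (lebesgue :: 'a::euclidean_space measure)"
proof -
  have "\<exists>A :: 'a set set. countable A \<and> A \<subseteq> sets lborel \<and> \<Union>A = space lborel \<and> (\<forall>a\<in>A. emeasure lborel a \<noteq> \<infinity>)"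
    by (rule sigma_finite_measure.sigma_finite_countable[OF sigma_finite_lborel])
  then obtain A :: "'a set set" where A: "countable A" "A \<subseteq> sets lborel" "\<Union>A = space lborel" "\<forall>a\<in>A. emeasure lborel a \<noteq> \<infinity>"
    by (elim exE conjE)
  have "A \<subseteq> sets lebesgue" using A(2) by (intro subset_trans[OF A(2)] sets_completionI_sets subsetI)
  moreover have "\<forall>a\<in>A. emeasure lebesgue a \<noteq> \<infinity>" using A(2,4) by (simp add: subset_iff)
  ultimately show "sigma_finite_measure (lebesgue :: 'a::euclidean_space measure)"
    unfolding sigma_finite_measure_def
    using A(1,3) by (intro exI[of _ A]) simp
qed

interpretation lebesgue_pair: pair_sigma_finite "lebesgue :: real measure" "lebesgue :: real measure"
  unfolding pair_sigma_finite_def using sigma_finite_lebesgue by auto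

text \<open>The integral of \<open>f t * g s\<close> over the triangle \<open>a \<le> s \<le> t \<le> b\<close>, taken in both orders. This replaces differentiation
  almost everywhere in the integration by parts below: a weak derivative is only known through its integrals.\<close>

lemma triangle_Fubini:
  fixes f g :: "real \<Rightarrow> complex"
  assumes f: "f absolutely_integrable_on {a..b}" and g: "g absolutely_integrable_on {a..b}"
  shows "integral {a..b} (\<lambda>t. f t * integral {a..t} g) = integral {a..b} (\<lambda>s. g s * integral {s..b} f)"
    and "(\<lambda>t. f t * integral {a..t} g) integrable_on {a..b}"
    and "(\<lambda>s. g s * integral {s..b} f) integrable_on {a..b}"
proof -
  define F where "F = (\<lambda>t. indicator {a..b} t *\<^sub>R f t)"
  define G where "G = (\<lambda>t. indicator {a..b} t *\<^sub>R g t)"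
  have F: "integrable lebesgue F" and G: "integrable lebesgue G"
    using f g by (simp_all add: set_integrable_def F_def G_def)
  have [measurable]: "F \<in> borel_measurable lebesgue" "G \<in> borel_measurable lebesgue"
    using F G by auto
  define H where "H = (\<lambda>(t,s). F t * (if s \<le> t then G s else 0))"
  have id_meas [measurable]: "(\<lambda>x::real. x) \<in> borel_measurable lebesgue"
    by (simp add: measurable_completion)
  have fst_meas [measurable]: "(\<lambda>p. fst p) \<in> borel_measurable ((lebesgue::real measure) \<Otimes>\<^sub>M (lebesgue::real measure))"
    by (rule measurable_compose[OF measurable_fst id_meas])
  have snd_meas [measurable]: "(\<lambda>p. snd p) \<in> borel_measurable ((lebesgue::real measure) \<Otimes>\<^sub>M (lebesgue::real measure))"
    by (rule measurable_compose[OF measurable_snd id_meas])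
  have FG: "(\<lambda>p. F (fst p)) \<in> borel_measurable ((lebesgue::real measure) \<Otimes>\<^sub>M (lebesgue::real measure))"
    "(\<lambda>p. G (snd p)) \<in> borel_measurable ((lebesgue::real measure) \<Otimes>\<^sub>M (lebesgue::real measure))"
    by (rule measurable_compose[OF measurable_fst \<open>F \<in> _\<close>], rule measurable_compose[OF measurable_snd \<open>G \<in> _\<close>])
  have H_eq: "H = (\<lambda>p. if snd p \<le> fst p then F (fst p) * G (snd p) else 0)"
    by (auto simp: H_def fun_eq_iff indicator_def)
  have Hm: "H \<in> borel_measurable (lebesgue \<Otimes>\<^sub>M lebesgue)"
    unfolding H_eq using FG by (intro measurable_If borel_measurable_times) measurable
  have sec: "integrable lebesgue (\<lambda>s. (if s \<le> t then G s else 0))" for t :: real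
  proof -
    have "integrable lebesgue (\<lambda>s. indicator {..t} s *\<^sub>R G s)"
      by (rule integrable_mult_indicator) (use G in auto)
    thus ?thesis by (rule back_subst[of "integrable lebesgue"]) (auto simp: fun_eq_iff)
  qed
  have H: "integrable (lebesgue \<Otimes>\<^sub>M lebesgue) H"
  proof (rule lebesgue_pair.Fubini_integrable[OF Hm])
    show "AE t in lebesgue. integrable lebesgue (\<lambda>s. H (t, s))"
      unfolding H_def prod.case using sec by (intro AE_I2 integrable_mult_right) simp
    have m: "(\<lambda>t. LINT s|lebesgue. norm (H (t, s))) \<in> borel_measurable lebesgue"
      using Hm by measurable
    show "integrable lebesgue (\<lambda>t. LINT s|lebesgue. norm (H (t, s)))"
    proof (rule Bochner_Integration.integrable_bound[of _ "\<lambda>t. norm (F t) * (LINT s|lebesgue. norm (G s))"])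
      show "integrable lebesgue (\<lambda>t. norm (F t) * (LINT s|lebesgue. norm (G s)))"
        using F by (intro integrable_mult_left integrable_norm)
      show "AE t in lebesgue. norm (LINT s|lebesgue. norm (H (t, s))) \<le> norm (norm (F t) * (LINT s|lebesgue. norm (G s)))"
      proof (intro AE_I2)
        fix t :: real
        have "(LINT s|lebesgue. norm (H (t, s))) \<le> (LINT s|lebesgue. norm (F t) * norm (G s))"
        proof (rule integral_mono)
          show "integrable lebesgue (\<lambda>s. norm (H (t, s)))"
            unfolding H_def prod.case by (intro integrable_norm integrable_mult_right sec)
          show "integrable lebesgue (\<lambda>s. norm (F t) * norm (G s))"
            using G by (intro integrable_mult_right integrable_norm)
          show "norm (H (t, s)) \<le> norm (F t) * norm (G s)" for s
            by (auto simp: H_def norm_mult indicator_def)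
        qed
        thus "norm (LINT s|lebesgue. norm (H (t, s))) \<le> norm (norm (F t) * (LINT s|lebesgue. norm (G s)))"
          by (simp add: integral_nonneg_AE)
      qed
    qed (use m in simp)
  qed
  have H': "integrable (lebesgue \<Otimes>\<^sub>M lebesgue) (\<lambda>(t,s). F t * (if s \<le> t then G s else 0))"
    using H by (simp add: H_def)
  have inner1: "(LINT s|lebesgue. F t * (if s \<le> t then G s else 0)) = indicator {a..b} t *\<^sub>R (f t * integral {a..t} g)" for t
  proof (cases "t \<in> {a..b}")
    case True
    have "set_integrable lebesgue {a..t} g"
      by (rule set_integrable_subset[OF g]) (use True in auto)
    moreover have "(\<lambda>s. F t * (if s \<le> t then G s else 0)) = (\<lambda>s. f t * (indicator {a..t} s *\<^sub>R g s))"
      using True by (auto simp: F_def G_def indicator_def fun_eq_iff)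
    moreover have "(LINT s|lebesgue. f t * (indicator {a..t} s *\<^sub>R g s)) = f t * (LINT s:{a..t}|lebesgue. g s)"
      unfolding set_lebesgue_integral_def by (rule integral_mult_right_zero)
    ultimately show ?thesis
      using True set_lebesgue_integral_eq_integral(2)[of "{a..t}" g] by simp
  next
    case False
    hence "F t = 0" by (simp add: F_def)
    with False show ?thesis by simp
  qed
  have inner2: "(LINT t|lebesgue. F t * (if s \<le> t then G s else 0)) = indicator {a..b} s *\<^sub>R (g s * integral {s..b} f)" for s
  proof (cases "s \<in> {a..b}")
    case True
    have "set_integrable lebesgue {s..b} f"
      by (rule set_integrable_subset[OF f]) (use True in auto)
    moreover have "(\<lambda>t. F t * (if s \<le> t then G s else 0)) = (\<lambda>t. g s * (indicator {s..b} t *\<^sub>R f t))"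
      using True by (auto simp: F_def G_def indicator_def fun_eq_iff)
    moreover have "(LINT t|lebesgue. g s * (indicator {s..b} t *\<^sub>R f t)) = g s * (LINT t:{s..b}|lebesgue. f t)"
      unfolding set_lebesgue_integral_def by (rule integral_mult_right_zero)
    ultimately show ?thesis
      using True set_lebesgue_integral_eq_integral(2)[of "{s..b}" f] by simp
  next
    case False
    hence "G s = 0" by (simp add: G_def)
    with False show ?thesis by (simp cong: if_cong)
  qed
  have i1: "set_integrable lebesgue {a..b} (\<lambda>t. f t * integral {a..t} g)"
    using lebesgue_pair.integrable_fst[OF H'] unfolding inner1 set_integrable_def .
  have i2: "set_integrable lebesgue {a..b} (\<lambda>s. g s * integral {s..b} f)"
    using lebesgue_pair.integrable_snd[OF H'] unfolding inner2 set_integrable_def .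
  show "(\<lambda>t. f t * integral {a..t} g) integrable_on {a..b}" "(\<lambda>s. g s * integral {s..b} f) integrable_on {a..b}"
    by (rule set_lebesgue_integral_eq_integral(1)[OF i1], rule set_lebesgue_integral_eq_integral(1)[OF i2])
  have "integral {a..b} (\<lambda>t. f t * integral {a..t} g) = (LINT t|lebesgue. LINT s|lebesgue. F t * (if s \<le> t then G s else 0))"
    using set_lebesgue_integral_eq_integral(2)[OF i1] unfolding inner1 set_lebesgue_integral_def by simp
  also have "\<dots> = (LINT s|lebesgue. LINT t|lebesgue. F t * (if s \<le> t then G s else 0))"
    using lebesgue_pair.Fubini_integral[OF H'] by simp
  also have "\<dots> = integral {a..b} (\<lambda>s. g s * integral {s..b} f)"
    using set_lebesgue_integral_eq_integral(2)[OF i2] unfolding inner2 set_lebesgue_integral_def by simp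
  finally show "integral {a..b} (\<lambda>t. f t * integral {a..t} g) = integral {a..b} (\<lambda>s. g s * integral {s..b} f)" .
qed

lemma absolutely_integrable_continuous_times:
  fixes f g :: "real \<Rightarrow> complex"
  assumes "continuous_on {a..b} f" "g absolutely_integrable_on {a..b}"
  shows "(\<lambda>t. f t * g t) absolutely_integrable_on {a..b}"
  by (rule absolutely_integrable_bounded_measurable_product[where h = "(*)"])
     (use assms in \<open>auto simp: bilinear_times intro!: continuous_imp_measurable_on_sets_lebesgue
        compact_imp_bounded compact_continuous_image\<close>)

text \<open>Substitute \<open>F t = F a + \<integral>\<^sub>a\<^sup>t \<phi>\<close>; the double integral that appears is the one over the triangle.\<close>

lemma integration_by_parts_indefinite:
  fixes G \<gamma> F \<phi> :: "real \<Rightarrow> complex"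
  assumes ab: "a \<le> b"
    and G: "\<And>t. t \<in> {a..b} \<Longrightarrow> (G has_vector_derivative \<gamma> t) (at t within {a..b})"
    and \<gamma>: "continuous_on {a..b} \<gamma>"
    and \<phi>: "\<phi> absolutely_integrable_on {a..b}"
    and F: "\<And>t. t \<in> {a..b} \<Longrightarrow> F t = F a + integral {a..t} \<phi>"
  shows "integral {a..b} (\<lambda>t. G t * \<phi> t) = G b * F b - G a * F a - integral {a..b} (\<lambda>t. \<gamma> t * F t)"
proof -
  have \<gamma>i: "\<gamma> absolutely_integrable_on {a..b}"
    using \<gamma> by (rule absolutely_integrable_continuous_real)
  have \<phi>int: "\<phi> integrable_on {a..b}" and \<gamma>int: "\<gamma> integrable_on {a..b}"
    by (rule set_lebesgue_integral_eq_integral(1)[OF \<phi>], rule set_lebesgue_integral_eq_integral(1)[OF \<gamma>i])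
  have Gt: "G t = G a + integral {a..t} \<gamma>" if "t \<in> {a..b}" for t
  proof -
    have "(\<gamma> has_integral (G t - G a)) {a..t}"
      using that by (intro fundamental_theorem_of_calculus)
        (auto intro: has_vector_derivative_within_subset[OF G])
    thus ?thesis by (simp add: integral_unique)
  qed
  have Fs: "integral {s..b} \<phi> = F b - F s" if "s \<in> {a..b}" for s
    using Henstock_Kurzweil_Integration.integral_combine[of a s b \<phi>] that \<phi>int F[of s] F[of b] ab by (simp add: algebra_simps)
  have "integral {a..b} (\<lambda>t. G t * \<phi> t) = integral {a..b} (\<lambda>t. G a * \<phi> t + \<phi> t * integral {a..t} \<gamma>)"
  proof (intro integral_cong)
    fix t assume t: "t \<in> {a..b}"
    show "G t * \<phi> t = G a * \<phi> t + \<phi> t * integral {a..t} \<gamma>"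
      unfolding Gt[OF t] by (simp add: algebra_simps)
  qed
  also have "\<dots> = G a * integral {a..b} \<phi> + integral {a..b} (\<lambda>t. \<phi> t * integral {a..t} \<gamma>)"
    using \<phi>int triangle_Fubini(2)[OF \<phi> \<gamma>i] by (simp add: Henstock_Kurzweil_Integration.integral_add integrable_on_mult_right)
  also have "integral {a..b} (\<lambda>t. \<phi> t * integral {a..t} \<gamma>) = integral {a..b} (\<lambda>s. \<gamma> s * integral {s..b} \<phi>)"
    by (rule triangle_Fubini(1)[OF \<phi> \<gamma>i])
  also have "\<dots> = integral {a..b} (\<lambda>s. \<gamma> s * F b - \<gamma> s * F s)"
    by (intro integral_cong) (simp add: Fs algebra_simps)
  also have "\<dots> = integral {a..b} \<gamma> * F b - integral {a..b} (\<lambda>s. \<gamma> s * F s)"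
  proof -
    have "continuous_on {a..b} (\<lambda>t. F a + integral {a..t} \<phi>)"
      using \<phi>int by (intro continuous_intros indefinite_integral_continuous_1)
    hence "continuous_on {a..b} F" by (rule continuous_on_eq) (simp add: F[symmetric])
    hence "(\<lambda>s. \<gamma> s * F s) integrable_on {a..b}"
      by (intro integrable_continuous_real continuous_intros \<gamma>)
    thus ?thesis using \<gamma>int by (simp add: Henstock_Kurzweil_Integration.integral_diff integrable_on_mult_left)
  qed
  finally show ?thesis using Gt[of b] F[of b] ab by (simp add: algebra_simps)
qed

text \<open>\<open>has_weak_second_derivative\<close> with its witness for the first derivative made visible, so that derivatives can be
  glued, shifted and integrated by parts.\<close>

definition weak_derivatives where
  "weak_derivatives u u' w \<longleftrightarrow>
     (\<forall>t. (u has_vector_derivative u' t) (at t)) \<and>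
     (\<forall>a b. a \<le> b \<longrightarrow> w absolutely_integrable_on {a..b} \<and> (w has_integral (u' b - u' a)) {a..b})"

lemma has_weak_second_derivative_iff: "has_weak_second_derivative u w \<longleftrightarrow> (\<exists>u'. weak_derivatives u u' w)"
  by (simp add: has_weak_second_derivative_def weak_derivatives_def)

text \<open>The pairing is bilinear, not sesquilinear: only then is the Wronskian \<open>bil g f' - bil g' f\<close> of two complex
  solutions constant.\<close>

definition bil :: "complex ^ 'n::finite \<Rightarrow> complex ^ 'n \<Rightarrow> complex" where
  "bil u v = (\<Sum>i\<in>UNIV. u $ i * v $ i)"

lemma weak_derivatives_continuous:
  fixes u :: "real \<Rightarrow> complex ^ 'n::finite"
  assumes "weak_derivatives u u' w"
  shows "continuous_on A u" "continuous_on A u'"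
proof -
  show "continuous_on A u"
    using assms unfolding weak_derivatives_def
    by (meson continuous_at_imp_continuous_on has_vector_derivative_continuous)
  have "isCont u' t" for t
  proof -
    have h: "(w has_integral (u' s - u' (t-1))) {t-1..s}" if "t - 1 \<le> s" for s
      using assms that unfolding weak_derivatives_def by blast
    have i: "w integrable_on {t-1..t+1}" "\<And>s. s \<in> {t-1..t+1} \<Longrightarrow> u' s = u' (t-1) + integral {t-1..s} w"
      using h[of "t+1"] integral_unique[OF h] by (auto intro: has_integral_integrable)
    have "continuous_on {t-1..t+1} (\<lambda>s. u' (t-1) + integral {t-1..s} w)"
      using i(1) by (intro continuous_intros indefinite_integral_continuous_1)
    hence "continuous_on {t-1..t+1} u'" by (rule continuous_on_eq) (simp add: i(2)[symmetric])
    hence "continuous_on {t-1<..<t+1} u'" by (rule continuous_on_subset) auto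
    thus ?thesis by (simp add: continuous_on_eq_continuous_at)
  qed
  thus "continuous_on A u'" by (simp add: continuous_at_imp_continuous_on)
qed

lemma weak_derivatives_by_parts:
  fixes f g :: "real \<Rightarrow> complex ^ 'n::finite"
  assumes ab: "a \<le> b" and f: "weak_derivatives f f' f''" and g: "weak_derivatives g g' g''"
  shows "(\<lambda>t. bil (g t) (f'' t)) absolutely_integrable_on {a..b}"
    and "integral {a..b} (\<lambda>t. bil (g t) (f'' t)) =
      bil (g b) (f' b) - bil (g a) (f' a) - integral {a..b} (\<lambda>t. bil (g' t) (f' t))"
proof -
  have f'': "f'' absolutely_integrable_on {a..b}"
    and f': "\<And>t. t \<in> {a..b} \<Longrightarrow> (f'' has_integral (f' t - f' a)) {a..t}"
    using f ab unfolding weak_derivatives_def by auto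
  have gd: "\<And>t. (g has_vector_derivative g' t) (at t)" using g by (simp add: weak_derivatives_def)
  have comp: "(\<lambda>t. f'' t $ i) absolutely_integrable_on {a..b}" for i
    using absolutely_integrable_linear[OF f'' bounded_linear_vec_nth[of i]] by (simp add: o_def)
  have cont: "continuous_on {a..b} (\<lambda>t. g t $ i)" "continuous_on {a..b} (\<lambda>t. g' t $ i)"
      "continuous_on {a..b} (\<lambda>t. f' t $ i)" for i
    using weak_derivatives_continuous[OF g] weak_derivatives_continuous[OF f]
    by (auto intro!: continuous_intros)
  have prod: "(\<lambda>t. g t $ i * f'' t $ i) absolutely_integrable_on {a..b}" for i
    by (rule absolutely_integrable_continuous_times[OF cont(1) comp])
  show "(\<lambda>t. bil (g t) (f'' t)) absolutely_integrable_on {a..b}"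
    unfolding bil_def by (rule absolutely_integrable_sum) (use prod in auto)
  have int: "(\<lambda>t. g t $ i * f'' t $ i) integrable_on {a..b}" for i
    by (rule set_lebesgue_integral_eq_integral(1)[OF prod])
  have int': "(\<lambda>t. g' t $ i * f' t $ i) integrable_on {a..b}" for i
    by (intro integrable_continuous_real continuous_intros cont)
  have part: "integral {a..b} (\<lambda>t. g t $ i * f'' t $ i) =
      g b $ i * f' b $ i - g a $ i * f' a $ i - integral {a..b} (\<lambda>t. g' t $ i * f' t $ i)" for i
  proof (rule integration_by_parts_indefinite[OF ab _ cont(2) comp])
    fix t assume t: "t \<in> {a..b}"
    show "((\<lambda>t. g t $ i) has_vector_derivative g' t $ i) (at t within {a..b})"
      using bounded_linear.has_vector_derivative[OF bounded_linear_vec_nth gd] has_vector_derivative_at_within by blast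
    show "f' t $ i = f' a $ i + integral {a..t} (\<lambda>t. f'' t $ i)"
      using has_integral_linear[OF f'[OF t] bounded_linear_vec_nth[of i]] by (simp add: o_def integral_unique)
  qed
  show "integral {a..b} (\<lambda>t. bil (g t) (f'' t)) =
      bil (g b) (f' b) - bil (g a) (f' a) - integral {a..b} (\<lambda>t. bil (g' t) (f' t))"
    unfolding bil_def using int int'
    by (simp add: integral_sum part sum_subtractf)
qed

lemma bil_commute: "bil u v = bil v u"
  by (simp add: bil_def mult.commute)

lemma Green_identity:
  fixes f g :: "real \<Rightarrow> complex ^ 'n::finite"
  assumes ab: "a \<le> b" and f: "weak_derivatives f f' f''" and g: "weak_derivatives g g' g''"
  shows "((\<lambda>t. bil (g t) (f'' t) - bil (g'' t) (f t)) has_integral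
      (bil (g b) (f' b) - bil (g' b) (f b)) - (bil (g a) (f' a) - bil (g' a) (f a))) {a..b}"
proof -
  note i = set_lebesgue_integral_eq_integral(1)[OF weak_derivatives_by_parts(1)[OF ab f g]]
    set_lebesgue_integral_eq_integral(1)[OF weak_derivatives_by_parts(1)[OF ab g f]]
  have "((\<lambda>t. bil (g t) (f'' t) - bil (f t) (g'' t)) has_integral
     (integral {a..b} (\<lambda>t. bil (g t) (f'' t)) - integral {a..b} (\<lambda>t. bil (f t) (g'' t)))) {a..b}"
    by (intro has_integral_diff integrable_integral i)
  moreover have "integral {a..b} (\<lambda>t. bil (f' t) (g' t)) = integral {a..b} (\<lambda>t. bil (g' t) (f' t))"
    by (rule arg_cong[where f = "integral {a..b}"]) (rule ext, rule bil_commute)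
  moreover have "bil (f t) (g'' t) = bil (g'' t) (f t)" for t
    by (rule bil_commute)
  ultimately show ?thesis
    unfolding weak_derivatives_by_parts(2)[OF ab f g] weak_derivatives_by_parts(2)[OF ab g f]
    by (simp add: bil_commute[of "f b"] bil_commute[of "f a"] algebra_simps)
qed

section \<open>Gluing and cut-off functions\<close>

lemma weak_derivatives_C2:
  fixes u :: "real \<Rightarrow> complex ^ 'n::finite"
  assumes "\<And>t. (u has_vector_derivative u' t) (at t)" "\<And>t. (u' has_vector_derivative w t) (at t)"
    "continuous_on UNIV w"
  shows "weak_derivatives u u' w"
  unfolding weak_derivatives_def
proof (intro conjI allI impI)
  show "(u has_vector_derivative u' t) (at t)" for t by fact
  fix a b :: real assume ab: "a \<le> b"
  show "w absolutely_integrable_on {a..b}"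
    by (rule absolutely_integrable_continuous_real[OF continuous_on_subset[OF assms(3) subset_UNIV]])
  show "(w has_integral (u' b - u' a)) {a..b}"
    by (rule fundamental_theorem_of_calculus[OF ab has_vector_derivative_at_within[OF assms(2)]])
qed

lemma weak_derivatives_add:
  fixes u v :: "real \<Rightarrow> complex ^ 'n::finite"
  assumes "weak_derivatives u u' w" "weak_derivatives v v' z"
  shows "weak_derivatives (\<lambda>t. u t + v t) (\<lambda>t. u' t + v' t) (\<lambda>t. w t + z t)"
  unfolding weak_derivatives_def
proof (intro conjI allI impI)
  show "((\<lambda>t. u t + v t) has_vector_derivative u' t + v' t) (at t)" for t
    using assms unfolding weak_derivatives_def by (intro has_vector_derivative_add) auto
  fix a b :: real assume ab: "a \<le> b"
  show "(\<lambda>t. w t + z t) absolutely_integrable_on {a..b}"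
    using assms ab unfolding weak_derivatives_def by (intro set_integral_add) auto
  have "((\<lambda>t. w t + z t) has_integral (u' b - u' a) + (v' b - v' a)) {a..b}"
    using assms ab unfolding weak_derivatives_def by (intro has_integral_add) auto
  thus "((\<lambda>t. w t + z t) has_integral (u' b + v' b - (u' a + v' a))) {a..b}"
    by (simp add: algebra_simps)
qed

lemma bounded_linear_vector_scalar: "bounded_linear (\<lambda>v. c *s v :: complex ^ 'n::finite)"
  by (intro linear_conv_bounded_linear[THEN iffD1] linearI)
     (simp_all add: vec_eq_iff algebra_simps)

lemma weak_derivatives_scale:
  fixes u :: "real \<Rightarrow> complex ^ 'n::finite"
  assumes "weak_derivatives u u' w"
  shows "weak_derivatives (\<lambda>t. c *s u t) (\<lambda>t. c *s u' t) (\<lambda>t. c *s w t)"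
  unfolding weak_derivatives_def
proof (intro conjI allI impI)
  show "((\<lambda>t. c *s u t) has_vector_derivative c *s u' t) (at t)" for t
    using assms unfolding weak_derivatives_def
    by (intro bounded_linear.has_vector_derivative[OF bounded_linear_vector_scalar]) auto
  fix a b :: real assume ab: "a \<le> b"
  hence w: "w absolutely_integrable_on {a..b}" "(w has_integral (u' b - u' a)) {a..b}"
    using assms by (auto simp: weak_derivatives_def)
  show "(\<lambda>t. c *s w t) absolutely_integrable_on {a..b}"
    using absolutely_integrable_linear[OF w(1) bounded_linear_vector_scalar[of c]] by (simp add: o_def)
  show "((\<lambda>t. c *s w t) has_integral (c *s u' b - c *s u' a)) {a..b}"
    using has_integral_linear[OF w(2) bounded_linear_vector_scalar[of c]]
    by (simp add: o_def vector_ssub_ldistrib)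
qed

text \<open>At the gluing point both one-sided derivatives exist and agree; elsewhere the function is locally one of the pieces.\<close>

lemma has_vector_derivative_glue:
  fixes u v :: "real \<Rightarrow> 'a::real_normed_vector"
  assumes u: "\<And>t. (u has_vector_derivative u' t) (at t)" and v: "\<And>t. (v has_vector_derivative v' t) (at t)"
    and eq: "u c = v c" "u' c = v' c"
  shows "((\<lambda>t. if t < c then u t else v t) has_vector_derivative (if t < c then u' t else v' t)) (at t)"
proof -
  define f where "f = (\<lambda>t. if t < c then u t else v t)"
  consider "t < c" | "t > c" | "t = c" by linarith
  hence "(f has_vector_derivative (if t < c then u' t else v' t)) (at t)"
  proof cases
    case 1
    have "(f has_vector_derivative u' t) (at t)"
      by (rule has_vector_derivative_transform_within_open[OF u, where S = "{..<c}"]) (use 1 in \<open>auto simp: f_def\<close>)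
    thus ?thesis using 1 by simp
  next
    case 2
    have "(f has_vector_derivative v' t) (at t)"
      by (rule has_vector_derivative_transform_within_open[OF v, where S = "{c<..}"]) (use 2 in \<open>auto simp: f_def\<close>)
    thus ?thesis using 2 by simp
  next
    case 3
    have "(f has_vector_derivative v' c) (at c within {..c})"
      by (rule has_vector_derivative_transform[where f = u])
         (use eq has_vector_derivative_at_within[OF u[of c], of "{..c}"] in \<open>simp_all add: f_def\<close>)
    moreover have "(f has_vector_derivative v' c) (at c within {c..})"
      by (rule has_vector_derivative_transform[where f = v])
         (use eq has_vector_derivative_at_within[OF v[of c], of "{c..}"] in \<open>simp_all add: f_def\<close>)
    moreover have "at c = sup (at c within {..c}) (at c within {c..})"
    proof -
      have "{..c} \<union> {c..} = UNIV" by auto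
      thus ?thesis by (simp flip: at_within_union)
    qed
    ultimately have "(f has_vector_derivative v' c) (at c)"
      unfolding has_vector_derivative_def has_derivative_within by (simp add: filterlim_sup)
    thus ?thesis using 3 by simp
  qed
  thus ?thesis by (simp add: f_def)
qed

lemma weak_derivatives_glue:
  fixes u v :: "real \<Rightarrow> complex ^ 'n::finite"
  assumes u: "weak_derivatives u u' w" and v: "weak_derivatives v v' z"
    and eq: "u c = v c" "u' c = v' c"
  shows "weak_derivatives (\<lambda>t. if t < c then u t else v t) (\<lambda>t. if t < c then u' t else v' t)
           (\<lambda>t. if t < c then w t else z t)"
  unfolding weak_derivatives_def
proof (intro conjI allI impI)
  show "((\<lambda>t. if t < c then u t else v t) has_vector_derivative (if t < c then u' t else v' t)) (at t)" for t
    using u v eq unfolding weak_derivatives_def by (intro has_vector_derivative_glue) auto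
  fix a b :: real assume ab: "a \<le> b"
  have w: "w absolutely_integrable_on {a..b}" and z: "z absolutely_integrable_on {a..b}"
    using u v ab by (auto simp: weak_derivatives_def)
  have "set_integrable lebesgue ({a..b} \<inter> {..<c}) w" "set_integrable lebesgue ({a..b} \<inter> {c..}) z"
    by (rule set_integrable_subset[OF w], auto, rule set_integrable_subset[OF z], auto)
  hence "integrable lebesgue (\<lambda>t. indicator ({a..b} \<inter> {..<c}) t *\<^sub>R w t + indicator ({a..b} \<inter> {c..}) t *\<^sub>R z t)"
    unfolding set_integrable_def by (rule Bochner_Integration.integrable_add)
  moreover have "(\<lambda>t. indicator ({a..b} \<inter> {..<c}) t *\<^sub>R w t + indicator ({a..b} \<inter> {c..}) t *\<^sub>R z t)
     = (\<lambda>t. indicator {a..b} t *\<^sub>R (if t < c then w t else z t))"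
    by (auto simp: indicator_def fun_eq_iff)
  ultimately show "(\<lambda>t. if t < c then w t else z t) absolutely_integrable_on {a..b}"
    by (simp add: set_integrable_def)
  have hw: "(w has_integral (u' y - u' x)) {x..y}" and hz: "(z has_integral (v' y - v' x)) {x..y}" if "x \<le> y" for x y
    using u v that by (auto simp: weak_derivatives_def)
  have L: "((\<lambda>t. if t < c then w t else z t) has_integral (u' y - u' x)) {x..y}" if "x \<le> y" "y \<le> c" for x y
    by (rule has_integral_spike_finite[OF _ _ hw[OF that(1)], of "{c}"]) (use that in auto)
  have R: "((\<lambda>t. if t < c then w t else z t) has_integral (v' y - v' x)) {x..y}" if "x \<le> y" "c \<le> x" for x y
    by (rule has_integral_eq[OF _ hz[OF that(1)]]) (use that in auto)
  consider "b < c" | "a \<ge> c" | "a < c" "c \<le> b" by linarith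
  thus "((\<lambda>t. if t < c then w t else z t) has_integral
      ((if b < c then u' b else v' b) - (if a < c then u' a else v' a))) {a..b}"
  proof cases
    case 3
    have "((\<lambda>t. if t < c then w t else z t) has_integral ((u' c - u' a) + (v' b - v' c))) {a..b}"
      by (rule has_integral_combine[of a c b, OF _ _ L R]) (use 3 in auto)
    thus ?thesis using 3 eq by simp
  qed (use L R ab in auto)
qed

lemma weak_derivatives_shift:
  fixes u :: "real \<Rightarrow> complex ^ 'n::finite"
  assumes u: "weak_derivatives u u' w"
  shows "weak_derivatives (\<lambda>t. u (t - s)) (\<lambda>t. u' (t - s)) (\<lambda>t. w (t - s))"
  unfolding weak_derivatives_def
proof (intro conjI allI impI)
  show "((\<lambda>t. u (t - s)) has_vector_derivative u' (t - s)) (at t)" for t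
  proof -
    have "(u has_vector_derivative u' (t - s)) (at (t - s))" using u by (simp add: weak_derivatives_def)
    hence "((u \<circ> (\<lambda>t. t - s)) has_vector_derivative 1 *\<^sub>R u' (t - s)) (at t)"
      by (intro vector_diff_chain_at) (auto intro!: derivative_eq_intros)
    thus ?thesis by (simp add: o_def)
  qed
  fix a b :: real assume ab: "a \<le> b"
  have sh: "((\<lambda>t. f (t - s)) has_integral i) {a..b}" if "(f has_integral i) {a - s..b - s}"
    for f :: "real \<Rightarrow> 'b::euclidean_space" and i
  proof -
    have "(\<lambda>x. x + s) ` {a - s..b - s} = {a..b}" using image_add_atLeastAtMost'[of s "a - s" "b - s"] by simp
    thus ?thesis
      using has_integral_affinity[of f i "a - s" "b - s" 1 "-s"] that by simp
  qed
  have w: "w absolutely_integrable_on {a - s..b - s}" "(w has_integral (u' (b - s) - u' (a - s))) {a - s..b - s}"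
    using u ab by (auto simp: weak_derivatives_def)
  show "(\<lambda>t. w (t - s)) absolutely_integrable_on {a..b}"
    using sh[of w] sh[of "\<lambda>t. norm (w t)"] w(1)
    unfolding absolutely_integrable_on_def integrable_on_def by auto
  show "((\<lambda>t. w (t - s)) has_integral (u' (b - s) - u' (a - s))) {a..b}"
    by (rule sh[OF w(2)])
qed

text \<open>The polynomials are \<open>(1 - t\<^sup>2)\<^sup>2\<close> and \<open>t (1 - t\<^sup>2)\<^sup>2\<close>. They vanish to second order at \<open>\<plusminus>1\<close>, which makes
  \<open>bump a b\<close> a compactly supported function with a weak second derivative, with value \<open>a\<close> and slope \<open>b\<close> at \<open>0\<close>.
  It continues arbitrary data at a point into the domain of the operator.\<close>

definition bump :: "complex ^ 'n::finite \<Rightarrow> complex ^ 'n \<Rightarrow> real \<Rightarrow> complex ^ 'n" where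
  "bump a b t = (if -1 \<le> t \<and> t < 1 then (1 - 2*t^2 + t^4) *\<^sub>R a + (t - 2*t^3 + t^5) *\<^sub>R b else 0)"

definition bump' :: "complex ^ 'n::finite \<Rightarrow> complex ^ 'n \<Rightarrow> real \<Rightarrow> complex ^ 'n" where
  "bump' a b t = (if -1 \<le> t \<and> t < 1 then (4*t^3 - 4*t) *\<^sub>R a + (1 - 6*t^2 + 5*t^4) *\<^sub>R b else 0)"

definition bump'' :: "complex ^ 'n::finite \<Rightarrow> complex ^ 'n \<Rightarrow> real \<Rightarrow> complex ^ 'n" where
  "bump'' a b t = (if -1 \<le> t \<and> t < 1 then (12*t^2 - 4) *\<^sub>R a + (20*t^3 - 12*t) *\<^sub>R b else 0)"

lemma weak_derivatives_bump: "weak_derivatives (bump a b) (bump' a b) (bump'' a b)"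
proof -
  have z: "weak_derivatives (\<lambda>t. 0 :: complex ^ 'n) (\<lambda>t. 0) (\<lambda>t. 0)"
    by (rule weak_derivatives_C2) auto
  have p: "weak_derivatives (\<lambda>t. (1 - 2*t^2 + t^4) *\<^sub>R a + (t - 2*t^3 + t^5) *\<^sub>R b)
     (\<lambda>t. (4*t^3 - 4*t) *\<^sub>R a + (1 - 6*t^2 + 5*t^4) *\<^sub>R b)
     (\<lambda>t. (12*t^2 - 4) *\<^sub>R a + (20*t^3 - 12*t) *\<^sub>R b)"
  proof (rule weak_derivatives_C2)
    show "continuous_on UNIV (\<lambda>t. (12*t^2 - 4) *\<^sub>R a + (20*t^3 - 12*t) *\<^sub>R b)"
      by (intro continuous_intros)
    fix t :: real
    have dp: "((\<lambda>t. 1 - 2*t^2 + t^4) has_real_derivative (4*t^3 - 4*t)) (at t)"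
      "((\<lambda>t. t - 2*t^3 + t^5) has_real_derivative (1 - 6*t^2 + 5*t^4)) (at t)"
      "((\<lambda>t. 4*t^3 - 4*t) has_real_derivative (12*t^2 - 4)) (at t)"
      "((\<lambda>t. 1 - 6*t^2 + 5*t^4) has_real_derivative (20*t^3 - 12*t)) (at t)"
      by (auto intro!: derivative_eq_intros)
    have d: "((\<lambda>t. f t *\<^sub>R a + g t *\<^sub>R b) has_vector_derivative f' *\<^sub>R a + g' *\<^sub>R b) (at t)"
      if "(f has_real_derivative f') (at t)" "(g has_real_derivative g') (at t)" for f g f' g'
      using that by (auto intro!: derivative_eq_intros)
    show "((\<lambda>t. (1 - 2*t^2 + t^4) *\<^sub>R a + (t - 2*t^3 + t^5) *\<^sub>R b) has_vector_derivative
        (4*t^3 - 4*t) *\<^sub>R a + (1 - 6*t^2 + 5*t^4) *\<^sub>R b) (at t)"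
      by (rule d; use dp in blast)
    show "((\<lambda>t. (4*t^3 - 4*t) *\<^sub>R a + (1 - 6*t^2 + 5*t^4) *\<^sub>R b) has_vector_derivative
        (12*t^2 - 4) *\<^sub>R a + (20*t^3 - 12*t) *\<^sub>R b) (at t)"
      by (rule d; use dp in blast)
  qed
  have "weak_derivatives (\<lambda>t. if t < 1 then if t < -1 then 0 else (1 - 2*t^2 + t^4) *\<^sub>R a + (t - 2*t^3 + t^5) *\<^sub>R b else 0)
     (\<lambda>t. if t < 1 then if t < -1 then 0 else (4*t^3 - 4*t) *\<^sub>R a + (1 - 6*t^2 + 5*t^4) *\<^sub>R b else 0)
     (\<lambda>t. if t < 1 then if t < -1 then 0 else (12*t^2 - 4) *\<^sub>R a + (20*t^3 - 12*t) *\<^sub>R b else 0)"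
    by (rule weak_derivatives_glue[OF weak_derivatives_glue[OF z p] z]) auto
  moreover have "(\<lambda>t. if t < 1 then if t < -1 then 0 else f t else 0) = (\<lambda>t. if -1 \<le> t \<and> t < 1 then f t else 0)"
    for f :: "real \<Rightarrow> complex ^ 'n" by (auto simp: fun_eq_iff)
  note this[of "\<lambda>t. (1 - 2*t^2 + t^4) *\<^sub>R a + (t - 2*t^3 + t^5) *\<^sub>R b"]
    this[of "\<lambda>t. (4*t^3 - 4*t) *\<^sub>R a + (1 - 6*t^2 + 5*t^4) *\<^sub>R b"]
    this[of "\<lambda>t. (12*t^2 - 4) *\<^sub>R a + (20*t^3 - 12*t) *\<^sub>R b"]
  ultimately show ?thesis
    unfolding bump_def[abs_def] bump'_def[abs_def] bump''_def[abs_def] by (simp only:)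
qed

lemma bump_at_0 [simp]: "bump a b 0 = a" "bump' a b 0 = b"
  by (simp_all add: bump_def bump'_def)

lemma bump_outside [simp]: "t < -1 \<Longrightarrow> bump a b t = 0" "t \<ge> 1 \<Longrightarrow> bump a b t = 0"
  "t < -1 \<Longrightarrow> bump'' a b t = 0" "t \<ge> 1 \<Longrightarrow> bump'' a b t = 0"
  by (simp_all add: bump_def bump''_def)

section \<open>Solutions of the initial value problem\<close>

text \<open>The sum of the moduli of the entries, rather than the operator norm, because its measurability and integrability follow at once from
  those of the entries.\<close>

definition entry_norm :: "complex ^ 'n::finite ^ 'n \<Rightarrow> real" where
  "entry_norm A = (\<Sum>i\<in>UNIV. \<Sum>j\<in>UNIV. cmod (A $ i $ j))"

lemma entry_norm_nonneg [simp]: "entry_norm A \<ge> 0"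
  by (simp add: entry_norm_def sum_nonneg)

lemma norm_le_sum_components: "norm (x :: complex ^ 'n::finite) \<le> (\<Sum>i\<in>UNIV. cmod (x $ i))"
  unfolding norm_vec_def by (rule L2_set_le_sum) simp

lemma norm_matrix_vector_le: "norm (A *v x) \<le> entry_norm A * norm x" for A :: "complex ^ 'n::finite ^ 'n"
proof -
  have "norm (A *v x) \<le> (\<Sum>i\<in>UNIV. cmod (\<Sum>j\<in>UNIV. A $ i $ j * x $ j))"
    using norm_le_sum_components[of "A *v x"] by (simp add: matrix_vector_mult_def)
  also have "\<dots> \<le> (\<Sum>i\<in>UNIV. \<Sum>j\<in>UNIV. cmod (A $ i $ j) * norm x)"
    by (intro sum_mono order_trans[OF norm_sum])
       (simp add: norm_mult mult_left_mono Finite_Cartesian_Product.norm_nth_le)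
  finally show ?thesis by (simp add: entry_norm_def sum_distrib_right)
qed

lemma mat_vector_mult: "mat c *v x = c *s (x :: complex ^ 'n::finite)"
  by (simp add: vec_eq_iff matrix_vector_mult_def mat_def if_distrib[of "\<lambda>x. x * _"] cong: if_cong)

lemma bilinear_matrix_vector: "bilinear (\<lambda>(x :: complex ^ 'n::finite) (A :: complex ^ 'n ^ 'n). A *v x)"
  unfolding bilinear_def
  by (auto intro!: linearI simp: vec_eq_iff matrix_vector_mult_def sum.distrib algebra_simps scaleR_sum_right)

lemma absolutely_integrable_matrix_vector:
  fixes A :: "real \<Rightarrow> complex ^ 'n::finite ^ 'n"
  assumes "A absolutely_integrable_on {a..b}" "continuous_on {a..b} y"
  shows "(\<lambda>t. A t *v y t) absolutely_integrable_on {a..b}"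
proof (rule absolutely_integrable_bounded_measurable_product[where h = "\<lambda>x A. A *v x", OF bilinear_matrix_vector])
  show "y \<in> borel_measurable (lebesgue_on {a..b})"
    by (rule continuous_imp_measurable_on_sets_lebesgue[OF assms(2)]) simp
  show "bounded (y ` {a..b})"
    by (rule compact_imp_bounded[OF compact_continuous_image[OF assms(2)]]) simp
qed (use assms in simp_all)

lemma absolutely_integrable_entry:
  fixes A :: "real \<Rightarrow> complex ^ 'n::finite ^ 'n"
  assumes "A absolutely_integrable_on S"
  shows "(\<lambda>t. A t $ i $ j) absolutely_integrable_on S"
proof -
  have "bounded_linear (\<lambda>A :: complex ^ 'n ^ 'n. A $ i $ j)"
    by (rule bounded_linear_compose[OF bounded_linear_vec_nth bounded_linear_vec_nth])
  from absolutely_integrable_linear[OF assms this] show ?thesis by (simp add: o_def)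
qed

lemma integrable_entry_norm:
  fixes A :: "real \<Rightarrow> complex ^ 'n::finite ^ 'n"
  assumes "A absolutely_integrable_on S"
  shows "(\<lambda>t. entry_norm (A t)) integrable_on S"
  unfolding entry_norm_def
  by (intro integrable_sum finite) (use absolutely_integrable_entry[OF assms] in \<open>auto simp: absolutely_integrable_on_def\<close>)

lemma norm_integral_matrix_vector_le:
  fixes A :: "real \<Rightarrow> complex ^ 'n::finite ^ 'n"
  assumes A: "A absolutely_integrable_on {0..T}" and y: "continuous_on {0..T} y"
    and t: "0 \<le> t" "t \<le> T" and B: "\<And>s. 0 \<le> s \<Longrightarrow> s \<le> t \<Longrightarrow> norm (y s) \<le> B"
  shows "norm (integral {0..t} (\<lambda>s. A s *v y s)) \<le> integral {0..T} (\<lambda>s. entry_norm (A s)) * B"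
proof -
  have B0: "B \<ge> 0" using B[of 0] t norm_ge_zero order_trans by blast
  have At: "A absolutely_integrable_on {0..t}" by (rule set_integrable_subset[OF A]) (use t in auto)
  have "norm (integral {0..t} (\<lambda>s. A s *v y s)) \<le> integral {0..t} (\<lambda>s. entry_norm (A s) * B)"
  proof (rule integral_norm_bound_integral)
    show "(\<lambda>s. A s *v y s) integrable_on {0..t}"
      by (rule set_lebesgue_integral_eq_integral(1)[OF absolutely_integrable_matrix_vector[OF At]])
         (rule continuous_on_subset[OF y], use t in auto)
    show "(\<lambda>s. entry_norm (A s) * B) integrable_on {0..t}"
      by (intro integrable_on_mult_left integrable_entry_norm At)
    show "norm (A s *v y s) \<le> entry_norm (A s) * B" if "s \<in> {0..t}" for s
      using that by (intro order_trans[OF norm_matrix_vector_le] mult_left_mono B) auto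
  qed
  also have "\<dots> = integral {0..t} (\<lambda>s. entry_norm (A s)) * B" by simp
  also have "\<dots> \<le> integral {0..T} (\<lambda>s. entry_norm (A s)) * B"
    using t B0 by (intro mult_right_mono integral_subset_le integrable_entry_norm At A) auto
  finally show ?thesis .
qed

text \<open>Picard iterates for \<open>y'' = Q y\<close>, \<open>y 0 = a\<close>, \<open>y' 0 = b\<close>. Written as a double integral for the second-order equation, the
  iteration needs only the local integrability of \<open>Q\<close>.\<close>

primrec picard :: "(real \<Rightarrow> complex ^ 'n::finite ^ 'n) \<Rightarrow> complex ^ 'n \<Rightarrow> complex ^ 'n \<Rightarrow> nat \<Rightarrow> real \<Rightarrow> complex ^ 'n" where
  "picard Q a b 0 t = a + t *\<^sub>R b"
| "picard Q a b (Suc n) t = a + t *\<^sub>R b + integral {0..t} (\<lambda>s. integral {0..s} (\<lambda>r. Q r *v picard Q a b n r))"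

definition locally_integrable :: "(real \<Rightarrow> complex ^ 'n::finite ^ 'n) \<Rightarrow> bool" where
  "locally_integrable Q \<longleftrightarrow> (\<forall>a b. Q absolutely_integrable_on {a..b})"

lemma locally_integrableD: "locally_integrable Q \<Longrightarrow> Q absolutely_integrable_on {a..b}"
  by (simp add: locally_integrable_def)

lemma continuous_on_integral_matrix_vector:
  assumes "locally_integrable Q" "continuous_on {0..T} y"
  shows "continuous_on {0..T} (\<lambda>s. integral {0..s} (\<lambda>r. Q r *v y r))"
  by (rule indefinite_integral_continuous_1)
     (rule set_lebesgue_integral_eq_integral(1)[OF absolutely_integrable_matrix_vector[OF locally_integrableD[OF assms(1)] assms(2)]])

lemma continuous_on_picard:
  assumes "locally_integrable Q"
  shows "continuous_on {0..T} (picard Q a b n)"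
proof (induction n)
  case 0
  show ?case by (simp add: picard.simps(1)[abs_def]) (intro continuous_intros)
next
  case (Suc n)
  show ?case unfolding picard.simps(2)[abs_def]
    by (intro continuous_intros indefinite_integral_continuous_1 integrable_continuous_real
          continuous_on_integral_matrix_vector assms Suc)
qed

lemma integral_power_0:
  assumes t: "0 \<le> t"
  shows "integral {0..t} (\<lambda>s. s ^ n) = t ^ Suc n / (real n + 1)"
proof -
  have d: "((\<lambda>s. s ^ Suc n / (real n + 1)) has_vector_derivative s ^ n) (at s within {0..t})" for s
  proof -
    have "((\<lambda>s. s ^ Suc n) has_real_derivative (real n + 1) * s ^ n) (at s within {0..t})"
      using DERIV_power[OF DERIV_ident, of "Suc n" s "{0..t}"] by (simp add: add.commute)
    from DERIV_cdivide[OF this, of "real n + 1"] show ?thesis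
      by (simp add: has_real_derivative_iff_has_vector_derivative)
  qed
  have "((\<lambda>s. s ^ n) has_integral (t ^ Suc n / (real n + 1) - 0 ^ Suc n / (real n + 1))) {0..t}"
    by (rule fundamental_theorem_of_calculus[OF t d])
  thus ?thesis by (simp add: integral_unique)
qed

text \<open>Each iteration integrates once against \<open>Q\<close>, which costs \<open>K\<close>, and once in \<open>t\<close>, which turns \<open>t\<^sup>n / n!\<close>
  into the next such term. The differences are thus summable uniformly in \<open>t\<close> and in every parameter that keeps \<open>K\<close> bounded.\<close>

lemma picard_step_le:
  fixes Q :: "real \<Rightarrow> complex ^ 'n::finite ^ 'n"
  assumes Q: "locally_integrable Q" and K: "integral {0..T} (\<lambda>s. entry_norm (Q s)) \<le> K"
    and t: "0 \<le> t" "t \<le> T"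
  shows "norm (picard Q a b (Suc n) t - picard Q a b n t) \<le> (norm a + T * norm b) * K ^ Suc n * t ^ Suc n / fact (Suc n)"
  using t
proof (induction n arbitrary: t)
  case (0 t)
  define C where "C = norm a + T * norm b"
  have T: "0 \<le> T" using 0 by simp
  have K0: "integral {0..T} (\<lambda>s. entry_norm (Q s)) \<ge> 0"
    by (rule Henstock_Kurzweil_Integration.integral_nonneg[OF integrable_entry_norm[OF locally_integrableD[OF Q]]]) simp
  have C: "C \<ge> 0" using T by (simp add: C_def)
  have inner: "norm (integral {0..s} (\<lambda>r. Q r *v picard Q a b 0 r)) \<le> K * C" if s: "s \<in> {0..t}" for s
  proof -
    have "norm (integral {0..s} (\<lambda>r. Q r *v picard Q a b 0 r)) \<le> integral {0..T} (\<lambda>s. entry_norm (Q s)) * C"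
    proof (rule norm_integral_matrix_vector_le[OF locally_integrableD[OF Q] continuous_on_picard[OF Q]])
      show "norm (picard Q a b 0 r) \<le> C" if "0 \<le> r" "r \<le> s" for r
        using that s 0 norm_triangle_ineq[of a "r *\<^sub>R b"] mult_right_mono[of r T "norm b"] by (simp add: C_def)
    qed (use s 0 in auto)
    also have "\<dots> \<le> K * C" using K C by (rule mult_right_mono)
    finally show ?thesis .
  qed
  have "norm (integral {0..t} (\<lambda>s. integral {0..s} (\<lambda>r. Q r *v picard Q a b 0 r))) \<le> integral {0..t} (\<lambda>s. K * C)"
    by (intro integral_norm_bound_integral inner integrable_continuous_real continuous_on_integral_matrix_vector Q
          continuous_on_picard continuous_intros)
  thus ?case using 0 by (simp add: C_def mult_ac)
next
  case (Suc n t)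
  define C where "C = norm a + T * norm b"
  have T: "0 \<le> T" using Suc by simp
  have K0: "integral {0..T} (\<lambda>s. entry_norm (Q s)) \<ge> 0"
    by (rule Henstock_Kurzweil_Integration.integral_nonneg[OF integrable_entry_norm[OF locally_integrableD[OF Q]]]) simp
  have C: "C \<ge> 0" using T by (simp add: C_def)
  have K1: "K \<ge> 0" using K K0 by simp
  have c: "continuous_on {0..x} (\<lambda>s. integral {0..s} (\<lambda>r. Q r *v picard Q a b m r))" for x m
    by (intro continuous_on_integral_matrix_vector Q continuous_on_picard)
  have i: "(\<lambda>r. Q r *v picard Q a b m r) integrable_on {0..s}" for m s
    by (rule set_lebesgue_integral_eq_integral(1)[OF absolutely_integrable_matrix_vector[OF locally_integrableD[OF Q] continuous_on_picard[OF Q]]])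
  have eq: "picard Q a b (Suc (Suc n)) t - picard Q a b (Suc n) t =
     integral {0..t} (\<lambda>s. integral {0..s} (\<lambda>r. Q r *v (picard Q a b (Suc n) r - picard Q a b n r)))"
  proof -
    have "integral {0..s} (\<lambda>r. Q r *v (picard Q a b (Suc n) r - picard Q a b n r)) =
       integral {0..s} (\<lambda>r. Q r *v picard Q a b (Suc n) r) - integral {0..s} (\<lambda>r. Q r *v picard Q a b n r)" for s
      unfolding matrix_vector_mult_diff_distrib by (rule Henstock_Kurzweil_Integration.integral_diff[OF i i])
    hence "integral {0..t} (\<lambda>s. integral {0..s} (\<lambda>r. Q r *v (picard Q a b (Suc n) r - picard Q a b n r))) =
       integral {0..t} (\<lambda>s. integral {0..s} (\<lambda>r. Q r *v picard Q a b (Suc n) r)) - integral {0..t} (\<lambda>s. integral {0..s} (\<lambda>r. Q r *v picard Q a b n r))"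
      by (simp only: Henstock_Kurzweil_Integration.integral_diff[OF integrable_continuous_real[OF c] integrable_continuous_real[OF c]])
    thus ?thesis unfolding picard.simps(2)[of Q a b "Suc n"] picard.simps(2)[of Q a b n] by simp
  qed
  have cd: "continuous_on {0..T} (\<lambda>r. picard Q a b (Suc n) r - picard Q a b n r)"
    by (intro continuous_intros continuous_on_picard Q)
  have inner: "norm (integral {0..s} (\<lambda>r. Q r *v (picard Q a b (Suc n) r - picard Q a b n r)))
      \<le> C * K ^ Suc (Suc n) / fact (Suc n) * s ^ Suc n" if s: "s \<in> {0..t}" for s
  proof -
    have "norm (integral {0..s} (\<lambda>r. Q r *v (picard Q a b (Suc n) r - picard Q a b n r)))
       \<le> integral {0..T} (\<lambda>s. entry_norm (Q s)) * (C * K ^ Suc n * s ^ Suc n / fact (Suc n))"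
    proof (rule norm_integral_matrix_vector_le[OF locally_integrableD[OF Q] cd])
      fix r assume r: "0 \<le> r" "r \<le> s"
      have "norm (picard Q a b (Suc n) r - picard Q a b n r) \<le> C * K ^ Suc n * r ^ Suc n / fact (Suc n)"
        using Suc.IH[of r] r s Suc.prems by (simp add: C_def)
      also have "\<dots> \<le> C * K ^ Suc n * s ^ Suc n / fact (Suc n)"
        using r C K1 by (intro divide_right_mono mult_left_mono power_mono mult_nonneg_nonneg zero_le_power) auto
      finally show "norm (picard Q a b (Suc n) r - picard Q a b n r) \<le> C * K ^ Suc n * s ^ Suc n / fact (Suc n)" .
    qed (use s Suc.prems in auto)
    also have "\<dots> \<le> K * (C * K ^ Suc n * s ^ Suc n / fact (Suc n))"
      using K C K1 s by (intro mult_right_mono divide_nonneg_nonneg mult_nonneg_nonneg zero_le_power) auto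
    finally show ?thesis by (simp add: mult_ac)
  qed
  have "norm (picard Q a b (Suc (Suc n)) t - picard Q a b (Suc n) t) \<le>
      integral {0..t} (\<lambda>s. C * K ^ Suc (Suc n) / fact (Suc n) * s ^ Suc n)"
    unfolding eq
    by (intro integral_norm_bound_integral inner integrable_continuous_real continuous_on_integral_matrix_vector Q
          continuous_on_subset[OF cd] continuous_intros) (use Suc.prems in auto)
  also have "\<dots> = C * K ^ Suc (Suc n) / fact (Suc n) * (t ^ Suc (Suc n) / (real (Suc n) + 1))"
    using Suc.prems by (simp only: integral_mult_right integral_power_0)
  also have "\<dots> = C * K ^ Suc (Suc n) * t ^ Suc (Suc n) / fact (Suc (Suc n))"
    by (simp only: fact_Suc[of "Suc n"]) (simp add: field_simps del: fact_Suc power_Suc)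
  finally show ?case by (simp only: C_def)
qed

text \<open>The limit of the Picard iterates for \<open>t \<ge> 0\<close>. To the left of \<open>0\<close> the solution is continued by a straight line, which
  preserves differentiability at \<open>0\<close>; every use of \<open>sol\<close> as a solution is on \<open>t \<ge> 0\<close>.\<close>

definition sol :: "(real \<Rightarrow> complex ^ 'n::finite ^ 'n) \<Rightarrow> complex ^ 'n \<Rightarrow> complex ^ 'n \<Rightarrow> real \<Rightarrow> complex ^ 'n" where
  "sol Q a b t = (if t < 0 then a + t *\<^sub>R b
     else a + t *\<^sub>R b + (\<Sum>n. picard Q a b (Suc n) t - picard Q a b n t))"

text \<open>Uniformity in the parameter \<open>x\<close> is what makes \<open>sol\<close> holomorphic in the energy later on.\<close>

lemma uniform_limit_picard:
  fixes Q :: "'x \<Rightarrow> real \<Rightarrow> complex ^ 'n::finite ^ 'n"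
  assumes Q: "\<And>x. x \<in> X \<Longrightarrow> locally_integrable (Q x)"
    and K: "\<And>x. x \<in> X \<Longrightarrow> integral {0..T} (\<lambda>s. entry_norm (Q x s)) \<le> K"
  shows "uniform_limit (X \<times> {0..T}) (\<lambda>n (x, t). picard (Q x) a b n t) (\<lambda>(x, t). sol (Q x) a b t) sequentially"
proof (cases "T \<ge> 0 \<and> X \<noteq> {}")
  case True
  hence T: "T \<ge> 0" by simp
  obtain x0 where x0: "x0 \<in> X" using True by auto
  have "0 \<le> integral {0..T} (\<lambda>s. entry_norm (Q x0 s))"
    by (rule Henstock_Kurzweil_Integration.integral_nonneg[OF integrable_entry_norm[OF locally_integrableD[OF Q[OF x0]]]]) simp
  hence K0: "K \<ge> 0" using K[OF x0] by simp
  define f where "f = (\<lambda>n (x,t). picard (Q x) a b (Suc n) t - picard (Q x) a b n t)"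
  have "uniform_limit (X \<times> {0..T}) (\<lambda>n z. \<Sum>i<n. f i z) (\<lambda>z. suminf (\<lambda>i. f i z)) sequentially"
  proof (rule Weierstrass_m_test)
    show "summable (\<lambda>n. (norm a + T * norm b) * ((K * T) ^ Suc n / fact (Suc n)))"
      by (intro summable_mult summable_Suc_iff[THEN iffD2]) (use summable_exp[of "K * T"] in \<open>simp add: field_simps\<close>)
    fix n z assume z: "z \<in> X \<times> {0..T}"
    obtain x t where xt: "z = (x,t)" "x \<in> X" "0 \<le> t" "t \<le> T" using z by auto
    have "norm (f n z) \<le> (norm a + T * norm b) * K ^ Suc n * t ^ Suc n / fact (Suc n)"
      unfolding f_def xt prod.case by (rule picard_step_le[OF Q[OF xt(2)] K[OF xt(2)] xt(3,4)])
    also have "\<dots> \<le> (norm a + T * norm b) * K ^ Suc n * T ^ Suc n / fact (Suc n)"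
      using xt T K0 by (intro divide_right_mono mult_left_mono power_mono mult_nonneg_nonneg zero_le_power) auto
    finally show "norm (f n z) \<le> (norm a + T * norm b) * ((K * T) ^ Suc n / fact (Suc n))"
      by (simp add: power_mult_distrib mult_ac del: power_Suc fact_Suc)
  qed
  hence "uniform_limit (X \<times> {0..T}) (\<lambda>n z. (a + snd z *\<^sub>R b) + (\<Sum>i<n. f i z)) (\<lambda>z. (a + snd z *\<^sub>R b) + suminf (\<lambda>i. f i z)) sequentially"
    by (rule uniform_limit_add[OF uniform_limit_const])
  moreover have "(a + snd z *\<^sub>R b) + (\<Sum>i<n. f i z) = (case z of (x, t) \<Rightarrow> picard (Q x) a b n t)" for n z
    using sum_lessThan_telescope[of "\<lambda>i. picard (Q (fst z)) a b i (snd z)" n]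
    by (cases z) (simp add: f_def del: picard.simps(2))
  moreover have "(a + snd z *\<^sub>R b) + suminf (\<lambda>i. f i z) = (case z of (x, t) \<Rightarrow> sol (Q x) a b t)"
    if "z \<in> X \<times> {0..T}" for z
    using that by (cases z) (simp add: f_def sol_def del: picard.simps(2))
  ultimately show ?thesis by (simp cong: uniform_limit_cong')
next
  case False
  hence E: "X \<times> {0..T} = {}" by auto
  show ?thesis unfolding E uniform_limit_iff by simp
qed

lemma uniform_limit_slice:
  assumes "uniform_limit (X \<times> S) f g F" "x \<in> X"
  shows "uniform_limit S (\<lambda>n t. f n (x, t)) (\<lambda>t. g (x, t)) F"
  unfolding uniform_limit_iff
proof (intro allI impI)
  fix e :: real assume "e > 0"
  hence "\<forall>\<^sub>F n in F. \<forall>z\<in>X \<times> S. dist (f n z) (g z) < e" using assms(1) by (simp only: uniform_limit_iff)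
  thus "\<forall>\<^sub>F n in F. \<forall>t\<in>S. dist (f n (x, t)) (g (x, t)) < e"
    by eventually_elim (use assms(2) in blast)
qed

lemma uniform_limit_picard_single:
  assumes "locally_integrable Q"
  shows "uniform_limit {0..T} (picard Q a b) (sol Q a b) sequentially"
proof -
  have "uniform_limit (UNIV \<times> {0..T}) (\<lambda>n (x::unit, t). picard Q a b n t) (\<lambda>(x, t). sol Q a b t) sequentially"
    by (rule uniform_limit_picard) (use assms in auto)
  from uniform_limit_slice[OF this UNIV_I] show ?thesis by simp
qed

lemma continuous_on_sol:
  assumes "locally_integrable Q"
  shows "continuous_on {0..T} (sol Q a b)"
  by (rule uniform_limit_theorem[OF _ uniform_limit_picard_single[OF assms]])
     (auto intro: always_eventually continuous_on_picard[OF assms])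

lemma norm_sol_le:
  fixes Q :: "real \<Rightarrow> complex ^ 'n::finite ^ 'n"
  assumes Q: "locally_integrable Q" and K: "integral {0..T} (\<lambda>s. entry_norm (Q s)) \<le> K"
    and t: "0 \<le> t" "t \<le> T"
  shows "norm (sol Q a b t) \<le> (norm a + T * norm b) * exp (K * T)"
proof (rule Lim_bounded)
  show "(\<lambda>n. norm (picard Q a b n t)) \<longlonglongrightarrow> norm (sol Q a b t)"
    by (intro tendsto_norm tendsto_uniform_limitI[OF uniform_limit_picard_single[OF Q]]) (use t in auto)
  have "0 \<le> integral {0..T} (\<lambda>s. entry_norm (Q s))"
    by (rule Henstock_Kurzweil_Integration.integral_nonneg[OF integrable_entry_norm[OF locally_integrableD[OF Q]]]) simp
  hence K0: "K \<ge> 0" using K by simp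
  define C where "C = norm a + T * norm b"
  have C: "C \<ge> 0" using t by (simp add: C_def)
  have "norm (picard Q a b n t) \<le> C * (\<Sum>k<Suc n. (K * T) ^ k / fact k)" for n
  proof (induction n)
    case 0
    show ?case using t norm_triangle_ineq[of a "t *\<^sub>R b"] mult_right_mono[of t T "norm b"] by (simp add: C_def)
  next
    case (Suc n)
    have "norm (picard Q a b (Suc n) t) \<le> norm (picard Q a b n t) + norm (picard Q a b (Suc n) t - picard Q a b n t)"
      by (rule norm_triangle_sub)
    also have "norm (picard Q a b (Suc n) t - picard Q a b n t) \<le> C * K ^ Suc n * t ^ Suc n / fact (Suc n)"
      unfolding C_def by (rule picard_step_le[OF Q K t])
    also have "\<dots> \<le> C * K ^ Suc n * T ^ Suc n / fact (Suc n)"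
      using t K0 C by (intro divide_right_mono mult_left_mono power_mono mult_nonneg_nonneg zero_le_power) auto
    finally show ?case using Suc
      by (simp add: sum.lessThan_Suc[of _ "Suc n"] distrib_left power_mult_distrib mult.assoc del: picard.simps(2) power_Suc fact_Suc sum.lessThan_Suc)
  qed
  also have "C * (\<Sum>k<Suc n. (K * T) ^ k / fact k) \<le> C * exp (K * T)" for n
  proof (intro mult_left_mono C)
    have "(\<Sum>k<Suc n. (K * T) ^ k /\<^sub>R fact k) \<le> exp (K * T)"
      unfolding exp_def by (rule sum_le_suminf[OF summable_exp_generic]) (use K0 t in auto)
    thus "(\<Sum>k<Suc n. (K * T) ^ k / fact k) \<le> exp (K * T)" by (simp add: divide_inverse mult.commute)
  qed
  finally have "norm (picard Q a b n t) \<le> C * exp (K * T)" for n .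
  thus "\<forall>n\<ge>0. norm (picard Q a b n t) \<le> (norm a + T * norm b) * exp (K * T)" by (simp add: C_def)
qed

text \<open>The derivative of \<open>sol\<close>; over negative \<open>t\<close> the integral is empty and the value is the slope \<open>b\<close> of the straight line.\<close>

definition sol' :: "(real \<Rightarrow> complex ^ 'n::finite ^ 'n) \<Rightarrow> complex ^ 'n \<Rightarrow> complex ^ 'n \<Rightarrow> real \<Rightarrow> complex ^ 'n" where
  "sol' Q a b t = b + integral {0..t} (\<lambda>s. Q s *v sol Q a b s)"

lemma uniform_limit_integral_picard:
  fixes Q :: "'x \<Rightarrow> real \<Rightarrow> complex ^ 'n::finite ^ 'n"
  assumes Q: "\<And>x. x \<in> X \<Longrightarrow> locally_integrable (Q x)"
    and K: "\<And>x. x \<in> X \<Longrightarrow> integral {0..T} (\<lambda>s. entry_norm (Q x s)) \<le> K"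
  shows "uniform_limit (X \<times> {0..T}) (\<lambda>n (x, t). b + integral {0..t} (\<lambda>s. Q x s *v picard (Q x) a b n s))
     (\<lambda>(x, t). sol' (Q x) a b t) sequentially"
  unfolding uniform_limit_iff
proof (intro allI impI)
  fix e :: real assume e: "e > 0"
  define k where "k = \<bar>K\<bar> + 1"
  have k: "k > 0" "K \<le> k" by (auto simp: k_def)
  define d where "d = e / (2 * k)"
  have d: "d > 0" using e k by (simp add: d_def)
  have u: "uniform_limit (X \<times> {0..T}) (\<lambda>n (x, t). picard (Q x) a b n t) (\<lambda>(x, t). sol (Q x) a b t) sequentially"
    by (rule uniform_limit_picard[OF Q K])
  from uniform_limitD[OF u d]
  have "\<forall>\<^sub>F n in sequentially. \<forall>z\<in>X \<times> {0..T}. dist (case z of (x, t) \<Rightarrow> picard (Q x) a b n t) (case z of (x, t) \<Rightarrow> sol (Q x) a b t) < d" .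
  thus "\<forall>\<^sub>F n in sequentially. \<forall>z\<in>X \<times> {0..T}. dist (case z of (x, t) \<Rightarrow> b + integral {0..t} (\<lambda>s. Q x s *v picard (Q x) a b n s))
       (case z of (x, t) \<Rightarrow> sol' (Q x) a b t) < e"
  proof eventually_elim
    case (elim n)
    show ?case
    proof
      fix z assume z: "z \<in> X \<times> {0..T}"
      obtain x t where xt: "z = (x,t)" "x \<in> X" "0 \<le> t" "t \<le> T" using z by auto
      note Qx = Q[OF xt(2)]
      have c: "continuous_on {0..T} (picard (Q x) a b n)" "continuous_on {0..T} (sol (Q x) a b)"
        by (rule continuous_on_picard[OF Qx], rule continuous_on_sol[OF Qx])
      have i: "(\<lambda>s. Q x s *v picard (Q x) a b n s) integrable_on {0..t}" "(\<lambda>s. Q x s *v sol (Q x) a b s) integrable_on {0..t}"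
        by (rule set_lebesgue_integral_eq_integral(1)[OF absolutely_integrable_matrix_vector[OF locally_integrableD[OF Qx]]],
            rule continuous_on_picard[OF Qx] continuous_on_sol[OF Qx])+
      have "dist (b + integral {0..t} (\<lambda>s. Q x s *v picard (Q x) a b n s)) (sol' (Q x) a b t)
         = norm (integral {0..t} (\<lambda>s. Q x s *v (picard (Q x) a b n s - sol (Q x) a b s)))"
        unfolding sol'_def matrix_vector_mult_diff_distrib Henstock_Kurzweil_Integration.integral_diff[OF i]
        by (simp add: dist_norm)
      also have "\<dots> \<le> integral {0..T} (\<lambda>s. entry_norm (Q x s)) * d"
      proof (rule norm_integral_matrix_vector_le[OF locally_integrableD[OF Qx] continuous_on_diff[OF c] xt(3,4)])
        fix s assume "0 \<le> s" "s \<le> t"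
        hence "(x, s) \<in> X \<times> {0..T}" using xt by auto
        from elim[rule_format, OF this] show "norm (picard (Q x) a b n s - sol (Q x) a b s) \<le> d" by (simp add: dist_norm)
      qed
      also have "\<dots> \<le> k * d"
        using K[OF xt(2)] d k by (intro mult_right_mono) auto
      also have "\<dots> < e" using e k by (simp add: d_def)
      finally show "dist (case z of (x, t) \<Rightarrow> b + integral {0..t} (\<lambda>s. Q x s *v picard (Q x) a b n s))
          (case z of (x, t) \<Rightarrow> sol' (Q x) a b t) < e" by (simp add: xt)
    qed
  qed
qed

lemma sol_eq_integral_sol':
  assumes Q: "locally_integrable Q" and t: "t \<ge> 0"
  shows "sol Q a b t = a + integral {0..t} (sol' Q a b)"
proof -
  define D where "D = (\<lambda>n s. b + integral {0..s} (\<lambda>s. Q s *v picard Q a b n s))"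
  have "uniform_limit (UNIV \<times> {0..t}) (\<lambda>n (x::unit, t). b + integral {0..t} (\<lambda>s. Q s *v picard Q a b n s))
     (\<lambda>(x, t). sol' Q a b t) sequentially"
    by (rule uniform_limit_integral_picard) (use Q in auto)
  from uniform_limit_slice[OF this UNIV_I] have u: "uniform_limit {0..t} D (sol' Q a b) sequentially"
    by (simp add: D_def)
  have c: "continuous_on {0..t} (D n)" for n
    unfolding D_def by (intro continuous_intros continuous_on_integral_matrix_vector Q continuous_on_picard)
  obtain I J where IJ: "\<And>n. (D n has_integral I n) {0..t}" "(sol' Q a b has_integral J) {0..t}" "I \<longlonglongrightarrow> J"
    using uniform_limit_integral[OF u c] by auto
  have "(\<lambda>n. integral {0..t} (D n)) \<longlonglongrightarrow> integral {0..t} (sol' Q a b)"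
    using IJ by (simp add: integral_unique[OF IJ(1)] integral_unique[OF IJ(2)])
  hence "(\<lambda>n. a + integral {0..t} (D n)) \<longlonglongrightarrow> a + integral {0..t} (sol' Q a b)"
    by (intro tendsto_intros)
  moreover have eq: "a + integral {0..t} (D n) = picard Q a b (Suc n) t" for n
  proof -
    have "integral {0..t} (D n) = integral {0..t} (\<lambda>s. b) + integral {0..t} (\<lambda>s. integral {0..s} (\<lambda>s. Q s *v picard Q a b n s))"
      unfolding D_def
      by (intro Henstock_Kurzweil_Integration.integral_add integrable_continuous_real continuous_intros
            continuous_on_integral_matrix_vector Q continuous_on_picard)
    thus ?thesis using t by (simp add: add.assoc)
  qed
  ultimately have "(\<lambda>n. picard Q a b (Suc n) t) \<longlonglongrightarrow> a + integral {0..t} (sol' Q a b)"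
    by (simp only: eq)
  moreover have "(\<lambda>n. picard Q a b (Suc n) t) \<longlonglongrightarrow> sol Q a b t"
    by (intro LIMSEQ_Suc tendsto_uniform_limitI[OF uniform_limit_picard_single[OF Q]]) (use t in auto)
  ultimately show ?thesis by (rule LIMSEQ_unique[symmetric])
qed

lemma sol_negative: "t < 0 \<Longrightarrow> sol Q a b t = a + t *\<^sub>R b"
  by (simp add: sol_def)

lemma sol'_nonpos: "t \<le> 0 \<Longrightarrow> sol' Q a b t = b"
  by (cases "t = 0") (auto simp: sol'_def)

lemma sol_at_0: "locally_integrable Q \<Longrightarrow> sol Q a b 0 = a"
  using sol_eq_integral_sol'[of Q 0 a b] by simp

lemma weak_derivatives_sol:
  fixes Q :: "real \<Rightarrow> complex ^ 'n::finite ^ 'n"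
  assumes Q: "locally_integrable Q"
  shows "weak_derivatives (sol Q a b) (sol' Q a b) (\<lambda>t. if t < 0 then 0 else Q t *v sol Q a b t)"
proof -
  define w where "w = (\<lambda>t. if t < 0 then 0 else Q t *v sol Q a b t)"
  have wi: "w absolutely_integrable_on {c..d}" for c d
  proof -
    have "continuous_on {c..d} (\<lambda>t. sol Q a b (max 0 t))"
      by (rule continuous_on_compose2[OF continuous_on_sol[OF Q, of "max 0 d"]]) (auto intro!: continuous_intros)
    hence "set_integrable lebesgue {c..d} (\<lambda>t. Q t *v sol Q a b (max 0 t))"
      by (rule absolutely_integrable_matrix_vector[OF locally_integrableD[OF Q]])
    hence "set_integrable lebesgue ({c..d} \<inter> {0..}) (\<lambda>t. Q t *v sol Q a b (max 0 t))"
      by (rule set_integrable_subset) auto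
    moreover have "(\<lambda>t. indicator ({c..d} \<inter> {0..}) t *\<^sub>R (Q t *v sol Q a b (max 0 t))) = (\<lambda>t. indicator {c..d} t *\<^sub>R w t)"
      by (auto simp: indicator_def w_def fun_eq_iff max_def)
    ultimately show ?thesis by (simp only: set_integrable_def)
  qed
  have wint: "w integrable_on {c..d}" for c d
    by (rule set_lebesgue_integral_eq_integral(1)[OF wi])
  have I: "integral {-M..t} w = sol' Q a b t - b" if M: "M \<ge> 0" "-M \<le> t" for M t
  proof (cases "t < 0")
    case True
    have "integral {-M..t} w = integral {-M..t} (\<lambda>_. 0)"
      by (rule integral_cong) (use True in \<open>auto simp: w_def\<close>)
    thus ?thesis using True by (simp add: sol'_nonpos)
  next
    case False
    have "(w has_integral 0) {-M..0}"
      by (rule has_integral_spike_finite[of "{0}" _ _ "\<lambda>_. 0"]) (auto simp: w_def)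
    moreover have "integral {0..t} w = integral {0..t} (\<lambda>s. Q s *v sol Q a b s)"
      by (rule integral_cong) (auto simp: w_def)
    ultimately show ?thesis
      using Henstock_Kurzweil_Integration.integral_combine[OF _ _ wint, of "-M" 0 t] M False
      by (simp add: sol'_def integral_unique)
  qed
  have hw: "(w has_integral (sol' Q a b d - sol' Q a b c)) {c..d}" if "c \<le> d" for c d
  proof -
    define M where "M = \<bar>c\<bar>"
    have M: "M \<ge> 0" "-M \<le> c" "-M \<le> d" using that by (auto simp: M_def)
    have eq: "integral {-M..c} w + integral {c..d} w = integral {-M..d} w"
      by (rule Henstock_Kurzweil_Integration.integral_combine[OF M(2) that wint])
    have "integral {c..d} w = integral {-M..d} w - integral {-M..c} w"
      by (simp flip: eq)
    hence "integral {c..d} w = sol' Q a b d - sol' Q a b c"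
      by (simp only: I[OF M(1,2)] I[OF M(1,3)]) simp
    thus ?thesis using integrable_integral[OF wint[of c d]] by simp
  qed
  have cont: "continuous_on {-M..M} (sol' Q a b)" if "M \<ge> 0" for M
  proof (rule continuous_on_eq)
    show "continuous_on {-M..M} (\<lambda>t. b + integral {-M..t} w)"
      by (intro continuous_intros indefinite_integral_continuous_1 wint)
    show "b + integral {-M..t} w = sol' Q a b t" if "t \<in> {-M..M}" for t
      using I[of M t] that \<open>M \<ge> 0\<close> by simp
  qed
  have S: "sol Q a b t = sol Q a b (-M) + integral {-M..t} (sol' Q a b)" if M: "M > 0" "t \<in> {-M..M}" for M t
  proof -
    have *: "integral {-M..s} (sol' Q a b) = (s + M) *\<^sub>R b" if "s \<le> 0" "-M \<le> s" for s
    proof -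
      have "integral {-M..s} (sol' Q a b) = integral {-M..s} (\<lambda>_. b)"
        by (rule integral_cong) (use that in \<open>auto simp: sol'_nonpos\<close>)
      thus ?thesis using that by simp
    qed
    show ?thesis
    proof (cases "t < 0")
      case True
      thus ?thesis using *[of t] M by (simp add: sol_negative algebra_simps)
    next
      case False
      have "integral {-M..0} (sol' Q a b) + integral {0..t} (sol' Q a b) = integral {-M..t} (sol' Q a b)"
        by (rule Henstock_Kurzweil_Integration.integral_combine)
           (use False M in \<open>auto intro!: integrable_continuous_real continuous_on_subset[OF cont[of M]]\<close>)
      thus ?thesis using *[of 0] M False sol_eq_integral_sol'[OF Q, of t a b]
        by (simp add: sol_negative algebra_simps)
    qed
  qed
  show ?thesis
    unfolding weak_derivatives_def w_def[symmetric]
  proof (intro conjI allI impI wi hw)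
    fix t :: real
    define M where "M = \<bar>t\<bar> + 1"
    have M: "M > 0" "t \<in> {-M<..<M}" by (auto simp: M_def)
    have "((\<lambda>t. integral {-M..t} (sol' Q a b)) has_vector_derivative sol' Q a b t) (at t within {-M..M})"
      by (rule integral_has_vector_derivative[OF cont]) (use M in auto)
    hence "((\<lambda>t. integral {-M..t} (sol' Q a b)) has_vector_derivative sol' Q a b t) (at t within {-M<..<M})"
      by (rule has_vector_derivative_within_subset) auto
    hence "((\<lambda>t. integral {-M..t} (sol' Q a b)) has_vector_derivative sol' Q a b t) (at t)"
      by (subst (asm) has_vector_derivative_within_open) (use M in auto)
    hence d: "((\<lambda>t. sol Q a b (-M) + integral {-M..t} (sol' Q a b)) has_vector_derivative 0 + sol' Q a b t) (at t)"
      by (intro has_vector_derivative_add has_vector_derivative_const)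
    have "(sol Q a b has_vector_derivative 0 + sol' Q a b t) (at t)"
    proof (rule has_vector_derivative_transform_within_open[OF d, where S = "{-M<..<M}"])
      show "sol Q a b (- M) + integral {- M..s} (sol' Q a b) = sol Q a b s" if "s \<in> {-M<..<M}" for s
        by (rule S[symmetric]) (use that M in auto)
    qed (use M in auto)
    thus "(sol Q a b has_vector_derivative sol' Q a b t) (at t)" by simp
  qed
qed

lemma locally_integrable_shifted:
  assumes "locally_integrable V"
  shows "locally_integrable (\<lambda>r. V r - mat c)"
  unfolding locally_integrable_def
  by (intro allI set_integral_diff locally_integrableD[OF assms] absolutely_integrable_continuous_real continuous_intros)

text \<open>One Picard step raises the degree in the energy \<open>c\<close> by one, with coefficients continuous in \<open>t\<close>.\<close>

lemma polynomial_step: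
  fixes V :: "real \<Rightarrow> complex ^ 'n::finite ^ 'n"
  assumes V: "locally_integrable V" and q: "\<And>i. continuous_on {0..T} (q i)"
    and F: "\<And>c t. t \<in> {0..T} \<Longrightarrow> F c t = (\<Sum>i\<le>n. c ^ i *s q i t)"
  shows "\<exists>e. (\<forall>i. continuous_on {0..T} (e i)) \<and>
    (\<forall>c. \<forall>t\<in>{0..T}. integral {0..t} (\<lambda>r. (V r - mat c) *v F c r) = (\<Sum>i\<le>Suc n. c ^ i *s e i t))"
proof -
  define g where "g i r = (if i \<le> n then V r *v q i r else 0) - (if i = 0 then 0 else q (i - 1) r)" for i r
  define e where "e i t = integral {0..t} (g i)" for i t
  have zi: "(\<lambda>r. 0 :: complex ^ 'n) integrable_on {0..T}"
    by (rule has_integral_integrable[OF has_integral_0])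
  have gi: "g i integrable_on {0..T}" for i
  proof -
    have "(\<lambda>r. if i \<le> n then V r *v q i r else 0) integrable_on {0..T}"
    proof -
      have "(\<lambda>r. V r *v q i r) integrable_on {0..T}"
        by (rule set_lebesgue_integral_eq_integral(1)[OF absolutely_integrable_matrix_vector[OF locally_integrableD[OF V] q]])
      thus ?thesis by (cases "i \<le> n") (simp_all add: zi)
    qed
    moreover have "(\<lambda>r. if i = 0 then 0 else q (i - 1) r) integrable_on {0..T}"
      using integrable_continuous_real[OF q[of "i - 1"]] by (cases "i = 0") (simp_all add: zi)
    ultimately show ?thesis unfolding g_def[abs_def] by (rule Henstock_Kurzweil_Integration.integrable_diff)
  qed
  show ?thesis
  proof (intro exI[of _ e] conjI allI ballI)
    show "continuous_on {0..T} (e i)" for i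
      unfolding e_def[abs_def] by (rule indefinite_integral_continuous_1[OF gi])
    fix c t assume t: "t \<in> {0..T}"
    have git: "g i integrable_on {0..t}" for i by (rule integrable_subinterval_real[OF gi]) (use t in auto)
    have "(V r - mat c) *v F c r = (\<Sum>i\<le>Suc n. c ^ i *s g i r)" if r: "r \<in> {0..t}" for r
    proof -
      have lin: "V r *v (\<Sum>i\<le>n. c ^ i *s q i r) = (\<Sum>i\<le>n. c ^ i *s (V r *v q i r))"
        by (induction n) (simp_all add: matrix_vector_right_distrib vector_scalar_commute)
      have "(\<Sum>i\<le>Suc n. c ^ i *s g i r) = (\<Sum>i\<le>Suc n. c ^ i *s (if i \<le> n then V r *v q i r else 0))
          - (\<Sum>i\<le>Suc n. c ^ i *s (if i = 0 then 0 else q (i - 1) r))"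
        by (simp add: g_def vector_ssub_ldistrib sum_subtractf)
      also have "(\<Sum>i\<le>Suc n. c ^ i *s (if i \<le> n then V r *v q i r else 0)) = (\<Sum>i\<le>n. c ^ i *s (V r *v q i r))"
        by simp
      also have "(\<Sum>i\<le>Suc n. c ^ i *s (if i = 0 then 0 else q (i - 1) r)) = (\<Sum>i\<le>n. c *s (c ^ i *s q i r))"
        by (subst sum.atMost_Suc_shift) (simp add: vector_smult_assoc)
      also have "\<dots> = c *s (\<Sum>i\<le>n. c ^ i *s q i r)"
        by (induction n) (simp_all add: vector_add_ldistrib)
      finally show ?thesis using F[of r c] r t lin by (simp add: matrix_vector_mult_diff_rdistrib mat_vector_mult)
    qed
    hence "integral {0..t} (\<lambda>r. (V r - mat c) *v F c r) = integral {0..t} (\<lambda>r. \<Sum>i\<le>Suc n. c ^ i *s g i r)"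
      by (intro integral_cong)
    also have "\<dots> = (\<Sum>i\<le>Suc n. integral {0..t} (\<lambda>r. c ^ i *s g i r))"
      by (rule integral_sum) (use integrable_linear[OF git bounded_linear_vector_scalar] in \<open>auto simp: o_def\<close>)
    also have "\<dots> = (\<Sum>i\<le>Suc n. c ^ i *s e i t)"
      using integral_linear[OF git bounded_linear_vector_scalar] by (simp add: o_def e_def)
    finally show "integral {0..t} (\<lambda>r. (V r - mat c) *v F c r) = (\<Sum>i\<le>Suc n. c ^ i *s e i t)" .
  qed
qed

lemma picard_polynomial:
  fixes V :: "real \<Rightarrow> complex ^ 'n::finite ^ 'n"
  assumes V: "locally_integrable V"
  shows "\<exists>q. (\<forall>i. continuous_on {0..T} (q i)) \<and>
    (\<forall>c. \<forall>t\<in>{0..T}. picard (\<lambda>r. V r - mat c) a b n t = (\<Sum>i\<le>n. c ^ i *s q i t))"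
proof (induction n)
  case 0
  show ?case by (rule exI[of _ "\<lambda>i t. a + t *\<^sub>R b"]) (auto intro!: continuous_intros)
next
  case (Suc n)
  then obtain q where q: "\<And>i. continuous_on {0..T} (q i)"
    "\<And>c t. t \<in> {0..T} \<Longrightarrow> picard (\<lambda>r. V r - mat c) a b n t = (\<Sum>i\<le>n. c ^ i *s q i t)" by blast
  obtain e where e': "(\<forall>i. continuous_on {0..T} (e i)) \<and>
    (\<forall>c. \<forall>t\<in>{0..T}. integral {0..t} (\<lambda>r. (V r - mat c) *v picard (\<lambda>r. V r - mat c) a b n r) = (\<Sum>i\<le>Suc n. c ^ i *s e i t))"
    using polynomial_step[OF V q(1), where F = "\<lambda>c. picard (\<lambda>r. V r - mat c) a b n", OF q(2)]
    by (rule exE)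
  note e = e'[THEN conjunct1, rule_format] e'[THEN conjunct2, rule_format]
  define p where "p i t = (if i = 0 then a + t *\<^sub>R b else 0) + integral {0..t} (e i)" for i t
  have "continuous_on {0..T} (p i)" for i
    unfolding p_def[abs_def]
    by (intro continuous_on_add indefinite_integral_continuous_1 integrable_continuous_real e)
       (cases "i = 0"; simp; intro continuous_intros)
  moreover have "picard (\<lambda>r. V r - mat c) a b (Suc n) t = (\<Sum>i\<le>Suc n. c ^ i *s p i t)" if t: "t \<in> {0..T}" for c t
  proof -
    have et: "e i integrable_on {0..t}" for i
      by (rule integrable_continuous_real[OF continuous_on_subset[OF e(1)]]) (use t in auto)
    have "integral {0..t} (\<lambda>s. integral {0..s} (\<lambda>r. (V r - mat c) *v picard (\<lambda>r. V r - mat c) a b n r))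
       = integral {0..t} (\<lambda>s. \<Sum>i\<le>Suc n. c ^ i *s e i s)"
      by (intro integral_cong e(2)) (use t in auto)
    also have "\<dots> = (\<Sum>i\<le>Suc n. integral {0..t} (\<lambda>r. c ^ i *s e i r))"
      by (rule integral_sum) (use integrable_linear[OF et bounded_linear_vector_scalar] in \<open>auto simp: o_def\<close>)
    also have "\<dots> = (\<Sum>i\<le>Suc n. c ^ i *s integral {0..t} (e i))"
      using integral_linear[OF et bounded_linear_vector_scalar] by (simp add: o_def)
    finally have "picard (\<lambda>r. V r - mat c) a b (Suc n) t = (a + t *\<^sub>R b) + (\<Sum>i\<le>Suc n. c ^ i *s integral {0..t} (e i))"
      by simp
    also have "a + t *\<^sub>R b = (\<Sum>i\<le>Suc n. c ^ i *s (if i = 0 then a + t *\<^sub>R b else 0))"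
      by (subst sum.atMost_Suc_shift) simp
    finally show ?thesis unfolding p_def vector_add_ldistrib sum.distrib .
  qed
  ultimately show ?case by blast
qed

lemma entry_norm_mat: "entry_norm (mat c :: complex ^ 'n::finite ^ 'n) = CARD('n) * cmod c"
  by (simp add: entry_norm_def mat_def if_distrib[of cmod] cong: if_cong)

lemma entry_norm_diff_le: "entry_norm (A - B) \<le> entry_norm A + entry_norm B"
  unfolding entry_norm_def sum.distrib[symmetric] by (intro sum_mono) (simp add: norm_triangle_ineq4)

lemma integral_entry_norm_shifted_le:
  fixes V :: "real \<Rightarrow> complex ^ 'n::finite ^ 'n" and R :: real
  assumes V: "locally_integrable V" and T: "T \<ge> 0" and c: "cmod c \<le> R"
  shows "integral {0..T} (\<lambda>s. entry_norm (V s - mat c)) \<le> integral {0..T} (\<lambda>s. entry_norm (V s)) + T * (real CARD('n) * R)"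
proof -
  have "integral {0..T} (\<lambda>s. entry_norm (V s - mat c)) \<le> integral {0..T} (\<lambda>s. entry_norm (V s) + real CARD('n) * R)"
  proof (rule integral_le)
    show "(\<lambda>s. entry_norm (V s - mat c)) integrable_on {0..T}"
      by (rule integrable_entry_norm[OF locally_integrableD[OF locally_integrable_shifted[OF V]]])
    show "(\<lambda>s. entry_norm (V s) + real CARD('n) * R) integrable_on {0..T}"
      by (rule Henstock_Kurzweil_Integration.integrable_add[OF integrable_entry_norm[OF locally_integrableD[OF V]] integrable_const_ivl])
    show "entry_norm (V s - mat c) \<le> entry_norm (V s) + real CARD('n) * R" for s
    proof -
      have "real CARD('n) * cmod c \<le> real CARD('n) * R" by (rule mult_left_mono[OF c]) simp
      thus ?thesis using entry_norm_diff_le[of "V s" "mat c"] unfolding entry_norm_mat by linarith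
    qed
  qed
  also have "\<dots> = integral {0..T} (\<lambda>s. entry_norm (V s)) + integral {0..T} (\<lambda>s. real CARD('n) * R)"
    by (rule Henstock_Kurzweil_Integration.integral_add[OF integrable_entry_norm[OF locally_integrableD[OF V]] integrable_const_ivl])
  also have "integral {0..T} (\<lambda>s. real CARD('n) * R) = T * (real CARD('n) * R)"
    using T by simp
  finally show ?thesis .
qed

lemma holomorphic_component_limit:
  fixes f :: "nat \<Rightarrow> complex \<Rightarrow> complex ^ 'n::finite" and g :: "complex \<Rightarrow> complex ^ 'n"
  assumes "\<And>n. (\<lambda>c. f n c $ j) holomorphic_on UNIV"
    and "\<And>R. uniform_limit (cball 0 R) f g sequentially"
  shows "(\<lambda>c. g c $ j) holomorphic_on UNIV"
proof (rule holomorphic_uniform_sequence[OF open_UNIV assms(1)])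
  fix x :: complex
  have "uniform_limit (cball 0 (norm x + 1)) (\<lambda>n c. f n c $ j) (\<lambda>c. g c $ j) sequentially"
    unfolding uniform_limit_iff
  proof (intro allI impI)
    fix e :: real assume "e > 0"
    from uniform_limitD[OF assms(2) this, of "norm x + 1"]
    show "\<forall>\<^sub>F n in sequentially. \<forall>y\<in>cball 0 (norm x + 1). dist (f n y $ j) (g y $ j) < e"
    proof eventually_elim
      case (elim n)
      show ?case
      proof
        fix y :: complex assume "y \<in> cball 0 (norm x + 1)"
        with elim have "dist (f n y) (g y) < e" by (rule bspec)
        thus "dist (f n y $ j) (g y $ j) < e" by (rule le_less_trans[OF dist_vec_nth_le])
      qed
    qed
  qed
  moreover have "cball x 1 \<subseteq> cball 0 (norm x + 1)"
  proof
    fix y :: complex assume "y \<in> cball x 1"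
    thus "y \<in> cball 0 (norm x + 1)" using norm_triangle_sub[of y x] by (simp add: dist_norm norm_minus_commute)
  qed
  ultimately have "uniform_limit (cball x 1) (\<lambda>n c. f n c $ j) (\<lambda>c. g c $ j) sequentially"
    by (rule uniform_limit_on_subset)
  thus "\<exists>d>0. cball x d \<subseteq> UNIV \<and> uniform_limit (cball x d) (\<lambda>n c. f n c $ j) (\<lambda>c. g c $ j) sequentially"
    by (intro exI[of _ 1]) simp
qed

text \<open>The Picard iterates are polynomials in the energy and converge uniformly on compact sets of energies.\<close>

lemma holomorphic_sol:
  fixes V :: "real \<Rightarrow> complex ^ 'n::finite ^ 'n"
  assumes V: "locally_integrable V" and t: "t \<ge> 0"
  shows "(\<lambda>c. sol (\<lambda>r. V r - mat c) a b t $ j) holomorphic_on UNIV"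
    and "(\<lambda>c. sol' (\<lambda>r. V r - mat c) a b t $ j) holomorphic_on UNIV"
proof -
  note loc = locally_integrable_shifted[OF V]
  have tt: "t \<in> {0..t}" using t by simp
  have slice: "uniform_limit X (\<lambda>n x. f n (x, t)) (\<lambda>x. g (x, t)) F" if "uniform_limit (X \<times> {0..t}) f g F"
    for X :: "complex set" and f :: "nat \<Rightarrow> _ \<Rightarrow> complex ^ 'n" and g F
    unfolding uniform_limit_iff
  proof (intro allI impI)
    fix e :: real assume "e > 0"
    from uniform_limitD[OF that this]
    show "\<forall>\<^sub>F n in F. \<forall>x\<in>X. dist (f n (x, t)) (g (x, t)) < e"
      by eventually_elim (use tt in blast)
  qed
  show "(\<lambda>c. sol (\<lambda>r. V r - mat c) a b t $ j) holomorphic_on UNIV"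
  proof (rule holomorphic_component_limit)
    show "uniform_limit (cball 0 R) (\<lambda>n c. picard (\<lambda>r. V r - mat c) a b n t) (\<lambda>c. sol (\<lambda>r. V r - mat c) a b t) sequentially" for R
      using slice[OF uniform_limit_picard[of "cball 0 R" "\<lambda>c r. V r - mat c" t, OF loc integral_entry_norm_shifted_le[OF V t]], of R a b]
      by simp
    show "(\<lambda>c. picard (\<lambda>r. V r - mat c) a b n t $ j) holomorphic_on UNIV" for n
    proof -
      obtain q where q: "\<And>c. picard (\<lambda>r. V r - mat c) a b n t = (\<Sum>i\<le>n. c ^ i *s q i t)"
        using picard_polynomial[OF V, of t a b n] tt by blast
      show ?thesis unfolding q by (simp, intro holomorphic_intros)
    qed
  qed
  show "(\<lambda>c. sol' (\<lambda>r. V r - mat c) a b t $ j) holomorphic_on UNIV"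
  proof (rule holomorphic_component_limit)
    show "uniform_limit (cball 0 R) (\<lambda>n c. b + integral {0..t} (\<lambda>r. (V r - mat c) *v picard (\<lambda>r. V r - mat c) a b n r))
       (\<lambda>c. sol' (\<lambda>r. V r - mat c) a b t) sequentially" for R
      using slice[OF uniform_limit_integral_picard[of "cball 0 R" "\<lambda>c r. V r - mat c" t, OF loc integral_entry_norm_shifted_le[OF V t]], of R b a]
      by simp
    show "(\<lambda>c. (b + integral {0..t} (\<lambda>r. (V r - mat c) *v picard (\<lambda>r. V r - mat c) a b n r)) $ j) holomorphic_on UNIV" for n
    proof -
      obtain q where q: "\<And>i. continuous_on {0..t} (q i)"
        "\<And>c s. s \<in> {0..t} \<Longrightarrow> picard (\<lambda>r. V r - mat c) a b n s = (\<Sum>i\<le>n. c ^ i *s q i s)"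
        using picard_polynomial[OF V, of t a b n] by blast
      obtain e where "(\<forall>i. continuous_on {0..t} (e i)) \<and> (\<forall>c. \<forall>s\<in>{0..t}. integral {0..s} (\<lambda>r. (V r - mat c) *v picard (\<lambda>r. V r - mat c) a b n r) = (\<Sum>i\<le>Suc n. c ^ i *s e i s))"
        using polynomial_step[OF V q(1), where F = "\<lambda>c. picard (\<lambda>r. V r - mat c) a b n", OF q(2)]
        by (rule exE)
      hence e: "integral {0..t} (\<lambda>r. (V r - mat c) *v picard (\<lambda>r. V r - mat c) a b n r) = (\<Sum>i\<le>Suc n. c ^ i *s e i t)" for c
        using tt by blast
      show ?thesis unfolding e by (simp del: sum.atMost_Suc, intro holomorphic_intros)
    qed
  qed
qed

section \<open>The operator on compactly supported functions\<close>

lemma has_integral_shift_interval: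
  fixes f :: "real \<Rightarrow> 'b::euclidean_space"
  assumes "(f has_integral i) {a - s..b - s}"
  shows "((\<lambda>t. f (t - s)) has_integral i) {a..b}"
proof -
  have "(\<lambda>x. x + s) ` {a - s..b - s} = {a..b}" using image_add_atLeastAtMost'[of s "a - s" "b - s"] by simp
  thus ?thesis using has_integral_affinity[of f i "a - s" "b - s" 1 "-s"] assms by simp
qed

lemma periodic_int_shift:
  assumes "\<And>t :: real. f (t + 1) = f t"
  shows "f (t + of_int m) = f t"
proof -
  have nat: "f (t + real k) = f t" for k t
  proof (induction k)
    case (Suc k)
    have "f (t + real (Suc k)) = f ((t + real k) + 1)" by (simp add: algebra_simps)
    thus ?case using assms Suc by simp
  qed simp
  show ?thesis
  proof (cases "m \<ge> 0")
    case True
    thus ?thesis using nat[of t "nat m"] by simp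
  next
    case False
    have "f ((t + of_int m) + real (nat (-m))) = f (t + of_int m)" by (rule nat)
    thus ?thesis using False by simp
  qed
qed

lemma periodic_integrable:
  fixes f :: "real \<Rightarrow> 'b::euclidean_space"
  assumes per: "\<And>t. f (t + 1) = f t" and i: "(f has_integral I) {0..1}"
  shows "(f has_integral I) {of_int m..of_int m + 1}" "f integrable_on {a..b}"
proof -
  show unit: "(f has_integral I) {of_int m..of_int m + 1}" for m
  proof -
    have "((\<lambda>t. f (t - of_int m)) has_integral I) {of_int m..of_int m + 1}"
      by (rule has_integral_shift_interval) (use i in simp)
    moreover have "f (t - of_int m) = f t" for t
      using periodic_int_shift[of f t "-m", OF per] by simp
    ultimately show ?thesis by simp
  qed
  have "f integrable_on {of_int m..of_int m + real k}" for m k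
  proof (induction k)
    case 0
    show ?case using integrable_on_refl[of f "real_of_int m"] by simp
  next
    case (Suc k)
    have "f integrable_on {of_int m + real k..of_int m + real (Suc k)}"
      using unit[of "m + int k"] by (auto simp: algebra_simps intro: has_integral_integrable)
    thus ?case by (intro Henstock_Kurzweil_Integration.integrable_combine[OF _ _ Suc]) auto
  qed
  note * = this[of "\<lfloor>a\<rfloor>" "nat (\<lceil>b\<rceil> - \<lfloor>a\<rfloor>)"]
  show "f integrable_on {a..b}"
  proof (cases "a \<le> b")
    case True
    have "{a..b} \<subseteq> {of_int \<lfloor>a\<rfloor>..of_int \<lfloor>a\<rfloor> + real (nat (\<lceil>b\<rceil> - \<lfloor>a\<rfloor>))}"
      using True by (auto; linarith)
    thus ?thesis by (rule integrable_on_subinterval[OF *])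
  next
    case False
    hence "{a..b} = {}" by simp
    thus ?thesis by (metis integrable_on_empty)
  qed
qed

locale potential =
  fixes V :: "real \<Rightarrow> real ^ 'n::finite ^ 'n"
  assumes V: "V \<in> periodic_potentials"
begin

text \<open>The potential with complex entries, which acts on \<open>L\<^sup>2\<close> functions.\<close>

definition cV :: "real \<Rightarrow> complex ^ 'n ^ 'n" where "cV t = complex_matrix (V t)"

text \<open>A scalar majorant of the potential. It is locally square integrable, and functions bounded by \<open>C * (1 + v)\<close> with
  bounded support are the natural images \<open>- u'' + V u\<close> in \<open>L\<^sup>2\<close>.\<close>

definition v :: "real \<Rightarrow> real" where "v t = entry_norm (cV t)"

lemma cV_entry: "cV t $ i $ j = of_real (V t $ i $ j)"
  by (simp add: cV_def complex_matrix_def)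

lemma V_symmetric: "V t $ i $ j = V t $ j $ i"
proof -
  have "Finite_Cartesian_Product.transpose (V t) = V t" using V by (simp add: periodic_potentials_def)
  hence "Finite_Cartesian_Product.transpose (V t) $ i $ j = V t $ i $ j" by simp
  thus ?thesis by (simp add: Finite_Cartesian_Product.transpose_def)
qed

lemma V_periodic: "V (t + 1) = V t"
  using V by (simp add: periodic_potentials_def)

lemma cV_periodic: "cV (t + of_int m) = cV t"
  using periodic_int_shift[of V, OF V_periodic] by (simp add: cV_def)

lemma v_nonneg [simp]: "v t \<ge> 0"
  by (simp add: v_def)

lemma V_measurable [measurable]: "V \<in> borel_measurable lebesgue"
  using V by (simp add: periodic_potentials_def)

lemma cV_measurable [measurable]: "cV \<in> borel_measurable lebesgue"
proof -
  have "linear (complex_matrix :: real ^ 'n ^ 'n \<Rightarrow> _)"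
    by (rule linearI) (simp_all add: complex_matrix_def vec_eq_iff scaleR_conv_of_real[where 'a = complex])
  hence "complex_matrix \<in> borel_measurable (borel :: (real ^ 'n ^ 'n) measure)"
    by (intro borel_measurable_continuous_onI linear_continuous_on linear_conv_bounded_linear[THEN iffD1])
  from measurable_compose[OF V_measurable this] show ?thesis by (simp add: cV_def[abs_def])
qed

lemma v_measurable [measurable]: "v \<in> borel_measurable lebesgue"
proof -
  have "continuous_on UNIV (entry_norm :: complex ^ 'n ^ 'n \<Rightarrow> real)"
    unfolding entry_norm_def[abs_def] by (intro continuous_intros)
  from measurable_compose[OF cV_measurable borel_measurable_continuous_onI[OF this]]
  show ?thesis by (simp add: v_def[abs_def])
qed

text \<open>\<open>V\<close> is symmetric, so \<open>tr (V\<^sup>2)\<close> is the sum of the squares of all entries; the rest is the Cauchy-Schwarz inequality.\<close>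

lemma v_square_le: "(v t)\<^sup>2 \<le> (real CARD('n))^2 * trace (V t ** V t)"
proof -
  have cs: "(\<Sum>i\<in>(UNIV::'n set). f i)\<^sup>2 \<le> real CARD('n) * (\<Sum>i\<in>UNIV. (f i)\<^sup>2)" for f :: "'n \<Rightarrow> real"
    using Cauchy_Schwarz_ineq_sum[of "\<lambda>_. 1" f UNIV] by simp
  have "(v t)\<^sup>2 = (\<Sum>i\<in>UNIV. \<Sum>j\<in>UNIV. \<bar>V t $ i $ j\<bar>)\<^sup>2"
    by (simp add: v_def entry_norm_def cV_entry)
  also have "\<dots> \<le> real CARD('n) * (\<Sum>i\<in>UNIV. (\<Sum>j\<in>UNIV. \<bar>V t $ i $ j\<bar>)\<^sup>2)" by (rule cs)
  also have "\<dots> \<le> real CARD('n) * (\<Sum>i\<in>UNIV. real CARD('n) * (\<Sum>j\<in>UNIV. \<bar>V t $ i $ j\<bar>\<^sup>2))"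
    by (intro mult_left_mono sum_mono cs) simp
  also have "\<dots> = (real CARD('n))^2 * (\<Sum>i\<in>UNIV. \<Sum>j\<in>UNIV. V t $ i $ j * V t $ j $ i)"
    using V_symmetric[of t] by (simp add: sum_distrib_left power2_eq_square mult.assoc)
  also have "(\<Sum>i\<in>UNIV. \<Sum>j\<in>UNIV. V t $ i $ j * V t $ j $ i) = trace (V t ** V t)"
    by (simp add: trace_def matrix_matrix_mult_def)
  finally show ?thesis .
qed

lemma v_square_integrable: "(\<lambda>t. (v t)\<^sup>2) absolutely_integrable_on {a..b}"
proof -
  have tr: "set_integrable lebesgue {0..1} (\<lambda>t. trace (V t ** V t))"
    using V by (simp add: periodic_potentials_def)
  have ai: "(\<lambda>t. (v t)\<^sup>2) absolutely_integrable_on {0..1}"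
  proof (rule measurable_bounded_by_integrable_imp_absolutely_integrable)
    show "(\<lambda>t. (v t)\<^sup>2) \<in> borel_measurable (lebesgue_on {0..1})"
      by (intro measurable_restrict_space1) measurable
    show "(\<lambda>t. (real CARD('n))^2 * trace (V t ** V t)) integrable_on {0..1}"
      by (rule integrable_on_mult_right[OF set_lebesgue_integral_eq_integral(1)[OF tr]])
    show "norm ((v t)\<^sup>2) \<le> (real CARD('n))^2 * trace (V t ** V t)" for t
      using v_square_le[of t] by simp
  qed simp
  have "(\<lambda>t. (v t)\<^sup>2) integrable_on {a..b}"
    by (rule periodic_integrable(2)[OF _ integrable_integral[OF set_lebesgue_integral_eq_integral(1)[OF ai]]])
       (simp add: v_def cV_def V_periodic)
  thus ?thesis by (rule nonnegative_absolutely_integrable_1) simp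
qed

lemma one_plus_v_square_integrable: "(\<lambda>t. (1 + v t)\<^sup>2) integrable_on {a..b}"
proof -
  have "(\<lambda>t. (1 + v t)\<^sup>2) absolutely_integrable_on {a..b}"
  proof (rule measurable_bounded_by_integrable_imp_absolutely_integrable)
    show "(\<lambda>t. (1 + v t)\<^sup>2) \<in> borel_measurable (lebesgue_on {a..b})"
      by (intro measurable_restrict_space1) measurable
    show "(\<lambda>t. 2 + 2 * (v t)\<^sup>2) integrable_on {a..b}"
      by (rule Henstock_Kurzweil_Integration.integrable_add[OF integrable_const_ivl
            integrable_on_mult_right[OF set_lebesgue_integral_eq_integral(1)[OF v_square_integrable]]])
    show "norm ((1 + v t)\<^sup>2) \<le> 2 + 2 * (v t)\<^sup>2" for t
    proof -
      have "0 \<le> (1 - v t)\<^sup>2" by simp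
      thus ?thesis by (simp add: power2_eq_square algebra_simps)
    qed
  qed simp
  thus ?thesis by (rule set_lebesgue_integral_eq_integral(1))
qed

lemma locally_integrable_cV: "locally_integrable cV"
  unfolding locally_integrable_def
proof (intro allI, rule measurable_bounded_by_integrable_imp_absolutely_integrable)
  fix a b :: real
  show "cV \<in> borel_measurable (lebesgue_on {a..b})"
    by (intro measurable_restrict_space1 cV_measurable)
  show "(\<lambda>t. (1 + v t)\<^sup>2) integrable_on {a..b}" by (rule one_plus_v_square_integrable)
  show "norm (cV t) \<le> (1 + v t)\<^sup>2" for t
  proof -
    have "norm (cV t) \<le> (\<Sum>i\<in>UNIV. norm (cV t $ i))" unfolding norm_vec_def[of "cV t"] by (rule L2_set_le_sum) simp
    also have "\<dots> \<le> v t" unfolding v_def entry_norm_def by (intro sum_mono norm_le_sum_components)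
    also have "\<dots> \<le> (1 + v t)\<^sup>2" by (simp add: power2_eq_square algebra_simps)
    finally show ?thesis .
  qed
qed simp

lemma locally_integrable_cV_shift: "locally_integrable (\<lambda>t. cV (t - s))"
  unfolding locally_integrable_def absolutely_integrable_on_def integrable_on_def
proof (intro allI conjI)
  fix a b :: real
  have c: "cV absolutely_integrable_on {a - s..b - s}" by (rule locally_integrableD[OF locally_integrable_cV])
  show "\<exists>i. ((\<lambda>t. cV (t - s)) has_integral i) {a..b}"
    using has_integral_shift_interval[OF integrable_integral[OF set_lebesgue_integral_eq_integral(1)[OF c]]] by (rule exI)
  have "(\<lambda>t. norm (cV t)) integrable_on {a - s..b - s}" using c by (simp only: absolutely_integrable_on_def)
  from has_integral_shift_interval[OF integrable_integral[OF this]]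
  show "\<exists>i. ((\<lambda>t. norm (cV (t - s))) has_integral i) {a..b}" by (rule exI)
qed

lemma cV_bil: "bil (cV t *v x) y = bil x (cV t *v y)"
proof -
  have "bil (cV t *v x) y = (\<Sum>i\<in>UNIV. \<Sum>j\<in>UNIV. cV t $ i $ j * x $ j * y $ i)"
    by (simp add: bil_def matrix_vector_mult_def sum_distrib_right)
  also have "\<dots> = (\<Sum>j\<in>UNIV. \<Sum>i\<in>UNIV. cV t $ i $ j * x $ j * y $ i)" by (rule sum.swap)
  also have "\<dots> = (\<Sum>j\<in>UNIV. \<Sum>i\<in>UNIV. x $ j * (cV t $ j $ i * y $ i))"
    by (intro sum.cong refl) (simp add: cV_entry V_symmetric mult_ac)
  also have "\<dots> = bil x (cV t *v y)" by (simp add: bil_def matrix_vector_mult_def sum_distrib_left)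
  finally show ?thesis .
qed

lemma L2_bounded_support:
  fixes f :: "real \<Rightarrow> complex ^ 'n"
  assumes f: "f \<in> borel_measurable lebesgue"
    and bd: "\<And>t. t \<in> {a..b} \<Longrightarrow> norm (f t) \<le> C * (1 + v t)" and supp: "\<And>t. t \<notin> {a..b} \<Longrightarrow> f t = 0"
  shows "f \<in> L2" "sqnorm f \<le> C\<^sup>2 * integral {a..b} (\<lambda>t. (1 + v t)\<^sup>2)"
proof -
  have ai: "(\<lambda>t. C\<^sup>2 * (1 + v t)\<^sup>2) absolutely_integrable_on {a..b}"
    by (rule nonnegative_absolutely_integrable_1[OF integrable_on_mult_right[OF one_plus_v_square_integrable]]) simp
  have le: "(norm (f t))\<^sup>2 \<le> indicator {a..b} t *\<^sub>R (C\<^sup>2 * (1 + v t)\<^sup>2)" for t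
  proof (cases "t \<in> {a..b}")
    case True
    thus ?thesis using power_mono[OF bd[OF True] norm_ge_zero, of 2] by (simp add: power_mult_distrib)
  qed (simp add: supp)
  have int: "integrable lebesgue (\<lambda>t. (norm (f t))\<^sup>2)"
    by (rule Bochner_Integration.integrable_bound[OF ai[unfolded set_integrable_def]])
       (use f le in \<open>auto intro!: AE_I2 simp del: scaleR_conv_of_real\<close>)
  thus "f \<in> L2" using f by (simp add: L2_def)
  have "sqnorm f \<le> (LINT t|lebesgue. indicator {a..b} t *\<^sub>R (C\<^sup>2 * (1 + v t)\<^sup>2))"
    unfolding sqnorm_def by (rule integral_mono[OF int ai[unfolded set_integrable_def] le])
  also have "\<dots> = integral {a..b} (\<lambda>t. C\<^sup>2 * (1 + v t)\<^sup>2)"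
    unfolding set_lebesgue_integral_eq_integral(2)[OF ai, symmetric] set_lebesgue_integral_def ..
  finally show "sqnorm f \<le> C\<^sup>2 * integral {a..b} (\<lambda>t. (1 + v t)\<^sup>2)" by simp
qed

text \<open>A compactly supported \<open>u\<close> with weak second derivative belongs to the maximal domain as soon as its image is
  square integrable.\<close>

lemma schroedinger_compact_support:
  fixes u :: "real \<Rightarrow> complex ^ 'n"
  assumes wd: "weak_derivatives u u' w"
    and supp: "\<And>t. t \<notin> {a..b} \<Longrightarrow> u t = 0" "\<And>t. t \<notin> {a..b} \<Longrightarrow> w t = 0"
    and f: "\<And>t. f t = - w t + cV t *v u t"
    and bd: "\<And>t. t \<in> {a..b} \<Longrightarrow> norm (f t) \<le> C * (1 + v t)"
  shows "schroedinger V u f" "f \<in> L2" "u \<in> L2"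
proof -
  have w: "w \<in> borel_measurable lebesgue"
  proof -
    have "w absolutely_integrable_on {a..b}"
    proof (cases "a \<le> b")
      case True
      thus ?thesis using wd by (simp add: weak_derivatives_def)
    qed (simp add: set_integrable_def)
    hence "(\<lambda>t. indicator {a..b} t *\<^sub>R w t) \<in> borel_measurable lebesgue"
      by (simp add: set_integrable_def)
    moreover have "(\<lambda>t. indicator {a..b} t *\<^sub>R w t) = w"
      using supp by (auto simp: indicator_def fun_eq_iff)
    ultimately show ?thesis by simp
  qed
  have c: "continuous_on A u" for A by (rule weak_derivatives_continuous(1)[OF wd])
  have u: "u \<in> borel_measurable lebesgue"
    using borel_measurable_continuous_onI[OF c[of UNIV]] by (simp add: measurable_completion)
  have "(\<lambda>t. cV t *v u t) \<in> borel_measurable (lebesgue_on UNIV)"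
    by (rule borel_measurable_bilinear[of "\<lambda>x A. A *v x", OF bilinear_matrix_vector])
       (use u in \<open>auto intro!: measurable_restrict_space1\<close>)
  hence fm: "f \<in> borel_measurable lebesgue"
    unfolding f[abs_def] using w by (intro borel_measurable_add borel_measurable_uminus) (simp_all add: lebesgue_on_UNIV_eq)
  show fL: "f \<in> L2" by (rule L2_bounded_support(1)[OF fm bd]) (use supp f in auto)
  obtain K where K: "\<And>t. t \<in> {a..b} \<Longrightarrow> norm (u t) \<le> K"
    using compact_imp_bounded[OF compact_continuous_image[OF c[of "{a..b}"] compact_Icc]] unfolding bounded_iff by blast
  show uL: "u \<in> L2"
  proof (rule L2_bounded_support(1)[OF u _ supp(1)])
    fix t assume t: "t \<in> {a..b}"
    have "norm (u t) \<le> \<bar>K\<bar> * 1" using K[OF t] by simp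
    also have "\<dots> \<le> \<bar>K\<bar> * (1 + v t)" by (intro mult_left_mono) auto
    finally show "norm (u t) \<le> \<bar>K\<bar> * (1 + v t)" .
  qed
  show "schroedinger V u f"
    unfolding schroedinger_def has_weak_second_derivative_iff
    by (intro conjI fL uL, rule exI[of _ u], rule exI[of _ w]) (use wd f in \<open>auto simp: cV_def\<close>)
qed

end

lemma abs_power_le_1: "\<bar>t\<bar> \<le> 1 \<Longrightarrow> \<bar>t ^ k\<bar> \<le> (1::real)"
  by (simp add: power_abs power_le_one)

lemma norm_bump_le: "norm (bump a b t) \<le> 4 * (norm a + norm b)"
proof (cases "-1 \<le> t \<and> t < 1")
  case True
  hence t: "\<bar>t\<bar> \<le> 1" by auto
  have "\<bar>1 - 2*t^2 + t^4\<bar> \<le> 4" "\<bar>t - 2*t^3 + t^5\<bar> \<le> 4"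
    using abs_power_le_1[OF t, of 2] abs_power_le_1[OF t, of 4] abs_power_le_1[OF t, of 3] abs_power_le_1[OF t, of 5] t
    by linarith+
  hence "norm ((1 - 2*t^2 + t^4) *\<^sub>R a) \<le> 4 * norm a" "norm ((t - 2*t^3 + t^5) *\<^sub>R b) \<le> 4 * norm b"
    unfolding norm_scaleR by (auto intro: mult_right_mono)
  thus ?thesis using True norm_triangle_mono by (fastforce simp: bump_def)
qed (auto simp: bump_def)

lemma norm_bump_le_32: "norm (bump a b t) \<le> 32 * (norm a + norm b)"
  by (rule order_trans[OF norm_bump_le]) (intro mult_right_mono, simp_all)

lemma norm_bump''_le: "norm (bump'' a b t) \<le> 32 * (norm a + norm b)"
proof (cases "-1 \<le> t \<and> t < 1")
  case True
  hence t: "\<bar>t\<bar> \<le> 1" by auto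
  have "\<bar>12*t^2 - 4\<bar> \<le> 32" "\<bar>20*t^3 - 12*t\<bar> \<le> 32"
    using abs_power_le_1[OF t, of 2] abs_power_le_1[OF t, of 3] t by linarith+
  hence "norm ((12*t^2 - 4) *\<^sub>R a) \<le> 32 * norm a" "norm ((20*t^3 - 12*t) *\<^sub>R b) \<le> 32 * norm b"
    unfolding norm_scaleR by (auto intro: mult_right_mono)
  thus ?thesis using True norm_triangle_mono by (fastforce simp: bump''_def)
qed (auto simp: bump''_def)

lemma bump_linear:
  "bump (c *s a + d *s a') (c *s b + d *s b') t = c *s bump a b t + d *s bump a' b' t"
  "bump'' (c *s a + d *s a') (c *s b + d *s b') t = c *s bump'' a b t + d *s bump'' a' b' t"
  by (simp_all add: bump_def bump''_def vec_eq_iff algebra_simps scaleR_conv_of_real[where 'a = complex])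

lemma norm_vector_scalar: "norm (c *s x) = cmod c * norm (x :: complex ^ 'n::finite)"
  by (simp add: norm_vec_def norm_mult L2_set_right_distrib)

context potential
begin

text \<open>\<open>- y'' + V y\<close> for the bump \<open>y\<close> around \<open>s\<close>. Below, \<open>left_bump\<close> and \<open>right_bump\<close> are its halves before and after \<open>s\<close>;
  they are not in the domain, but they complete a solution on an interval \<open>[s, T]\<close> to an element of the domain.\<close>

definition Lbump :: "real \<Rightarrow> complex ^ 'n \<Rightarrow> complex ^ 'n \<Rightarrow> real \<Rightarrow> complex ^ 'n" where
  "Lbump s a b t = - bump'' a b (t - s) + cV t *v bump a b (t - s)"

definition left_bump :: "real \<Rightarrow> complex ^ 'n \<Rightarrow> complex ^ 'n \<Rightarrow> real \<Rightarrow> complex ^ 'n" where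
  "left_bump s a b t = (if t < s then bump a b (t - s) else 0)"
definition L_left_bump :: "real \<Rightarrow> complex ^ 'n \<Rightarrow> complex ^ 'n \<Rightarrow> real \<Rightarrow> complex ^ 'n" where
  "L_left_bump s a b t = (if t < s then Lbump s a b t else 0)"
definition right_bump :: "real \<Rightarrow> complex ^ 'n \<Rightarrow> complex ^ 'n \<Rightarrow> real \<Rightarrow> complex ^ 'n" where
  "right_bump s a b t = (if t < s then 0 else bump a b (t - s))"
definition L_right_bump :: "real \<Rightarrow> complex ^ 'n \<Rightarrow> complex ^ 'n \<Rightarrow> real \<Rightarrow> complex ^ 'n" where
  "L_right_bump s a b t = (if t < s then 0 else Lbump s a b t)"
definition cut_out :: "real \<Rightarrow> real \<Rightarrow> (real \<Rightarrow> complex ^ 'n) \<Rightarrow> real \<Rightarrow> complex ^ 'n" where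
  "cut_out s T g t = (if s \<le> t \<and> t < T then g t else 0)"

lemma norm_matrix_le: "norm (cV t *v x) \<le> v t * norm x"
  unfolding v_def by (rule norm_matrix_vector_le)

lemma norm_Lbump_le: "norm (Lbump s a b t) \<le> 32 * (norm a + norm b) * (1 + v t)"
proof -
  have "norm (Lbump s a b t) \<le> norm (bump'' a b (t - s)) + v t * norm (bump a b (t - s))"
    unfolding Lbump_def using norm_matrix_le[of t "bump a b (t - s)"] norm_triangle_ineq[of "- bump'' a b (t - s)" "cV t *v bump a b (t - s)"]
    by simp
  also have "\<dots> \<le> 32 * (norm a + norm b) + v t * (32 * (norm a + norm b))"
    by (intro add_mono mult_left_mono v_nonneg norm_bump''_le norm_bump_le_32)
  finally show ?thesis by (simp add: algebra_simps)
qed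

lemma norm_bump_le': "norm (bump a b t) \<le> 32 * (norm a + norm b) * (1 + v s)"
proof -
  have "norm (bump a b t) \<le> 32 * (norm a + norm b) * 1"
    using norm_bump_le_32[of a b t] by simp
  also have "\<dots> \<le> 32 * (norm a + norm b) * (1 + v s)" by (intro mult_left_mono) auto
  finally show ?thesis .
qed

lemma bump_measurable: "(\<lambda>t. bump a b (t - s)) \<in> borel_measurable lebesgue"
proof -
  have "continuous_on UNIV (\<lambda>t. bump a b (t - s))"
    by (rule weak_derivatives_continuous(1)[OF weak_derivatives_shift[OF weak_derivatives_bump]])
  thus ?thesis by (intro measurable_completion) (simp add: borel_measurable_continuous_onI)
qed

lemma cV_mult_measurable:
  assumes "u \<in> borel_measurable lebesgue"
  shows "(\<lambda>t. cV t *v u t) \<in> borel_measurable lebesgue"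
proof -
  have "(\<lambda>t. cV t *v u t) \<in> borel_measurable (lebesgue_on UNIV)"
    by (rule borel_measurable_bilinear[of "\<lambda>x A. A *v x", OF bilinear_matrix_vector])
       (use assms in \<open>auto intro!: measurable_restrict_space1\<close>)
  thus ?thesis by (simp add: lebesgue_on_UNIV_eq)
qed

lemma Lbump_measurable: "Lbump s a b \<in> borel_measurable lebesgue"
proof -
  have "(\<lambda>t. bump'' a b (t - s)) = (\<lambda>t. if -1 \<le> t - s \<and> t - s < 1 then (12*(t-s)^2 - 4) *\<^sub>R a + (20*(t-s)^3 - 12*(t-s)) *\<^sub>R b else 0)"
    by (simp add: bump''_def fun_eq_iff)
  also have "\<dots> \<in> borel_measurable borel"
    by measurable
  finally have "(\<lambda>t. bump'' a b (t - s)) \<in> borel_measurable lebesgue"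
    by (intro measurable_completion) simp
  thus ?thesis unfolding Lbump_def[abs_def]
    by (intro borel_measurable_add borel_measurable_uminus cV_mult_measurable bump_measurable)
qed

text \<open>The square norms are bounded by the mass of \<open>(1 + v)\<^sup>2\<close> over one period, hence uniformly over all integer positions \<open>s\<close>.\<close>

lemma halves_L2:
  shows "left_bump s a b \<in> L2" "L_left_bump s a b \<in> L2" "right_bump s a b \<in> L2" "L_right_bump s a b \<in> L2"
    and "sqnorm (left_bump s a b) \<le> (32 * (norm a + norm b))\<^sup>2 * integral {s - 1..s} (\<lambda>t. (1 + v t)\<^sup>2)"
    and "sqnorm (L_left_bump s a b) \<le> (32 * (norm a + norm b))\<^sup>2 * integral {s - 1..s} (\<lambda>t. (1 + v t)\<^sup>2)"
proof -
  have set: "{t::real. t < s} \<in> sets lebesgue" for s by (rule sets_completionI_sets) simp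
  have P: "Measurable.pred lebesgue (\<lambda>t::real. t < s)" for s
    using set[of s] by (simp add: pred_def)
  have m: "left_bump s a b \<in> borel_measurable lebesgue" "L_left_bump s a b \<in> borel_measurable lebesgue"
    "right_bump s a b \<in> borel_measurable lebesgue" "L_right_bump s a b \<in> borel_measurable lebesgue"
    unfolding left_bump_def[abs_def] L_left_bump_def[abs_def] right_bump_def[abs_def] L_right_bump_def[abs_def]
    by (intro measurable_If bump_measurable Lbump_measurable measurable_const P; use set in simp)+
  have bL: "norm (left_bump s a b t) \<le> 32 * (norm a + norm b) * (1 + v t)" "norm (L_left_bump s a b t) \<le> 32 * (norm a + norm b) * (1 + v t)"
    "norm (right_bump s a b t) \<le> 32 * (norm a + norm b) * (1 + v t)" "norm (L_right_bump s a b t) \<le> 32 * (norm a + norm b) * (1 + v t)" for t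
    using norm_bump_le'[of a b "t - s" t] norm_Lbump_le[of s a b t]
    by (auto simp: left_bump_def L_left_bump_def right_bump_def L_right_bump_def simp del: distrib_left_numeral intro!: mult_nonneg_nonneg add_nonneg_nonneg)
  have supp: "left_bump s a b t = 0" "L_left_bump s a b t = 0" if "t \<notin> {s - 1..s}" for t
    using that by (auto simp: left_bump_def L_left_bump_def Lbump_def)
  have supp': "right_bump s a b t = 0" "L_right_bump s a b t = 0" if "t \<notin> {s..s + 1}" for t
    using that by (auto simp: right_bump_def L_right_bump_def Lbump_def)
  show "left_bump s a b \<in> L2" "sqnorm (left_bump s a b) \<le> (32 * (norm a + norm b))\<^sup>2 * integral {s - 1..s} (\<lambda>t. (1 + v t)\<^sup>2)"
    by (rule L2_bounded_support[OF m(1) bL(1) supp(1)]; assumption)+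
  show "L_left_bump s a b \<in> L2" "sqnorm (L_left_bump s a b) \<le> (32 * (norm a + norm b))\<^sup>2 * integral {s - 1..s} (\<lambda>t. (1 + v t)\<^sup>2)"
    by (rule L2_bounded_support[OF m(2) bL(2) supp(2)]; assumption)+
  show "right_bump s a b \<in> L2" by (rule L2_bounded_support(1)[OF m(3) bL(3) supp'(1)])
  show "L_right_bump s a b \<in> L2" by (rule L2_bounded_support(1)[OF m(4) bL(4) supp'(2)])
qed

lemma cut_out_L2:
  assumes g: "continuous_on UNIV g" and K: "\<And>t. t \<in> {s..T} \<Longrightarrow> norm (g t) \<le> K"
  shows "cut_out s T g \<in> L2" "sqnorm (cut_out s T g) \<le> \<bar>K\<bar>\<^sup>2 * integral {s..T} (\<lambda>t. (1 + v t)\<^sup>2)"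
proof -
  have set: "{t::real. s \<le> t \<and> t < T} \<in> sets lebesgue"
    using atLeastLessThan_def[of s T] by (intro sets_completionI_sets) (simp add: Collect_conj_eq)
  have "(\<lambda>t. if s \<le> t \<and> t < T then g t else 0) \<in> borel_measurable lebesgue"
    using borel_measurable_continuous_onI[OF g] set
    by (intro measurable_If) (auto intro: measurable_completion)
  hence m: "cut_out s T g \<in> borel_measurable lebesgue" by (simp add: cut_out_def[abs_def])
  have bd: "norm (cut_out s T g t) \<le> \<bar>K\<bar> * (1 + v t)" for t
  proof (cases "s \<le> t \<and> t < T")
    case True
    have "norm (cut_out s T g t) \<le> \<bar>K\<bar> * 1" using K[of t] True by (simp add: cut_out_def)
    also have "\<dots> \<le> \<bar>K\<bar> * (1 + v t)" by (intro mult_left_mono) auto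
    finally show ?thesis .
  qed (auto simp: cut_out_def intro!: mult_nonneg_nonneg add_nonneg_nonneg)
  have supp: "cut_out s T g t = 0" if "t \<notin> {s..T}" for t using that by (auto simp: cut_out_def)
  show "cut_out s T g \<in> L2" "sqnorm (cut_out s T g) \<le> \<bar>K\<bar>\<^sup>2 * integral {s..T} (\<lambda>t. (1 + v t)\<^sup>2)"
    by (rule L2_bounded_support[OF m bd supp]; assumption)+
qed

lemma schroedinger_bump: "schroedinger V (\<lambda>t. left_bump s a b t + right_bump s a b t) (\<lambda>t. L_left_bump s a b t + L_right_bump s a b t)"
proof -
  have "schroedinger V (\<lambda>t. bump a b (t - s)) (Lbump s a b)"
  proof (rule schroedinger_compact_support(1)[OF weak_derivatives_shift[OF weak_derivatives_bump]])
    show "bump a b (t - s) = 0" "bump'' a b (t - s) = 0" if "t \<notin> {s - 1..s + 1}" for t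
      using that by auto
    show "norm (Lbump s a b t) \<le> 32 * (norm a + norm b) * (1 + v t)" for t by (rule norm_Lbump_le)
  qed (simp add: Lbump_def)
  moreover have "(\<lambda>t. left_bump s a b t + right_bump s a b t) = (\<lambda>t. bump a b (t - s))" "(\<lambda>t. L_left_bump s a b t + L_right_bump s a b t) = Lbump s a b"
    by (auto simp: left_bump_def right_bump_def L_left_bump_def L_right_bump_def)
  ultimately show ?thesis by simp
qed

text \<open>A solution on \<open>[s, T]\<close> is cut out and continued by half bumps on both sides.\<close>

lemma schroedinger_glued:
  assumes g: "weak_derivatives g g' w" and sT: "s \<le> T"
    and eq: "\<And>t. s \<le> t \<Longrightarrow> t < T \<Longrightarrow> - w t + cV t *v g t = c *s g t"
  shows "schroedinger V (\<lambda>t. left_bump s (g s) (g' s) t + (cut_out s T g t + right_bump T (g T) (g' T) t))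
     (\<lambda>t. L_left_bump s (g s) (g' s) t + (c *s cut_out s T g t + L_right_bump T (g T) (g' T) t))"
proof -
  define u where "u = (\<lambda>t. if t < s then bump (g s) (g' s) (t - s) else if t < T then g t else bump (g T) (g' T) (t - T))"
  define u' where "u' = (\<lambda>t. if t < s then bump' (g s) (g' s) (t - s) else if t < T then g' t else bump' (g T) (g' T) (t - T))"
  define z where "z = (\<lambda>t. if t < s then bump'' (g s) (g' s) (t - s) else if t < T then w t else bump'' (g T) (g' T) (t - T))"
  have wd: "weak_derivatives u u' z"
    unfolding u_def u'_def z_def
    by (intro weak_derivatives_glue weak_derivatives_shift[OF weak_derivatives_bump] g) (use sT in auto)
  define f where "f = (\<lambda>t. L_left_bump s (g s) (g' s) t + (c *s cut_out s T g t + L_right_bump T (g T) (g' T) t))"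
  have feq: "f t = - z t + cV t *v u t" for t
    using sT eq[of t] by (auto simp: f_def z_def u_def L_left_bump_def L_right_bump_def cut_out_def Lbump_def)
  obtain K where K: "\<And>t. t \<in> {s..T} \<Longrightarrow> norm (g t) \<le> K"
    using compact_imp_bounded[OF compact_continuous_image[OF weak_derivatives_continuous(1)[OF g, of "{s..T}"] compact_Icc]]
    unfolding bounded_iff by blast
  define C where "C = 32 * (norm (g s) + norm (g' s)) + 32 * (norm (g T) + norm (g' T)) + cmod c * \<bar>K\<bar>"
  have C: "C \<ge> 32 * (norm (g s) + norm (g' s))" "C \<ge> 32 * (norm (g T) + norm (g' T))" "C \<ge> cmod c * \<bar>K\<bar>" "C \<ge> 0"
    by (auto simp: C_def)
  have "schroedinger V u f"
  proof (rule schroedinger_compact_support(1)[OF wd _ _ feq])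
    show "u t = 0" "z t = 0" if "t \<notin> {s - 1..T + 1}" for t
      using that sT by (auto simp: u_def z_def)
    fix t :: real
    consider "t < s" | "s \<le> t" "t < T" | "T \<le> t" by linarith
    thus "norm (f t) \<le> C * (1 + v t)"
    proof cases
      case 1
      hence "norm (f t) \<le> 32 * (norm (g s) + norm (g' s)) * (1 + v t)"
        using norm_Lbump_le[of s "g s" "g' s" t] sT by (simp add: f_def L_left_bump_def L_right_bump_def cut_out_def)
      also have "\<dots> \<le> C * (1 + v t)" by (intro mult_right_mono C) simp
      finally show ?thesis .
    next
      case 2
      hence "norm (f t) = cmod c * norm (g t)"
        by (simp add: f_def L_left_bump_def L_right_bump_def cut_out_def norm_vector_scalar)
      also have "\<dots> \<le> cmod c * \<bar>K\<bar>" using K[of t] 2 by (intro mult_left_mono) auto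
      also have "\<dots> \<le> C * 1" using C by simp
      also have "\<dots> \<le> C * (1 + v t)" using C by (intro mult_left_mono) auto
      finally show ?thesis .
    next
      case 3
      hence "norm (f t) \<le> 32 * (norm (g T) + norm (g' T)) * (1 + v t)"
        using norm_Lbump_le[of T "g T" "g' T" t] sT by (simp add: f_def L_left_bump_def L_right_bump_def cut_out_def)
      also have "\<dots> \<le> C * (1 + v t)" by (intro mult_right_mono C) simp
      finally show ?thesis .
    qed
  qed
  moreover have "(\<lambda>t. left_bump s (g s) (g' s) t + (cut_out s T g t + right_bump T (g T) (g' T) t)) = u"
    using sT by (auto simp: left_bump_def right_bump_def cut_out_def u_def fun_eq_iff)
  ultimately show ?thesis by (simp add: f_def)
qed

end

section \<open>Spectral representations and boundary forms\<close>

lemma L2_lincomb: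
  fixes f g :: "real \<Rightarrow> complex ^ 'n::finite"
  assumes f: "f \<in> L2" and g: "g \<in> L2"
  shows "(\<lambda>t. a *s f t + b *s g t) \<in> L2"
proof -
  have bl: "(\<lambda>x :: complex ^ 'n. c *s x) \<in> borel_measurable borel" for c
    by (intro borel_measurable_continuous_onI linear_continuous_on bounded_linear_vector_scalar)
  have m: "f \<in> borel_measurable lebesgue" "g \<in> borel_measurable lebesgue"
    and i: "integrable lebesgue (\<lambda>t. (norm (f t))\<^sup>2)" "integrable lebesgue (\<lambda>t. (norm (g t))\<^sup>2)"
    using f g by (auto simp: L2_def)
  have mc: "(\<lambda>t. a *s f t + b *s g t) \<in> borel_measurable lebesgue"
    by (intro borel_measurable_add measurable_compose[OF m(1) bl] measurable_compose[OF m(2) bl])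
  have le: "(norm (a *s f t + b *s g t))\<^sup>2 \<le> 2 * (cmod a)\<^sup>2 * (norm (f t))\<^sup>2 + 2 * (cmod b)\<^sup>2 * (norm (g t))\<^sup>2" for t
  proof -
    have "(norm (a *s f t + b *s g t))\<^sup>2 \<le> (cmod a * norm (f t) + cmod b * norm (g t))\<^sup>2"
      using norm_triangle_ineq[of "a *s f t" "b *s g t"] by (intro power_mono) (simp_all add: norm_vector_scalar)
    also have "\<dots> \<le> 2 * (cmod a * norm (f t))\<^sup>2 + 2 * (cmod b * norm (g t))\<^sup>2"
      using sum_squares_bound[of "cmod a * norm (f t)" "cmod b * norm (g t)"] by (simp add: power2_sum)
    finally show ?thesis by (simp add: power_mult_distrib mult.assoc)
  qed
  have "integrable lebesgue (\<lambda>t. (norm (a *s f t + b *s g t))\<^sup>2)"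
  proof (rule Bochner_Integration.integrable_bound)
    show "integrable lebesgue (\<lambda>t. 2 * (cmod a)\<^sup>2 * (norm (f t))\<^sup>2 + 2 * (cmod b)\<^sup>2 * (norm (g t))\<^sup>2)"
      by (intro Bochner_Integration.integrable_add integrable_mult_right i)
    show "(\<lambda>t. (norm (a *s f t + b *s g t))\<^sup>2) \<in> borel_measurable lebesgue"
      using mc by measurable
    show "AE t in lebesgue. norm ((norm (a *s f t + b *s g t))\<^sup>2) \<le> norm (2 * (cmod a)\<^sup>2 * (norm (f t))\<^sup>2 + 2 * (cmod b)\<^sup>2 * (norm (g t))\<^sup>2)"
      using le by (intro AE_I2) (auto intro: order_trans[OF _ abs_ge_self])
  qed
  thus ?thesis using mc by (simp add: L2_def)
qed

lemma L2_add: "f \<in> L2 \<Longrightarrow> g \<in> L2 \<Longrightarrow> (\<lambda>t. f t + g t) \<in> L2"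
  using L2_lincomb[of f g 1 1] by simp

lemma L2_scale: "f \<in> L2 \<Longrightarrow> (\<lambda>t. a *s f t) \<in> L2"
  using L2_lincomb[of f f a 0] by simp

lemma cmod_add_scaled_square:
  "(cmod (x + c * y))\<^sup>2 = (cmod x)\<^sup>2 + (cmod c)\<^sup>2 * (cmod y)\<^sup>2 + 2 * Re (cnj c * (x * cnj y))"
  by (simp only: cmod_power2) (simp add: power2_eq_square algebra_simps)

lemma norm_square_vec: "(norm z)\<^sup>2 = (\<Sum>i\<in>UNIV. (cmod (z $ i))\<^sup>2)" for z :: "complex ^ 'n::finite"
  by (simp add: norm_vec_def L2_set_def sum_nonneg)

text \<open>Linear in the first argument. Polarization of \<open>sqnorm\<close> transports it through the spectral representation.\<close>

definition ip :: "(real \<Rightarrow> complex ^ 'n::finite) \<Rightarrow> (real \<Rightarrow> complex ^ 'n) \<Rightarrow> complex" where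
  "ip f g = (LINT t|lebesgue. (\<Sum>i\<in>UNIV. f t $ i * cnj (g t $ i)))"

lemma norm_mult_le_squares: "norm ((x::complex) * y) \<le> (cmod x)\<^sup>2 + (cmod y)\<^sup>2"
proof -
  have "2 * (cmod x * cmod y) \<le> (cmod x)\<^sup>2 + (cmod y)\<^sup>2"
    using sum_squares_bound[of "cmod x" "cmod y"] by simp
  moreover have "0 \<le> cmod x * cmod y" by simp
  ultimately show ?thesis unfolding norm_mult by linarith
qed

lemma ip_integrable:
  fixes f g :: "real \<Rightarrow> complex ^ 'n::finite"
  assumes f: "f \<in> L2" and g: "g \<in> L2"
  shows "integrable lebesgue (\<lambda>t. (\<Sum>i\<in>UNIV. f t $ i * cnj (g t $ i)))"
proof (rule Bochner_Integration.integrable_bound)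
  have nth: "(\<lambda>x :: complex ^ 'n. x $ i) \<in> borel_measurable borel" for i
    by (intro borel_measurable_continuous_onI linear_continuous_on bounded_linear_vec_nth)
  have m: "f \<in> borel_measurable lebesgue" "g \<in> borel_measurable lebesgue"
    and i: "integrable lebesgue (\<lambda>t. (norm (f t))\<^sup>2)" "integrable lebesgue (\<lambda>t. (norm (g t))\<^sup>2)"
    using f g by (auto simp: L2_def)
  have c: "(\<lambda>t. f t $ i) \<in> borel_measurable lebesgue" "(\<lambda>t. g t $ i) \<in> borel_measurable lebesgue" for i
    by (rule measurable_compose[OF m(1) nth], rule measurable_compose[OF m(2) nth])
  have cn: "(\<lambda>t. cnj (g t $ i)) \<in> borel_measurable lebesgue" for i
    by (rule measurable_compose[OF c(2)]) (intro borel_measurable_continuous_onI continuous_intros)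
  show "(\<lambda>t. (\<Sum>i\<in>UNIV. f t $ i * cnj (g t $ i))) \<in> borel_measurable lebesgue"
    by (intro borel_measurable_sum borel_measurable_times c cn)
  show "integrable lebesgue (\<lambda>t. (norm (f t))\<^sup>2 + (norm (g t))\<^sup>2)" using i by (rule Bochner_Integration.integrable_add)
  show "AE t in lebesgue. norm (\<Sum>i\<in>UNIV. f t $ i * cnj (g t $ i)) \<le> norm ((norm (f t))\<^sup>2 + (norm (g t))\<^sup>2)"
  proof (rule AE_I2)
    fix t
    have "norm (\<Sum>i\<in>UNIV. f t $ i * cnj (g t $ i)) \<le> (\<Sum>i\<in>UNIV. (cmod (f t $ i))\<^sup>2 + (cmod (cnj (g t $ i)))\<^sup>2)"
      by (intro order_trans[OF norm_sum] sum_mono norm_mult_le_squares)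
    thus "norm (\<Sum>i\<in>UNIV. f t $ i * cnj (g t $ i)) \<le> norm ((norm (f t))\<^sup>2 + (norm (g t))\<^sup>2)"
      by (simp add: norm_square_vec sum.distrib)
  qed
qed

lemma sqnorm_add_scaled:
  fixes f g :: "real \<Rightarrow> complex ^ 'n::finite"
  assumes f: "f \<in> L2" and g: "g \<in> L2"
  shows "sqnorm (\<lambda>t. f t + c *s g t) = sqnorm f + (cmod c)\<^sup>2 * sqnorm g + 2 * Re (cnj c * ip f g)"
proof -
  have i: "integrable lebesgue (\<lambda>t. (norm (f t))\<^sup>2)" "integrable lebesgue (\<lambda>t. (norm (g t))\<^sup>2)"
    using f g by (auto simp: L2_def)
  note ii = ip_integrable[OF f g]
  define p where "p t = (\<Sum>i\<in>UNIV. f t $ i * cnj (g t $ i))" for t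
  have ip: "integrable lebesgue p" using ii by (simp add: p_def[abs_def])
  have ic: "integrable lebesgue (\<lambda>t. cnj c * p t)" using ip by (rule integrable_mult_right)
  have "(norm (f t + c *s g t))\<^sup>2 = (norm (f t))\<^sup>2 + (cmod c)\<^sup>2 * (norm (g t))\<^sup>2 + 2 * Re (cnj c * p t)" for t
    unfolding norm_square_vec p_def
    by (simp add: cmod_add_scaled_square sum.distrib sum_distrib_left Re_sum)
  hence "sqnorm (\<lambda>t. f t + c *s g t) = (LINT t|lebesgue. ((norm (f t))\<^sup>2 + (cmod c)\<^sup>2 * (norm (g t))\<^sup>2)
      + 2 * Re (cnj c * p t))" by (simp only: sqnorm_def)
  also have "\<dots> = (LINT t|lebesgue. (norm (f t))\<^sup>2 + (cmod c)\<^sup>2 * (norm (g t))\<^sup>2) + (LINT t|lebesgue. 2 * Re (cnj c * p t))"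
    by (intro Bochner_Integration.integral_add Bochner_Integration.integrable_add integrable_mult_right i integrable_Re[OF ic])
  also have "(LINT t|lebesgue. (norm (f t))\<^sup>2 + (cmod c)\<^sup>2 * (norm (g t))\<^sup>2) = sqnorm f + (cmod c)\<^sup>2 * sqnorm g"
    using Bochner_Integration.integral_add[OF i(1) integrable_mult_right[OF i(2), of "(cmod c)\<^sup>2"]]
    by (simp only: sqnorm_def integral_mult_right_zero)
  also have "(LINT t|lebesgue. 2 * Re (cnj c * p t)) = 2 * Re (cnj c * ip f g)"
  proof -
    have "ip f g = (LINT t|lebesgue. p t)" by (simp add: ip_def p_def)
    thus ?thesis by (simp only: integral_mult_right_zero integral_Re[OF ic])
  qed
  finally show ?thesis .
qed

locale spectral = potential V for V :: "real \<Rightarrow> real ^ 'n::finite ^ 'n" +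
  fixes \<mu> :: "real measure" and n :: "real \<Rightarrow> nat"
    and U :: "(real \<Rightarrow> complex ^ 'n) \<Rightarrow> real \<Rightarrow> nat \<Rightarrow> complex"
  assumes rep: "spectral_representation V \<mu> n U"
begin

lemma sets_mu [simp, measurable_cong]: "sets \<mu> = sets borel"
  using rep by (simp add: spectral_representation_def)

lemma space_mu [simp]: "space \<mu> = UNIV"
  using sets_eq_imp_space_eq[OF sets_mu] by simp

lemma sigma_finite_mu: "sigma_finite_measure \<mu>"
  using rep by (simp add: spectral_representation_def)

lemma n_measurable [measurable]: "n \<in> measurable \<mu> (count_space UNIV)"
  using rep by (simp add: spectral_representation_def)

lemma U_fibre: "f \<in> L2 \<Longrightarrow> U f \<in> fibre_L2 \<mu> n"
  using rep by (simp add: spectral_representation_def)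

lemma U_lincomb: "f \<in> L2 \<Longrightarrow> g \<in> L2 \<Longrightarrow> AE x in \<mu>. \<forall>k<n x. U (\<lambda>t. a *s f t + b *s g t) x k = a * U f x k + b * U g x k"
  using rep by (simp add: spectral_representation_def fibre_eq_def)

lemma U_norm: "f \<in> L2 \<Longrightarrow> (LINT x|\<mu>. (\<Sum>k<n x. (cmod (U f x k))\<^sup>2)) = sqnorm f"
  using rep by (simp add: spectral_representation_def)

lemma U_surj: "h \<in> fibre_L2 \<mu> n \<Longrightarrow> \<exists>f\<in>L2. AE x in \<mu>. \<forall>k<n x. U f x k = h x k"
  using rep by (simp add: spectral_representation_def fibre_eq_def)

lemma U_schroedinger: "f \<in> L2 \<Longrightarrow> g \<in> L2 \<Longrightarrow>
    schroedinger V f g \<longleftrightarrow> (AE x in \<mu>. \<forall>k<n x. U g x k = of_real x * U f x k)"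
  using rep by (simp add: spectral_representation_def fibre_eq_def)

lemma U_add: "f \<in> L2 \<Longrightarrow> g \<in> L2 \<Longrightarrow> AE x in \<mu>. \<forall>k<n x. U (\<lambda>t. f t + g t) x k = U f x k + U g x k"
  using U_lincomb[of f g 1 1] by simp

lemma U_scale: "f \<in> L2 \<Longrightarrow> AE x in \<mu>. \<forall>k<n x. U (\<lambda>t. a *s f t) x k = a * U f x k"
  using U_lincomb[of f f a 0] by simp

lemma U_measurable [measurable]: "f \<in> L2 \<Longrightarrow> (\<lambda>x. U f x k) \<in> borel_measurable \<mu>"
  using U_fibre[of f] by (simp add: fibre_L2_def)

lemma U_integrable: "f \<in> L2 \<Longrightarrow> integrable \<mu> (\<lambda>x. \<Sum>k<n x. (cmod (U f x k))\<^sup>2)"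
  using U_fibre[of f] by (simp add: fibre_L2_def)

text \<open>\<open>n\<close> takes countably many values, and on each level set the sum has a fixed number of terms.\<close>

lemma sum_below_n_measurable:
  fixes F :: "nat \<Rightarrow> real \<Rightarrow> 'b::{second_countable_topology, real_normed_vector}"
  assumes "\<And>k. F k \<in> borel_measurable \<mu>"
  shows "(\<lambda>x. \<Sum>k<n x. F k x) \<in> borel_measurable \<mu>"
proof (rule measurable_compose_countable[OF _ n_measurable])
  show "(\<lambda>x. \<Sum>k<i. F k x) \<in> borel_measurable \<mu>" for i
    by (intro borel_measurable_sum assms)
qed

definition uip :: "(real \<Rightarrow> complex ^ 'n) \<Rightarrow> (real \<Rightarrow> complex ^ 'n) \<Rightarrow> complex" where
  "uip f g = (LINT x|\<mu>. (\<Sum>k<n x. U f x k * cnj (U g x k)))"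

lemma uip_integrable:
  assumes f: "f \<in> L2" and g: "g \<in> L2"
  shows "integrable \<mu> (\<lambda>x. \<Sum>k<n x. U f x k * cnj (U g x k))"
proof (rule Bochner_Integration.integrable_bound)
  show "(\<lambda>x. \<Sum>k<n x. U f x k * cnj (U g x k)) \<in> borel_measurable \<mu>"
    by (intro sum_below_n_measurable borel_measurable_times U_measurable f
         measurable_compose[OF U_measurable[OF g], of cnj borel] borel_measurable_continuous_onI continuous_intros)
  show "integrable \<mu> (\<lambda>x. (\<Sum>k<n x. (cmod (U f x k))\<^sup>2) + (\<Sum>k<n x. (cmod (U g x k))\<^sup>2))"
    by (intro Bochner_Integration.integrable_add U_integrable f g)
  show "AE x in \<mu>. norm (\<Sum>k<n x. U f x k * cnj (U g x k)) \<le>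
      norm ((\<Sum>k<n x. (cmod (U f x k))\<^sup>2) + (\<Sum>k<n x. (cmod (U g x k))\<^sup>2))"
  proof (rule AE_I2)
    fix x
    have "norm (\<Sum>k<n x. U f x k * cnj (U g x k)) \<le> (\<Sum>k<n x. (cmod (U f x k))\<^sup>2 + (cmod (cnj (U g x k)))\<^sup>2)"
      by (intro order_trans[OF norm_sum] sum_mono norm_mult_le_squares)
    also have "\<dots> = (\<Sum>k<n x. (cmod (U f x k))\<^sup>2) + (\<Sum>k<n x. (cmod (U g x k))\<^sup>2)"
      by (simp add: sum.distrib)
    finally show "norm (\<Sum>k<n x. U f x k * cnj (U g x k)) \<le>
      norm ((\<Sum>k<n x. (cmod (U f x k))\<^sup>2) + (\<Sum>k<n x. (cmod (U g x k))\<^sup>2))" by simp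
  qed
qed

lemma sqnorm_add_scaled_U:
  assumes f: "f \<in> L2" and g: "g \<in> L2"
  shows "sqnorm (\<lambda>t. f t + c *s g t) = sqnorm f + (cmod c)\<^sup>2 * sqnorm g + 2 * Re (cnj c * uip f g)"
proof -
  note ii = uip_integrable[OF f g]
  have ic: "integrable \<mu> (\<lambda>x. cnj c * (\<Sum>k<n x. U f x k * cnj (U g x k)))" using ii by (rule integrable_mult_right)
  have L: "(\<lambda>t. f t + c *s g t) \<in> L2" using L2_lincomb[OF f g, of 1 c] by simp
  have "AE x in \<mu>. (\<Sum>k<n x. (cmod (U (\<lambda>t. f t + c *s g t) x k))\<^sup>2) =
      (\<Sum>k<n x. (cmod (U f x k))\<^sup>2) + (cmod c)\<^sup>2 * (\<Sum>k<n x. (cmod (U g x k))\<^sup>2)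
      + 2 * Re (cnj c * (\<Sum>k<n x. U f x k * cnj (U g x k)))"
    using U_lincomb[OF f g, of 1 c]
  proof eventually_elim
    case (elim x)
    have "(\<Sum>k<n x. (cmod (U (\<lambda>t. f t + c *s g t) x k))\<^sup>2) = (\<Sum>k<n x. (cmod (U f x k + c * U g x k))\<^sup>2)"
      using elim by simp
    thus ?case by (simp add: cmod_add_scaled_square sum.distrib sum_distrib_left Re_sum)
  qed
  hence "sqnorm (\<lambda>t. f t + c *s g t) = (LINT x|\<mu>. (\<Sum>k<n x. (cmod (U f x k))\<^sup>2) + (cmod c)\<^sup>2 * (\<Sum>k<n x. (cmod (U g x k))\<^sup>2)
      + 2 * Re (cnj c * (\<Sum>k<n x. U f x k * cnj (U g x k))))"
    unfolding U_norm[OF L, symmetric]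
    by (intro integral_cong_AE borel_measurable_integrable U_integrable L f g Bochner_Integration.integrable_add
          integrable_mult_right integrable_Re[OF ic])
  also have "\<dots> = (LINT x|\<mu>. (\<Sum>k<n x. (cmod (U f x k))\<^sup>2) + (cmod c)\<^sup>2 * (\<Sum>k<n x. (cmod (U g x k))\<^sup>2))
      + (LINT x|\<mu>. 2 * Re (cnj c * (\<Sum>k<n x. U f x k * cnj (U g x k))))"
    by (intro Bochner_Integration.integral_add Bochner_Integration.integrable_add U_integrable f g integrable_mult_right integrable_Re[OF ic])
  also have "(LINT x|\<mu>. (\<Sum>k<n x. (cmod (U f x k))\<^sup>2) + (cmod c)\<^sup>2 * (\<Sum>k<n x. (cmod (U g x k))\<^sup>2))
      = sqnorm f + (cmod c)\<^sup>2 * sqnorm g"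
    using Bochner_Integration.integral_add[OF U_integrable[OF f] integrable_mult_right[OF U_integrable[OF g], of "(cmod c)\<^sup>2"]]
    by (simp only: U_norm[OF f, symmetric] U_norm[OF g, symmetric] integral_mult_right_zero)
  also have "(LINT x|\<mu>. 2 * Re (cnj c * (\<Sum>k<n x. U f x k * cnj (U g x k)))) = 2 * Re (cnj c * uip f g)"
    by (simp only: integral_mult_right_zero integral_Re[OF ic] uip_def)
  finally show ?thesis .
qed

text \<open>A norm-preserving map preserves inner products, by polarization with \<open>1\<close> and \<open>\<i>\<close>.\<close>

lemma uip_eq_ip:
  assumes f: "f \<in> L2" and g: "g \<in> L2"
  shows "uip f g = ip f g"
proof (rule complex_eqI)
  show "Re (uip f g) = Re (ip f g)"
    using sqnorm_add_scaled[OF f g, of 1] sqnorm_add_scaled_U[OF f g, of 1] by simp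
  show "Im (uip f g) = Im (ip f g)"
    using sqnorm_add_scaled[OF f g, of \<i>] sqnorm_add_scaled_U[OF f g, of \<i>] by simp
qed

text \<open>If \<open>U f x k\<close> is thought of as the integral of \<open>f\<close> against the conjugate of a generalized eigenfunction \<open>\<phi>\<close> at energy \<open>x\<close>,
  then integration by parts over \<open>(-\<infinity>, s]\<close> makes this the Wronskian \<open>bil a (cnj (\<phi>' s)) - bil b (cnj (\<phi> s))\<close>: the boundary values of the
  eigenfunction at \<open>s\<close>, without any reference to an eigenfunction. It is defined from square integrable functions only, hence
  it makes sense for almost every \<open>x\<close>.\<close>

definition boundary_form :: "real \<Rightarrow> complex ^ 'n \<Rightarrow> complex ^ 'n \<Rightarrow> real \<Rightarrow> nat \<Rightarrow> complex" where
  "boundary_form s a b x k = U (L_left_bump s a b) x k - of_real x * U (left_bump s a b) x k"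

lemma boundary_form_measurable [measurable]: "(\<lambda>x. boundary_form s a b x k) \<in> borel_measurable \<mu>"
proof -
  have [measurable]: "(\<lambda>x. U (L_left_bump s a b) x k) \<in> borel_measurable \<mu>" "(\<lambda>x. U (left_bump s a b) x k) \<in> borel_measurable \<mu>"
    by (intro U_measurable halves_L2)+
  show ?thesis unfolding boundary_form_def by measurable
qed

text \<open>Comparing the element of the domain that is glued from \<open>g\<close> on \<open>[s, T]\<close> with the bump at \<open>T\<close>: the right halves cancel. For an
  eigenfunction at the energy \<open>x = y\<close> this says that the Wronskian with a solution \<open>g\<close> at energy \<open>y\<close> is constant.\<close>

lemma boundary_form_transfer:
  fixes y :: real
  assumes g: "weak_derivatives g g' w" and sT: "s \<le> T"
    and eq: "\<And>t. s \<le> t \<Longrightarrow> t < T \<Longrightarrow> - w t + cV t *v g t = of_real y *s g t"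
  shows "AE x in \<mu>. \<forall>k<n x. boundary_form s (g s) (g' s) x k - boundary_form T (g T) (g' T) x k = of_real (x - y) * U (cut_out s T g) x k"
proof -
  obtain K where K: "\<And>t. t \<in> {s..T} \<Longrightarrow> norm (g t) \<le> K"
    using compact_imp_bounded[OF compact_continuous_image[OF weak_derivatives_continuous(1)[OF g, of "{s..T}"] compact_Icc]]
    unfolding bounded_iff by blast
  have sg: "cut_out s T g \<in> L2" by (rule cut_out_L2(1)[OF weak_derivatives_continuous(1)[OF g] K])
  let ?left_bump = "left_bump s (g s) (g' s)" and ?L_left_bump = "L_left_bump s (g s) (g' s)"
  let ?lbT = "left_bump T (g T) (g' T)" and ?lwT = "L_left_bump T (g T) (g' T)"
  let ?right_bump = "right_bump T (g T) (g' T)" and ?L_right_bump = "L_right_bump T (g T) (g' T)"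
  have L: "(\<lambda>t. cut_out s T g t + ?right_bump t) \<in> L2" "(\<lambda>t. of_real y *s cut_out s T g t + ?L_right_bump t) \<in> L2" "(\<lambda>t. of_real y *s cut_out s T g t) \<in> L2"
    "(\<lambda>t. ?left_bump t + (cut_out s T g t + ?right_bump t)) \<in> L2" "(\<lambda>t. ?L_left_bump t + (of_real y *s cut_out s T g t + ?L_right_bump t)) \<in> L2"
    "(\<lambda>t. ?lbT t + ?right_bump t) \<in> L2" "(\<lambda>t. ?lwT t + ?L_right_bump t) \<in> L2"
    by (intro L2_add L2_scale sg halves_L2)+
  have E1: "AE x in \<mu>. \<forall>k<n x. U (\<lambda>t. ?L_left_bump t + (of_real y *s cut_out s T g t + ?L_right_bump t)) x k =
      of_real x * U (\<lambda>t. ?left_bump t + (cut_out s T g t + ?right_bump t)) x k"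
    by (rule U_schroedinger[OF L(4,5), THEN iffD1, OF schroedinger_glued[OF g sT]]) (rule eq)
  have E2: "AE x in \<mu>. \<forall>k<n x. U (\<lambda>t. ?lwT t + ?L_right_bump t) x k = of_real x * U (\<lambda>t. ?lbT t + ?right_bump t) x k"
    by (rule U_schroedinger[OF L(6,7), THEN iffD1, OF schroedinger_bump])
  show ?thesis
    using E1 E2 U_add[OF halves_L2(1) L(1), of s "g s" "g' s"] U_add[OF sg halves_L2(3), of T "g T" "g' T"]
      U_add[OF halves_L2(2) L(2), of s "g s" "g' s"] U_add[OF L(3) halves_L2(4), of T "g T" "g' T"] U_scale[OF sg, of "of_real y"]
      U_add[OF halves_L2(1,3), of T "g T" "g' T" T "g T" "g' T"] U_add[OF halves_L2(2,4), of T "g T" "g' T" T "g T" "g' T"]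
  proof eventually_elim
    case (elim x)
    show ?case
    proof (intro allI impI)
      fix k assume k: "k < n x"
      note e = elim[rule_format, OF k]
      have 1: "U ?L_left_bump x k + (of_real y * U (cut_out s T g) x k + U ?L_right_bump x k) = of_real x * (U ?left_bump x k + (U (cut_out s T g) x k + U ?right_bump x k))"
        using e(1) unfolding e(3) e(4) e(5) e(6) e(7) .
      have 2: "U ?lwT x k + U ?L_right_bump x k = of_real x * (U ?lbT x k + U ?right_bump x k)"
        using e(2) unfolding e(8) e(9) .
      show "boundary_form s (g s) (g' s) x k - boundary_form T (g T) (g' T) x k = of_real (x - y) * U (cut_out s T g) x k"
        unfolding boundary_form_def of_real_diff
        unfolding add_diff_cancel_right'[of "U ?L_left_bump x k" "of_real y * U (cut_out s T g) x k + U ?L_right_bump x k", unfolded 1, symmetric]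
          add_diff_cancel_right'[of "U ?lwT x k" "U ?L_right_bump x k", unfolded 2, symmetric]
        by (simp add: algebra_simps)
    qed
  qed
qed

lemma left_bump_linear: "left_bump s (c *s a + d *s a') (c *s b + d *s b') t = c *s left_bump s a b t + d *s left_bump s a' b' t"
  by (simp add: left_bump_def bump_linear)

lemma L_left_bump_linear: "L_left_bump s (c *s a + d *s a') (c *s b + d *s b') t = c *s L_left_bump s a b t + d *s L_left_bump s a' b' t"
  by (simp only: L_left_bump_def Lbump_def bump_linear matrix_vector_right_distrib vector_scalar_commute)
     (simp add: vec_eq_iff algebra_simps)

lemma boundary_form_lincomb: "AE x in \<mu>. \<forall>k<n x. boundary_form s (c *s a + d *s a') (c *s b + d *s b') x k = c * boundary_form s a b x k + d * boundary_form s a' b' x k"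
  using U_lincomb[OF halves_L2(1,1), of c s a b d s a' b'] U_lincomb[OF halves_L2(2,2), of c s a b d s a' b']
proof eventually_elim
  case (elim x)
  have "left_bump s (c *s a + d *s a') (c *s b + d *s b') = (\<lambda>t. c *s left_bump s a b t + d *s left_bump s a' b' t)"
    "L_left_bump s (c *s a + d *s a') (c *s b + d *s b') = (\<lambda>t. c *s L_left_bump s a b t + d *s L_left_bump s a' b' t)"
    by (rule ext, rule left_bump_linear, rule ext, rule L_left_bump_linear)
  with elim show ?case by (simp add: boundary_form_def algebra_simps)
qed

text \<open>Linearity in the data holds outside a null set that depends on the data, so only finite sums can be taken at once.\<close>

lemma boundary_form_sum:
  assumes "finite J"
  shows "AE x in \<mu>. \<forall>k<n x. boundary_form s (\<Sum>j\<in>J. c j *s a j) (\<Sum>j\<in>J. c j *s b j) x k = (\<Sum>j\<in>J. c j * boundary_form s (a j) (b j) x k)"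
  using assms
proof (induction J)
  case empty
  show ?case using boundary_form_lincomb[of s 0 0 0 0 0 0] by simp
next
  case (insert i J)
  have "AE x in \<mu>. \<forall>k<n x. boundary_form s (c i *s a i + 1 *s (\<Sum>j\<in>J. c j *s a j)) (c i *s b i + 1 *s (\<Sum>j\<in>J. c j *s b j)) x k
      = c i * boundary_form s (a i) (b i) x k + 1 * boundary_form s (\<Sum>j\<in>J. c j *s a j) (\<Sum>j\<in>J. c j *s b j) x k"
    by (rule boundary_form_lincomb)
  with insert.IH show ?case
    by eventually_elim (use insert.hyps in simp)
qed

end

text \<open>For each fixed \<open>y\<close> the relation \<open>eq\<close> holds for almost all \<open>x\<close>, and one would like to put \<open>y = x\<close>; but the diagonal may meet all the exceptional
  null sets. Instead the integral \<open>E\<close> of the square of the left-hand side on the diagonal over \<open>[-R, R]\<close> is estimated.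
  Let \<open>y\<close> run through a grid of width \<open>1/m\<close>. On a cell, \<open>c q x\<close> is uniformly close to \<open>c q y\<close>, and
  \<open>|x - y|\<^sup>2 \<le> 1/m\<^sup>2\<close>, while there are only about \<open>m\<close> cells, each with \<open>S y\<close> bounded in \<open>L\<^sup>2\<close>. The sum tends to \<open>0\<close>.\<close>

lemma (in spectral) diagonal_vanishing:
  fixes c :: "'q \<Rightarrow> real \<Rightarrow> complex" and A :: "'q \<Rightarrow> real \<Rightarrow> nat \<Rightarrow> complex" and S :: "real \<Rightarrow> real \<Rightarrow> nat \<Rightarrow> complex"
  assumes Q: "finite Q" and c: "\<And>q. q \<in> Q \<Longrightarrow> continuous_on UNIV (c q)"
    and Am: "\<And>q k. q \<in> Q \<Longrightarrow> (\<lambda>x. A q x k) \<in> borel_measurable \<mu>"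
    and Ai: "\<And>q R. q \<in> Q \<Longrightarrow> integrable \<mu> (\<lambda>x. indicator {-R..R} x * (\<Sum>k<n x. (cmod (A q x k))\<^sup>2))"
    and Si: "\<And>y. integrable \<mu> (\<lambda>x. \<Sum>k<n x. (cmod (S y x k))\<^sup>2)"
    and SG: "\<And>R. \<exists>G. \<forall>y\<in>{-R..R}. (LINT x|\<mu>. (\<Sum>k<n x. (cmod (S y x k))\<^sup>2)) \<le> G"
    and eq: "\<And>y. AE x in \<mu>. \<forall>k<n x. (\<Sum>q\<in>Q. c q y * A q x k) = of_real (x - y) * S y x k"
  shows "AE x in \<mu>. \<forall>k<n x. (\<Sum>q\<in>Q. c q x * A q x k) = 0"
proof -
  have bounded: "AE x in \<mu>. \<bar>x\<bar> \<le> R \<longrightarrow> (\<forall>k<n x. (\<Sum>q\<in>Q. c q x * A q x k) = 0)" if R: "R \<ge> 0" for R :: real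
  proof -
    define E where "E x = indicator {-R..R} x * (\<Sum>k<n x. (cmod (\<Sum>q\<in>Q. c q x * A q x k))\<^sup>2)" for x
    obtain G where G: "\<And>y. y \<in> {-(R+1)..R+1} \<Longrightarrow> (LINT x|\<mu>. (\<Sum>k<n x. (cmod (S y x k))\<^sup>2)) \<le> G"
      using SG[of "R + 1"] by blast
    define J where "J = (\<Sum>q\<in>Q. LINT x|\<mu>. indicator {-R..R} x * (\<Sum>k<n x. (cmod (A q x k))\<^sup>2))"
    have J0: "J \<ge> 0" unfolding J_def by (intro sum_nonneg integral_nonneg_AE AE_I2 mult_nonneg_nonneg) auto
    have cm: "c q \<in> borel_measurable \<mu>" if "q \<in> Q" for q
      using borel_measurable_continuous_onI[OF c[OF that]] by (simp cong: measurable_cong_sets)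
    have Em: "E \<in> borel_measurable \<mu>"
      unfolding E_def[abs_def]
    proof (intro borel_measurable_times sum_below_n_measurable)
      show "indicator {-R..R} \<in> borel_measurable \<mu>" by simp
      fix k
      have "(\<lambda>x. \<Sum>q\<in>Q. c q x * A q x k) \<in> borel_measurable \<mu>"
        by (intro borel_measurable_sum borel_measurable_times cm Am)
      thus "(\<lambda>x. (cmod (\<Sum>q\<in>Q. c q x * A q x k))\<^sup>2) \<in> borel_measurable \<mu>" by measurable
    qed
    \<comment> \<open>The majorant \<open>B\<close> belongs to the grid \<open>Y\<close> of width \<open>1/m\<close>; its integral is bounded with \<open>G\<close>, a bound for \<open>S\<close> on a slightly larger interval.\<close>
    have key: "\<exists>B. integrable \<mu> B \<and> (AE x in \<mu>. E x \<le> B x) \<and>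
        (LINT x|\<mu>. B x) \<le> 2 * \<epsilon>\<^sup>2 * real (card Q) * J + 2 / real m * (2 * (R + 1) + 1) * \<bar>G\<bar>"
      if \<epsilon>: "\<epsilon> > 0" and m: "m > 0" and unif: "\<And>q x y. q \<in> Q \<Longrightarrow> \<bar>x\<bar> \<le> R \<Longrightarrow> \<bar>x - y\<bar> \<le> 1 / real m \<Longrightarrow> cmod (c q x - c q y) \<le> \<epsilon>"
      for \<epsilon> :: real and m :: nat
    proof -
      define M where "M = \<lceil>R * real m\<rceil>"
      define Y where "Y = (\<lambda>i. real_of_int i / real m) ` {-M..M}"
      have finY: "finite Y" by (simp add: Y_def)
      have M: "of_int M \<le> R * real m + 1" "R * real m \<le> of_int M" unfolding M_def by linarith+
      have "0 \<le> R * real m" using R by simp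
      hence "0 \<le> real_of_int M" using M(2) by linarith
      hence M0: "M \<ge> 0" by simp
      have "card Y \<le> card {-M..M}" unfolding Y_def by (rule card_image_le) simp
      also have "\<dots> = nat (2 * M + 1)" by simp
      finally have "real (card Y) \<le> of_int (2 * M + 1)" using M0 by linarith
      also have "\<dots> \<le> 2 * (R * real m + 1) + 1" using M by simp
      also have "\<dots> \<le> real m * (2 * (R + 1) + 1)" using m by (simp add: algebra_simps)
      finally have cardY: "real (card Y) \<le> real m * (2 * (R + 1) + 1)" .
      have Yb: "y \<in> {-(R+1)..R+1}" if y: "y \<in> Y" for y
      proof -
        obtain i where i: "y = of_int i / real m" "i \<in> {-M..M}" using y unfolding Y_def by (rule imageE)
        have "\<bar>real_of_int i\<bar> \<le> R * real m + 1" using i M by auto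
        also have "\<dots> \<le> (R + 1) * real m" using m by (simp add: algebra_simps)
        finally have "\<bar>y\<bar> \<le> R + 1" using m by (simp add: i field_simps)
        thus ?thesis by auto
      qed
      define B where "B x = 2 * \<epsilon>\<^sup>2 * real (card Q) * (\<Sum>q\<in>Q. indicator {-R..R} x * (\<Sum>k<n x. (cmod (A q x k))\<^sup>2))
          + 2 / (real m)\<^sup>2 * (\<Sum>y\<in>Y. \<Sum>k<n x. (cmod (S y x k))\<^sup>2)" for x
      have i1: "integrable \<mu> (\<lambda>x. \<Sum>q\<in>Q. indicator {-R..R} x * (\<Sum>k<n x. (cmod (A q x k))\<^sup>2))"
        by (intro Bochner_Integration.integrable_sum Ai)
      have i2: "integrable \<mu> (\<lambda>x. \<Sum>y\<in>Y. \<Sum>k<n x. (cmod (S y x k))\<^sup>2)"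
        by (intro Bochner_Integration.integrable_sum Si)
      have "integrable \<mu> B" unfolding B_def[abs_def]
        by (intro Bochner_Integration.integrable_add integrable_mult_right i1 i2)
      moreover have "AE x in \<mu>. E x \<le> B x"
      proof -
        have "AE x in \<mu>. \<forall>y\<in>Y. \<forall>k<n x. (\<Sum>q\<in>Q. c q y * A q x k) = of_real (x - y) * S y x k"
          using finY eq by (simp add: AE_finite_all)
        thus ?thesis
        proof eventually_elim
          case (elim x)
          show ?case
          proof (cases "\<bar>x\<bar> \<le> R")
            case True
            hence x: "x \<in> {-R..R}" by auto
            define i where "i = \<lfloor>x * real m\<rfloor>"
            define y where "y = of_int i / real m"
            have xm: "-R * real m \<le> x * real m" "x * real m \<le> R * real m"
              using x mult_right_mono[of "-R" x "real m"] mult_right_mono[of x R "real m"] by auto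
            have "of_int (-M) \<le> x * real m" using xm M by simp
            hence "-M \<le> i" unfolding i_def by (rule le_floor_iff[THEN iffD2])
            moreover have "real_of_int i \<le> x * real m" unfolding i_def by (rule of_int_floor_le)
            hence "real_of_int i \<le> real_of_int M" using xm M by linarith
            hence "i \<le> M" by simp
            ultimately have "i \<in> {-M..M}" by simp
            hence yY: "y \<in> Y" by (auto simp: Y_def y_def)
            have "\<bar>x * real m - of_int i\<bar> \<le> 1" unfolding i_def by linarith
            hence "\<bar>x * real m - of_int i\<bar> / real m \<le> 1 / real m" by (rule divide_right_mono) simp
            moreover have "x - y = (x * real m - of_int i) / real m" using m by (simp add: y_def diff_divide_distrib)
            ultimately have xy: "\<bar>x - y\<bar> \<le> 1 / real m" by simp
            have est: "(cmod (\<Sum>q\<in>Q. c q x * A q x k))\<^sup>2 \<le>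
                2 * \<epsilon>\<^sup>2 * real (card Q) * (\<Sum>q\<in>Q. (cmod (A q x k))\<^sup>2) + 2 / (real m)\<^sup>2 * (cmod (S y x k))\<^sup>2" if k: "k < n x" for k
            proof -
              have "(\<Sum>q\<in>Q. c q x * A q x k) = (\<Sum>q\<in>Q. (c q x - c q y) * A q x k) + of_real (x - y) * S y x k"
                unfolding elim[rule_format, OF yY k, symmetric] by (simp add: sum_subtractf left_diff_distrib)
              also have "cmod \<dots> \<le> (\<Sum>q\<in>Q. \<epsilon> * cmod (A q x k)) + 1 / real m * cmod (S y x k)"
              proof (intro order_trans[OF norm_triangle_ineq] add_mono order_trans[OF norm_sum] sum_mono)
                show "cmod ((c q x - c q y) * A q x k) \<le> \<epsilon> * cmod (A q x k)" if "q \<in> Q" for q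
                  using unif[OF that True xy] by (simp add: norm_mult mult_right_mono)
                show "cmod (of_real (x - y) * S y x k) \<le> 1 / real m * cmod (S y x k)"
                  using xy by (simp only: norm_mult norm_of_real) (intro mult_right_mono, auto)
              qed
              finally have "(cmod (\<Sum>q\<in>Q. c q x * A q x k))\<^sup>2 \<le> (\<epsilon> * (\<Sum>q\<in>Q. cmod (A q x k)) + 1 / real m * cmod (S y x k))\<^sup>2"
                by (intro power_mono) (simp_all add: sum_distrib_left)
              also have "\<dots> \<le> 2 * (\<epsilon> * (\<Sum>q\<in>Q. cmod (A q x k)))\<^sup>2 + 2 * (1 / real m * cmod (S y x k))\<^sup>2"
                using sum_squares_bound[of "\<epsilon> * (\<Sum>q\<in>Q. cmod (A q x k))" "1 / real m * cmod (S y x k)"]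
                unfolding power2_sum by linarith
              also have "(\<Sum>q\<in>Q. cmod (A q x k))\<^sup>2 \<le> real (card Q) * (\<Sum>q\<in>Q. (cmod (A q x k))\<^sup>2)"
                using Cauchy_Schwarz_ineq_sum[of "\<lambda>_. 1" "\<lambda>q. cmod (A q x k)" Q] by simp
              hence "2 * (\<epsilon> * (\<Sum>q\<in>Q. cmod (A q x k)))\<^sup>2 \<le> 2 * \<epsilon>\<^sup>2 * real (card Q) * (\<Sum>q\<in>Q. (cmod (A q x k))\<^sup>2)"
                by (simp add: power_mult_distrib mult_left_mono mult.assoc)
              finally show ?thesis by (simp add: power_mult_distrib power_divide)
            qed
            have "E x \<le> (\<Sum>k<n x. 2 * \<epsilon>\<^sup>2 * real (card Q) * (\<Sum>q\<in>Q. (cmod (A q x k))\<^sup>2) + 2 / (real m)\<^sup>2 * (cmod (S y x k))\<^sup>2)"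
            proof -
              have "E x = (\<Sum>k<n x. (cmod (\<Sum>q\<in>Q. c q x * A q x k))\<^sup>2)" using x by (simp add: E_def)
              also have "\<dots> \<le> (\<Sum>k<n x. 2 * \<epsilon>\<^sup>2 * real (card Q) * (\<Sum>q\<in>Q. (cmod (A q x k))\<^sup>2) + 2 / (real m)\<^sup>2 * (cmod (S y x k))\<^sup>2)"
                by (intro sum_mono est) simp
              finally show ?thesis .
            qed
            also have "\<dots> = 2 * \<epsilon>\<^sup>2 * real (card Q) * (\<Sum>q\<in>Q. (\<Sum>k<n x. (cmod (A q x k))\<^sup>2)) + 2 / (real m)\<^sup>2 * (\<Sum>k<n x. (cmod (S y x k))\<^sup>2)"
              by (simp only: sum.distrib sum_distrib_left[symmetric] sum.swap[of _ Q])
            also have "\<dots> \<le> B x"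
              unfolding B_def using x finY yY
              by (intro add_mono mult_left_mono) (auto intro!: member_le_sum[of y Y "\<lambda>y. \<Sum>k<n x. (cmod (S y x k))\<^sup>2"] sum_nonneg)
            finally show ?thesis .
          next
            case False
            hence "x \<notin> {-R..R}" by auto
            thus ?thesis by (simp add: E_def B_def sum_nonneg)
          qed
        qed
      qed
      moreover have "(LINT x|\<mu>. B x) \<le> 2 * \<epsilon>\<^sup>2 * real (card Q) * J + 2 / real m * (2 * (R + 1) + 1) * \<bar>G\<bar>"
      proof -
        have e: "(LINT x|\<mu>. B x) = 2 * \<epsilon>\<^sup>2 * real (card Q) * J + 2 / (real m)\<^sup>2 * (\<Sum>y\<in>Y. LINT x|\<mu>. (\<Sum>k<n x. (cmod (S y x k))\<^sup>2))"
          unfolding B_def J_def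
          by (simp only: Bochner_Integration.integral_add[OF integrable_mult_right[OF i1] integrable_mult_right[OF i2]] integral_mult_right_zero
              Bochner_Integration.integral_sum[OF Ai] Bochner_Integration.integral_sum[OF Si])
        have "(\<Sum>y\<in>Y. LINT x|\<mu>. (\<Sum>k<n x. (cmod (S y x k))\<^sup>2)) \<le> (\<Sum>y\<in>Y. \<bar>G\<bar>)"
          by (intro sum_mono order_trans[OF G abs_ge_self] Yb)
        also have "\<dots> = real (card Y) * \<bar>G\<bar>" by simp
        also have "\<dots> \<le> real m * (2 * (R + 1) + 1) * \<bar>G\<bar>"
          by (rule mult_right_mono[OF cardY]) simp
        finally have "2 / (real m)\<^sup>2 * (\<Sum>y\<in>Y. LINT x|\<mu>. (\<Sum>k<n x. (cmod (S y x k))\<^sup>2)) \<le> 2 / (real m)\<^sup>2 * (real m * (2 * (R + 1) + 1) * \<bar>G\<bar>)"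
          by (rule mult_left_mono) simp
        also have "\<dots> = 2 / real m * (2 * (R + 1) + 1) * \<bar>G\<bar>"
          using m by (simp add: power2_eq_square)
        finally show ?thesis unfolding e by (rule add_left_mono)
      qed
      ultimately show ?thesis by (intro exI[of _ B] conjI)
    qed
    have small: "\<exists>B. integrable \<mu> B \<and> (AE x in \<mu>. E x \<le> B x) \<and> (LINT x|\<mu>. B x) \<le> \<eta>" if \<eta>: "\<eta> > 0" for \<eta> :: real
    proof -
      define H where "H = 2 * real (card Q) * J"
      have H0: "H \<ge> 0" using J0 by (simp add: H_def)
      define h where "h = H + 1"
      have h: "h > 0" "H \<le> h" using H0 by (auto simp: h_def)
      define \<epsilon> where "\<epsilon> = min 1 (\<eta> / (2 * h))"
      have \<epsilon>: "\<epsilon> > 0" "\<epsilon> \<le> 1" "\<epsilon> \<le> \<eta> / (2 * h)" using \<eta> h by (auto simp: \<epsilon>_def)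
      have "\<epsilon>\<^sup>2 \<le> \<epsilon>" using mult_left_mono[OF \<epsilon>(2), of \<epsilon>] \<epsilon>(1) by (simp add: power2_eq_square)
      hence "\<epsilon>\<^sup>2 * H \<le> \<epsilon> * h"
        using h H0 \<epsilon>(1) by (intro mult_mono) auto
      also have "\<dots> \<le> \<eta> / (2 * h) * h" using h by (intro mult_right_mono \<epsilon>(3)) simp
      also have "\<dots> = \<eta> / 2" using h by simp
      finally have e1: "2 * \<epsilon>\<^sup>2 * real (card Q) * J \<le> \<eta> / 2" by (simp add: H_def mult_ac)
      have "\<exists>\<delta>. \<delta> > 0 \<and> (\<forall>x\<in>{-(R+1)..R+1}. \<forall>y\<in>{-(R+1)..R+1}. dist y x < \<delta> \<longrightarrow> dist (c q y) (c q x) < \<epsilon>)" if q: "q \<in> Q" for q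
      proof -
        have "uniformly_continuous_on {-(R+1)..R+1} (c q)"
          by (rule compact_uniformly_continuous[OF continuous_on_subset[OF c[OF q] subset_UNIV] compact_Icc])
        from this[unfolded uniformly_continuous_on_def, rule_format, OF \<epsilon>(1)] show ?thesis by auto
      qed
      hence "\<forall>q\<in>Q. \<exists>\<delta>. \<delta> > 0 \<and> (\<forall>x\<in>{-(R+1)..R+1}. \<forall>y\<in>{-(R+1)..R+1}. dist y x < \<delta> \<longrightarrow> dist (c q y) (c q x) < \<epsilon>)" by (rule ballI)
      then obtain d where d: "\<forall>q\<in>Q. d q > 0 \<and> (\<forall>x\<in>{-(R+1)..R+1}. \<forall>y\<in>{-(R+1)..R+1}. dist y x < d q \<longrightarrow> dist (c q y) (c q x) < \<epsilon>)"
        using bchoice[of Q] by metis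
      define \<delta> where "\<delta> = Min (insert 1 (d ` Q))"
      have \<delta>1: "\<delta> > 0" unfolding \<delta>_def using Q d by (subst Min_gr_iff) auto
      have \<delta>2: "dist (c q y) (c q x) < \<epsilon>" if "q \<in> Q" "x \<in> {-(R+1)..R+1}" "y \<in> {-(R+1)..R+1}" "dist y x < \<delta>" for q x y
      proof -
        have "\<delta> \<le> d q" unfolding \<delta>_def by (rule Min_le) (use Q that in auto)
        hence "dist y x < d q" using that by linarith
        with d that show ?thesis by blast
      qed
      note \<delta> = \<delta>1 \<delta>2
      define W where "W = 2 * (2 * (R + 1) + 1) * \<bar>G\<bar>"
      have W0: "W \<ge> 0" using R by (simp add: W_def)
      obtain m :: nat where m: "real m > 1 / \<delta> + 1 + 2 * W / \<eta>" using reals_Archimedean2 by blast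
      have "0 \<le> 2 * W / \<eta>" "0 < 1 / \<delta>" using W0 \<eta> \<delta>(1) by auto
      hence m1': "real m > 1 / \<delta>" "real m \<ge> 1" "real m \<ge> 2 * W / \<eta>" "real m > 0"
        using m by linarith+
      hence m1: "real m > 1 / \<delta>" "real m \<ge> 1" "real m \<ge> 2 * W / \<eta>" "m > 0" by simp_all
      have md: "1 / real m < \<delta>" "1 / real m \<le> 1" using m1 \<delta>(1) by (auto simp: field_simps)
      have "W / real m \<le> \<eta> / 2" using m1 \<eta> by (simp add: field_simps)
      hence e2: "2 / real m * (2 * (R + 1) + 1) * \<bar>G\<bar> \<le> \<eta> / 2" by (simp add: W_def)
      have "cmod (c q x - c q y) \<le> \<epsilon>" if q: "q \<in> Q" and x: "\<bar>x\<bar> \<le> R" and xy: "\<bar>x - y\<bar> \<le> 1 / real m" for q x y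
      proof -
        have xx: "-R \<le> x" "x \<le> R" "-1 \<le> x - y" "x - y \<le> 1" "\<bar>x - y\<bar> < \<delta>" using x xy md by linarith+
        have "dist (c q x) (c q y) < \<epsilon>"
          by (rule \<delta>(2)[OF q]) (use xx in \<open>auto simp: dist_real_def\<close>)
        thus ?thesis by (simp add: dist_norm)
      qed
      note K = key[OF \<epsilon>(1) m1(4) this]
      obtain B where B: "integrable \<mu> B \<and> (AE x in \<mu>. E x \<le> B x) \<and>
          (LINT x|\<mu>. B x) \<le> 2 * \<epsilon>\<^sup>2 * real (card Q) * J + 2 / real m * (2 * (R + 1) + 1) * \<bar>G\<bar>"
        using K by (rule exE)
      show ?thesis
        by (intro exI[of _ B] conjI B[THEN conjunct1] B[THEN conjunct2, THEN conjunct1])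
           (use B[THEN conjunct2, THEN conjunct2] e1 e2 in linarith)
    qed
    have E0: "E x \<ge> 0" for x by (simp add: E_def sum_nonneg)
    have "\<exists>B. integrable \<mu> B \<and> (AE x in \<mu>. E x \<le> B x) \<and> (LINT x|\<mu>. B x) \<le> 1"
      by (rule small) simp
    then obtain B1 where B1: "integrable \<mu> B1 \<and> (AE x in \<mu>. E x \<le> B1 x) \<and> (LINT x|\<mu>. B1 x) \<le> 1"
      by (rule exE)
    have Ei: "integrable \<mu> E"
    proof (rule Bochner_Integration.integrable_bound[OF B1[THEN conjunct1] Em])
      show "AE x in \<mu>. norm (E x) \<le> norm (B1 x)"
        using B1[THEN conjunct2, THEN conjunct1] by eventually_elim (use E0 in \<open>simp add: order_trans[OF _ abs_ge_self]\<close>)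
    qed
    have "(LINT x|\<mu>. E x) \<le> 0 + \<eta>" if \<eta>: "\<eta> > 0" for \<eta>
    proof -
      obtain B where B: "integrable \<mu> B \<and> (AE x in \<mu>. E x \<le> B x) \<and> (LINT x|\<mu>. B x) \<le> \<eta>" using small[OF \<eta>] by (rule exE)
      have "(LINT x|\<mu>. E x) \<le> (LINT x|\<mu>. B x)"
        by (rule integral_mono_AE[OF Ei B[THEN conjunct1] B[THEN conjunct2, THEN conjunct1]])
      thus ?thesis using B by simp
    qed
    hence le0: "(LINT x|\<mu>. E x) \<le> 0" by (rule field_le_epsilon)
    have ge0: "(LINT x|\<mu>. E x) \<ge> 0" by (rule integral_nonneg_AE) (use E0 in auto)
    have "AE x in \<mu>. E x = 0"
      by (rule integral_nonneg_eq_0_iff_AE[OF Ei AE_I2[OF E0], THEN iffD1]) (rule antisym[OF le0 ge0])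
    thus ?thesis
    proof eventually_elim
      case (elim x)
      show ?case
      proof (intro impI allI)
        fix k assume x: "\<bar>x\<bar> \<le> R" and k: "k < n x"
        hence "x \<in> {-R..R}" by auto
        hence "(\<Sum>k<n x. (cmod (\<Sum>q\<in>Q. c q x * A q x k))\<^sup>2) = 0" using elim by (simp add: E_def)
        hence "\<forall>k\<in>{..<n x}. (cmod (\<Sum>q\<in>Q. c q x * A q x k))\<^sup>2 = 0" by (subst (asm) sum_nonneg_eq_0_iff) auto
        thus "(\<Sum>q\<in>Q. c q x * A q x k) = 0" using k by simp
      qed
    qed
  qed
  have "AE x in \<mu>. \<forall>i::nat. \<bar>x\<bar> \<le> real i \<longrightarrow> (\<forall>k<n x. (\<Sum>q\<in>Q. c q x * A q x k) = 0)"
    unfolding AE_all_countable using bounded by simp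
  thus ?thesis
  proof eventually_elim
    case (elim x)
    obtain i :: nat where i: "\<bar>x\<bar> \<le> real i" using real_arch_simple[of "\<bar>x\<bar>"] by (rule exE)
    from elim[rule_format, OF i] show ?case by simp
  qed
qed

section \<open>The transfer matrix acts on the boundary forms\<close>

lemma weak_derivatives_reflect:
  fixes u :: "real \<Rightarrow> complex ^ 'n::finite"
  assumes u: "weak_derivatives u u' w"
  shows "weak_derivatives (\<lambda>t. u (T - t)) (\<lambda>t. - u' (T - t)) (\<lambda>t. w (T - t))"
  unfolding weak_derivatives_def
proof (intro conjI allI impI)
  show "((\<lambda>t. u (T - t)) has_vector_derivative - u' (T - t)) (at t)" for t
  proof -
    have "(u has_vector_derivative u' (T - t)) (at (T - t))" using u by (simp add: weak_derivatives_def)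
    hence "((u \<circ> (\<lambda>t. T - t)) has_vector_derivative (-1) *\<^sub>R u' (T - t)) (at t)"
      by (intro vector_diff_chain_at) (auto intro!: derivative_eq_intros)
    thus ?thesis by (simp add: o_def)
  qed
  fix a b :: real assume ab: "a \<le> b"
  have sh: "((\<lambda>t. f (T - t)) has_integral i) {a..b}" if "(f has_integral i) {T - b..T - a}"
    for f :: "real \<Rightarrow> 'b::euclidean_space" and i
  proof -
    have "(\<lambda>x. T - x) ` {T - b..T - a} = {a..b}"
      using image_diff_atLeastAtMost[of T "T - b" "T - a"] by simp
    thus ?thesis
      using has_integral_affinity[of f i "T - b" "T - a" "-1" "T"] that by (simp add: algebra_simps)
  qed
  have w: "w absolutely_integrable_on {T - b..T - a}" "(w has_integral (u' (T - a) - u' (T - b))) {T - b..T - a}"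
    using u ab by (auto simp: weak_derivatives_def)
  show "(\<lambda>t. w (T - t)) absolutely_integrable_on {a..b}"
    using sh[of w] sh[of "\<lambda>t. norm (w t)"] w(1)
    unfolding absolutely_integrable_on_def integrable_on_def by auto
  show "((\<lambda>t. w (T - t)) has_integral (- u' (T - b) - (- u' (T - a)))) {a..b}"
    using sh[OF w(2)] by simp
qed

text \<open>The unit initial data are indexed by \<open>'n + 'n\<close>: values on the left, slopes on the right. Then \<open>coord\<close> is the vector of
  coordinates of a pair of data in this basis.\<close>

definition basis_value :: "'n + 'n \<Rightarrow> complex ^ 'n::finite" where "basis_value = case_sum (\<lambda>i. axis i 1) (\<lambda>i. 0)"
definition basis_slope :: "'n + 'n \<Rightarrow> complex ^ 'n::finite" where "basis_slope = case_sum (\<lambda>i. 0) (\<lambda>i. axis i 1)"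
definition coord :: "complex ^ 'n::finite \<Rightarrow> complex ^ 'n \<Rightarrow> 'n + 'n \<Rightarrow> complex" where
  "coord a b = case_sum (\<lambda>i. a $ i) (\<lambda>i. b $ i)"

lemma sum_over_sum_type: "(\<Sum>j\<in>(UNIV :: ('n::finite + 'n) set). f j) = (\<Sum>i\<in>UNIV. f (Inl i)) + (\<Sum>i\<in>UNIV. f (Inr i))"
  unfolding UNIV_Plus_UNIV[symmetric] by (subst sum.Plus) auto

lemma coord_expand: "(\<Sum>j\<in>UNIV. coord a b j *s basis_value j) = a" "(\<Sum>j\<in>UNIV. coord a b j *s basis_slope j) = b"
proof -
  have "(\<Sum>i\<in>UNIV. c $ i *s axis i 1) = c" for c :: "complex ^ 'a"
    by (simp add: vec_eq_iff axis_def if_distrib[of "\<lambda>x. _ * x"] cong: if_cong)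
  thus "(\<Sum>j\<in>UNIV. coord a b j *s basis_value j) = a" "(\<Sum>j\<in>UNIV. coord a b j *s basis_slope j) = b"
    by (simp_all add: sum_over_sum_type coord_def basis_value_def basis_slope_def)
qed

lemma coord_unit: "coord (basis_value j) (basis_slope j) i = (if i = j then 1 else 0)"
  by (auto simp: coord_def basis_value_def basis_slope_def axis_def split: sum.splits)

context potential
begin

text \<open>The transposed monodromy matrix at energy \<open>z\<close>: row \<open>j\<close> holds the data after one period of the solution that starts from
  the \<open>j\<close>-th unit data.\<close>

definition transfer :: "complex \<Rightarrow> 'n + 'n \<Rightarrow> 'n + 'n \<Rightarrow> complex" where
  "transfer z j i = coord (sol (\<lambda>r. cV r - mat z) (basis_value j) (basis_slope j) 1) (sol' (\<lambda>r. cV r - mat z) (basis_value j) (basis_slope j) 1) i"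

end

context spectral
begin

definition basis_form :: "real \<Rightarrow> 'n + 'n \<Rightarrow> real \<Rightarrow> nat \<Rightarrow> complex" where
  "basis_form s j x k = boundary_form s (basis_value j) (basis_slope j) x k"

lemma basis_form_measurable [measurable]: "(\<lambda>x. basis_form s j x k) \<in> borel_measurable \<mu>"
  unfolding basis_form_def by (rule boundary_form_measurable)

lemma boundary_form_expand: "AE x in \<mu>. \<forall>k<n x. boundary_form s a b x k = (\<Sum>j\<in>UNIV. coord a b j * basis_form s j x k)"
  using boundary_form_sum[of "UNIV :: ('n + 'n) set" s "coord a b" basis_value basis_slope] by (simp add: coord_expand basis_form_def)

text \<open>On bounded energies the boundary forms are square integrable, with a bound by norms of half bumps, which are the same at all
  integer positions. This is the polynomial boundedness of generalized eigenfunctions in disguise.\<close>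

lemma boundary_form_L2:
  shows "integrable \<mu> (\<lambda>x. indicator {-R..R} x * (\<Sum>k<n x. (cmod (boundary_form s a b x k))\<^sup>2))"
    and "(LINT x|\<mu>. indicator {-R..R} x * (\<Sum>k<n x. (cmod (boundary_form s a b x k))\<^sup>2))
      \<le> 2 * sqnorm (L_left_bump s a b) + 2 * R\<^sup>2 * sqnorm (left_bump s a b)"
proof -
  define B where "B x = 2 * (\<Sum>k<n x. (cmod (U (L_left_bump s a b) x k))\<^sup>2) + 2 * R\<^sup>2 * (\<Sum>k<n x. (cmod (U (left_bump s a b) x k))\<^sup>2)" for x
  have Bi: "integrable \<mu> B" unfolding B_def[abs_def]
    by (intro Bochner_Integration.integrable_add integrable_mult_right U_integrable halves_L2)
  have le: "indicator {-R..R} x * (\<Sum>k<n x. (cmod (boundary_form s a b x k))\<^sup>2) \<le> B x" for x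
  proof (cases "x \<in> {-R..R}")
    case True
    have "(cmod (boundary_form s a b x k))\<^sup>2 \<le> 2 * (cmod (U (L_left_bump s a b) x k))\<^sup>2 + 2 * R\<^sup>2 * (cmod (U (left_bump s a b) x k))\<^sup>2" for k
    proof -
      have "cmod (boundary_form s a b x k) \<le> cmod (U (L_left_bump s a b) x k) + \<bar>x\<bar> * cmod (U (left_bump s a b) x k)"
        unfolding boundary_form_def using norm_triangle_ineq4[of "U (L_left_bump s a b) x k" "of_real x * U (left_bump s a b) x k"] by (simp add: norm_mult)
      hence "(cmod (boundary_form s a b x k))\<^sup>2 \<le> (cmod (U (L_left_bump s a b) x k) + \<bar>x\<bar> * cmod (U (left_bump s a b) x k))\<^sup>2"
        by (intro power_mono) auto
      also have "\<dots> \<le> 2 * (cmod (U (L_left_bump s a b) x k))\<^sup>2 + 2 * (\<bar>x\<bar> * cmod (U (left_bump s a b) x k))\<^sup>2"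
        using sum_squares_bound[of "cmod (U (L_left_bump s a b) x k)" "\<bar>x\<bar> * cmod (U (left_bump s a b) x k)"] unfolding power2_sum by linarith
      also have "(\<bar>x\<bar> * cmod (U (left_bump s a b) x k))\<^sup>2 \<le> R\<^sup>2 * (cmod (U (left_bump s a b) x k))\<^sup>2"
        unfolding power_mult_distrib using True by (intro mult_right_mono power_mono) auto
      finally show ?thesis by simp
    qed
    hence "(\<Sum>k<n x. (cmod (boundary_form s a b x k))\<^sup>2) \<le> (\<Sum>k<n x. 2 * (cmod (U (L_left_bump s a b) x k))\<^sup>2 + 2 * R\<^sup>2 * (cmod (U (left_bump s a b) x k))\<^sup>2)"
      by (intro sum_mono)
    thus ?thesis using True by (simp add: B_def sum.distrib sum_distrib_left)
  next
    case False
    thus ?thesis by (simp add: B_def sum_nonneg)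
  qed
  have ind: "(indicator {-R..R} :: real \<Rightarrow> real) \<in> borel_measurable \<mu>" by simp
  have "(\<lambda>x. indicator {-R..R} x * (\<Sum>k<n x. (cmod (boundary_form s a b x k))\<^sup>2)) \<in> borel_measurable \<mu>"
    by (intro borel_measurable_times ind sum_below_n_measurable) measurable
  thus i: "integrable \<mu> (\<lambda>x. indicator {-R..R} x * (\<Sum>k<n x. (cmod (boundary_form s a b x k))\<^sup>2))"
  proof (rule Bochner_Integration.integrable_bound[OF Bi], intro AE_I2)
    fix x
    have "0 \<le> indicat_real {-R..R} x * (\<Sum>k<n x. (cmod (boundary_form s a b x k))\<^sup>2)" by (simp add: sum_nonneg)
    thus "norm (indicator {-R..R} x * (\<Sum>k<n x. (cmod (boundary_form s a b x k))\<^sup>2)) \<le> norm (B x)"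
      using le[of x] by simp
  qed
  have "(LINT x|\<mu>. indicator {-R..R} x * (\<Sum>k<n x. (cmod (boundary_form s a b x k))\<^sup>2)) \<le> (LINT x|\<mu>. B x)"
    by (rule integral_mono[OF i Bi le])
  also have "\<dots> = 2 * sqnorm (L_left_bump s a b) + 2 * R\<^sup>2 * sqnorm (left_bump s a b)"
    unfolding B_def
    by (simp only: Bochner_Integration.integral_add[OF integrable_mult_right[OF U_integrable[OF halves_L2(2)]] integrable_mult_right[OF U_integrable[OF halves_L2(1)]]]
       integral_mult_right_zero U_norm[OF halves_L2(1)] U_norm[OF halves_L2(2)])
  finally show "(LINT x|\<mu>. indicator {-R..R} x * (\<Sum>k<n x. (cmod (boundary_form s a b x k))\<^sup>2))
      \<le> 2 * sqnorm (L_left_bump s a b) + 2 * R\<^sup>2 * sqnorm (left_bump s a b)" .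
qed

text \<open>Constancy of the Wronskian at the energy \<open>x\<close> itself. For solutions depending continuously on the energy \<open>y\<close>,
  \<open>boundary_form_transfer\<close> holds for every \<open>y\<close> almost everywhere, and \<open>diagonal_vanishing\<close> gives the diagonal.\<close>

lemma basis_form_relation:
  fixes g g' w :: "real \<Rightarrow> real \<Rightarrow> complex ^ 'n"
  assumes g: "\<And>y. weak_derivatives (g y) (g' y) (w y)" and sT: "s \<le> T"
    and eq: "\<And>y t. s \<le> t \<Longrightarrow> t < T \<Longrightarrow> - w y t + cV t *v g y t = of_real y *s g y t"
    and cont: "\<And>j. continuous_on UNIV (\<lambda>y. coord (g y s) (g' y s) j)" "\<And>j. continuous_on UNIV (\<lambda>y. coord (g y T) (g' y T) j)"
    and bound: "\<And>R. \<exists>K. \<forall>y\<in>{-R..R}. \<forall>t\<in>{s..T}. norm (g y t) \<le> K"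
  shows "AE x in \<mu>. \<forall>k<n x. (\<Sum>j\<in>UNIV. coord (g x s) (g' x s) j * basis_form s j x k) = (\<Sum>j\<in>UNIV. coord (g x T) (g' x T) j * basis_form T j x k)"
proof -
  define c where "c = (\<lambda>q y. case q of Inl j \<Rightarrow> coord (g y s) (g' y s) j | Inr j \<Rightarrow> - coord (g y T) (g' y T) j)"
  define B where "B = (\<lambda>q. case q of Inl j \<Rightarrow> basis_form s j | Inr j \<Rightarrow> basis_form T j)"
  have sum: "(\<Sum>q\<in>UNIV. c q y * B q x k) = (\<Sum>j\<in>UNIV. coord (g y s) (g' y s) j * basis_form s j x k) - (\<Sum>j\<in>UNIV. coord (g y T) (g' y T) j * basis_form T j x k)" for x y k
    by (simp add: sum_over_sum_type[where 'n = "'n + 'n"] c_def B_def sum_negf)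
  have sgL: "cut_out s T (g y) \<in> L2" for y
  proof -
    have "y \<in> {-\<bar>y\<bar>..\<bar>y\<bar>}" by auto
    moreover obtain K where "\<forall>y\<in>{-\<bar>y\<bar>..\<bar>y\<bar>}. \<forall>t\<in>{s..T}. norm (g y t) \<le> K" using bound[of "\<bar>y\<bar>"] by (rule exE)
    ultimately have "norm (g y t) \<le> K" if "t \<in> {s..T}" for t using that by blast
    thus ?thesis by (rule cut_out_L2(1)[OF weak_derivatives_continuous(1)[OF g]])
  qed
  have "AE x in \<mu>. \<forall>k<n x. (\<Sum>q\<in>UNIV. c q x * B q x k) = 0"
  proof (rule diagonal_vanishing[where S = "\<lambda>y. U (cut_out s T (g y))"])
    show "continuous_on UNIV (c q)" for q
      using cont by (cases q) (simp_all add: c_def continuous_on_minus)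
    show "(\<lambda>x. B q x k) \<in> borel_measurable \<mu>" for q k
      by (cases q) (simp_all add: B_def)
    show "integrable \<mu> (\<lambda>x. indicator {-R..R} x * (\<Sum>k<n x. (cmod (B q x k))\<^sup>2))" for q R
      using boundary_form_L2(1) by (cases q) (simp_all add: B_def basis_form_def)
    show "integrable \<mu> (\<lambda>x. \<Sum>k<n x. (cmod (U (cut_out s T (g y)) x k))\<^sup>2)" for y
      by (rule U_integrable[OF sgL])
    show "\<exists>G. \<forall>y\<in>{-R..R}. (LINT x|\<mu>. (\<Sum>k<n x. (cmod (U (cut_out s T (g y)) x k))\<^sup>2)) \<le> G" for R
    proof -
      obtain K where K: "\<forall>y\<in>{-R..R}. \<forall>t\<in>{s..T}. norm (g y t) \<le> K" using bound[of R] by (rule exE)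
      show ?thesis
      proof (intro exI ballI)
        fix y assume y: "y \<in> {-R..R}"
        show "(LINT x|\<mu>. (\<Sum>k<n x. (cmod (U (cut_out s T (g y)) x k))\<^sup>2)) \<le> \<bar>K\<bar>\<^sup>2 * integral {s..T} (\<lambda>t. (1 + v t)\<^sup>2)"
          unfolding U_norm[OF sgL]
          by (rule cut_out_L2(2)[OF weak_derivatives_continuous(1)[OF g] K[rule_format, OF y]])
      qed
    qed
    fix y
    have tr: "AE x in \<mu>. \<forall>k<n x. boundary_form s (g y s) (g' y s) x k - boundary_form T (g y T) (g' y T) x k = of_real (x - y) * U (cut_out s T (g y)) x k"
      by (rule boundary_form_transfer[OF g sT]) (rule eq)
    show "AE x in \<mu>. \<forall>k<n x. (\<Sum>q\<in>UNIV. c q y * B q x k) = complex_of_real (x - y) * U (cut_out s T (g y)) x k"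
      using tr boundary_form_expand[of s "g y s" "g' y s"] boundary_form_expand[of T "g y T" "g' y T"]
    proof eventually_elim
      case (elim x)
      show ?case
      proof (intro allI impI)
        fix k assume k: "k < n x"
        show "(\<Sum>q\<in>UNIV. c q y * B q x k) = complex_of_real (x - y) * U (cut_out s T (g y)) x k"
          unfolding sum elim(2)[rule_format, OF k, symmetric] elim(3)[rule_format, OF k, symmetric]
          by (rule elim(1)[rule_format, OF k])
      qed
    qed
  qed auto
  thus ?thesis unfolding sum by simp
qed

lemma continuous_co_sol:
  assumes V: "locally_integrable W" and t: "t \<ge> 0"
  shows "continuous_on UNIV (\<lambda>y::real. coord (sol (\<lambda>r. W r - mat (of_real y)) a b t) (sol' (\<lambda>r. W r - mat (of_real y)) a b t) j)"
proof -
  have r: "continuous_on UNIV (\<lambda>y::real. f (of_real y :: complex))" if "f holomorphic_on UNIV" for f :: "complex \<Rightarrow> complex"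
    by (rule continuous_on_compose2[OF holomorphic_on_imp_continuous_on[OF that]]) (auto intro!: continuous_intros)
  show ?thesis
    by (cases j) (simp_all add: coord_def r[OF holomorphic_sol(1)[OF V t]] r[OF holomorphic_sol(2)[OF V t]])
qed

lemma bounded_sol:
  fixes W :: "real \<Rightarrow> complex ^ 'n ^ 'n"
  assumes W: "locally_integrable W" and T: "T \<ge> 0"
  shows "\<exists>K. \<forall>y\<in>{-R..R}. \<forall>t\<in>{0..T}. norm (sol (\<lambda>r. W r - mat (of_real y)) a b t) \<le> K"
proof (intro exI ballI)
  fix y t :: real assume y: "y \<in> {-R..R}" and t: "t \<in> {0..T}"
  have "cmod (of_real y) \<le> R" using y by auto
  from norm_sol_le[OF locally_integrable_shifted[OF W] integral_entry_norm_shifted_le[OF W T this], of t] t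
  show "norm (sol (\<lambda>r. W r - mat (of_real y)) a b t) \<le>
    (norm a + T * norm b) * exp ((integral {0..T} (\<lambda>s. entry_norm (W s)) + T * (real CARD('n) * R)) * T)" by simp
qed

lemma basis_form_forward_general:
  assumes sT: "s \<le> T"
  shows "AE x in \<mu>. \<forall>k<n x. basis_form s j x k = (\<Sum>i\<in>UNIV. coord (sol (\<lambda>r. cV (r + s) - mat (of_real x)) (basis_value j) (basis_slope j) (T - s))
       (sol' (\<lambda>r. cV (r + s) - mat (of_real x)) (basis_value j) (basis_slope j) (T - s)) i * basis_form T i x k)"
proof -
  define W where "W r = cV (r + s)" for r
  have W: "locally_integrable W" using locally_integrable_cV_shift[of "-s"] by (simp add: W_def[abs_def])
  note Wy = locally_integrable_shifted[OF W]
  define Q where "Q y r = W r - mat (of_real y)" for y r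
  have Q: "locally_integrable (Q y)" for y using Wy by (simp add: Q_def[abs_def])
  have "AE x in \<mu>. \<forall>k<n x.
      (\<Sum>i\<in>UNIV. coord (sol (Q x) (basis_value j) (basis_slope j) (s - s)) (sol' (Q x) (basis_value j) (basis_slope j) (s - s)) i * basis_form s i x k) =
      (\<Sum>i\<in>UNIV. coord (sol (Q x) (basis_value j) (basis_slope j) (T - s)) (sol' (Q x) (basis_value j) (basis_slope j) (T - s)) i * basis_form T i x k)"
  proof (rule basis_form_relation[OF weak_derivatives_shift[OF weak_derivatives_sol[OF Q]] sT])
    fix y t assume t: "s \<le> t" "t < T"
    show "- (if t - s < 0 then 0 else Q y (t - s) *v sol (Q y) (basis_value j) (basis_slope j) (t - s)) + cV t *v sol (Q y) (basis_value j) (basis_slope j) (t - s)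
       = of_real y *s sol (Q y) (basis_value j) (basis_slope j) (t - s)"
      using t by (simp add: Q_def W_def matrix_vector_mult_diff_rdistrib mat_vector_mult)
  next
    show "continuous_on UNIV (\<lambda>y. coord (sol (Q y) (basis_value j) (basis_slope j) (s - s)) (sol' (Q y) (basis_value j) (basis_slope j) (s - s)) i)" for i
      unfolding Q_def by (rule continuous_co_sol[OF W]) simp
    show "continuous_on UNIV (\<lambda>y. coord (sol (Q y) (basis_value j) (basis_slope j) (T - s)) (sol' (Q y) (basis_value j) (basis_slope j) (T - s)) i)" for i
      unfolding Q_def by (rule continuous_co_sol[OF W]) (use sT in simp)
    show "\<exists>K. \<forall>y\<in>{- R..R}. \<forall>t\<in>{s..T}. norm (sol (Q y) (basis_value j) (basis_slope j) (t - s)) \<le> K" for R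
    proof -
      obtain K where K: "\<forall>y\<in>{-R..R}. \<forall>t\<in>{0..T - s}. norm (sol (Q y) (basis_value j) (basis_slope j) t) \<le> K"
        using bounded_sol[OF W, of "T - s" R "basis_value j" "basis_slope j"] sT unfolding Q_def by auto
      thus ?thesis by (intro exI[of _ K] ballI) auto
    qed
  qed
  moreover have "coord (sol (Q x) (basis_value j) (basis_slope j) (s - s)) (sol' (Q x) (basis_value j) (basis_slope j) (s - s)) i = (if i = j then 1 else 0)" for x i
    using coord_unit[of j i] by (simp add: sol_at_0[OF Q] sol'_nonpos)
  ultimately show ?thesis
    unfolding Q_def[abs_def] W_def by (simp add: if_distrib[of "\<lambda>x. x * _"] cong: if_cong)
qed

text \<open>By periodicity, moving the base point by one period to the left multiplies the boundary forms by one and the same matrix.\<close>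

lemma basis_form_transfer:
  "AE x in \<mu>. \<forall>k<n x. basis_form (of_int m - 1) j x k = (\<Sum>i\<in>UNIV. transfer (of_real x) j i * basis_form (of_int m) i x k)"
proof -
  have "cV (r + (of_int m - 1)) = cV r" for r
    using cV_periodic[of r "m - 1"] by (simp add: algebra_simps)
  thus ?thesis
    using basis_form_forward_general[of "of_int m - 1" "of_int m" j] by (simp add: transfer_def)
qed

lemma locally_integrable_cV_reflect: "locally_integrable (\<lambda>t. cV (T - t))"
  unfolding locally_integrable_def absolutely_integrable_on_def integrable_on_def
proof (intro allI conjI)
  fix a b :: real
  have sh: "((\<lambda>t. f (T - t)) has_integral i) {a..b}" if "(f has_integral i) {T - b..T - a}"
    for f :: "real \<Rightarrow> 'c::euclidean_space" and i
  proof -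
    have "(\<lambda>x. T - x) ` {T - b..T - a} = {a..b}"
      using image_diff_atLeastAtMost[of T "T - b" "T - a"] by simp
    thus ?thesis
      using has_integral_affinity[of f i "T - b" "T - a" "-1" "T"] that by (simp add: algebra_simps)
  qed
  have c: "cV absolutely_integrable_on {T - b..T - a}" by (rule locally_integrableD[OF locally_integrable_cV])
  show "\<exists>i. ((\<lambda>t. cV (T - t)) has_integral i) {a..b}"
    using sh[OF integrable_integral[OF set_lebesgue_integral_eq_integral(1)[OF c]]] by (rule exI)
  have "(\<lambda>t. norm (cV t)) integrable_on {T - b..T - a}" using c by (simp only: absolutely_integrable_on_def)
  from sh[OF integrable_integral[OF this]]
  show "\<exists>i. ((\<lambda>t. norm (cV (T - t))) has_integral i) {a..b}" by (rule exI)
qed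

text \<open>The reflected equation carries data from \<open>T\<close> back to \<open>s\<close>, with the slopes changing sign.\<close>

lemma basis_form_backward_general:
  assumes sT: "s \<le> T"
  shows "\<exists>M. AE x in \<mu>. \<forall>k<n x. basis_form T j x k = (\<Sum>i\<in>UNIV. M x i * basis_form s i x k)"
proof -
  define W where "W r = cV (T - r)" for r
  have W: "locally_integrable W" using locally_integrable_cV_reflect by (simp add: W_def[abs_def])
  define Q where "Q y r = W r - mat (of_real y)" for y r
  have Q: "locally_integrable (Q y)" for y using locally_integrable_shifted[OF W] by (simp add: Q_def[abs_def])
  have c: "continuous_on UNIV (\<lambda>y. coord (sol (Q y) (basis_value j) (- basis_slope j) \<tau>) (- sol' (Q y) (basis_value j) (- basis_slope j) \<tau>) i)" if \<tau>: "\<tau> \<ge> 0" for \<tau> i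
    using continuous_co_sol[OF W \<tau>, of "basis_value j" "- basis_slope j" i]
    unfolding Q_def by (cases i) (auto simp: coord_def intro: continuous_on_minus)
  have "AE x in \<mu>. \<forall>k<n x.
      (\<Sum>i\<in>UNIV. coord (sol (Q x) (basis_value j) (- basis_slope j) (T - s)) (- sol' (Q x) (basis_value j) (- basis_slope j) (T - s)) i * basis_form s i x k) =
      (\<Sum>i\<in>UNIV. coord (sol (Q x) (basis_value j) (- basis_slope j) (T - T)) (- sol' (Q x) (basis_value j) (- basis_slope j) (T - T)) i * basis_form T i x k)"
  proof (rule basis_form_relation[OF weak_derivatives_reflect[OF weak_derivatives_sol[OF Q]] sT])
    fix y t assume t: "s \<le> t" "t < T"
    show "- (if T - t < 0 then 0 else Q y (T - t) *v sol (Q y) (basis_value j) (- basis_slope j) (T - t)) + cV t *v sol (Q y) (basis_value j) (- basis_slope j) (T - t)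
       = of_real y *s sol (Q y) (basis_value j) (- basis_slope j) (T - t)"
      using t by (simp add: Q_def W_def matrix_vector_mult_diff_rdistrib mat_vector_mult)
  next
    show "\<exists>K. \<forall>y\<in>{- R..R}. \<forall>t\<in>{s..T}. norm (sol (Q y) (basis_value j) (- basis_slope j) (T - t)) \<le> K" for R
    proof -
      obtain K where K: "\<forall>y\<in>{-R..R}. \<forall>t\<in>{0..T - s}. norm (sol (Q y) (basis_value j) (- basis_slope j) t) \<le> K"
        using bounded_sol[OF W, of "T - s" R "basis_value j" "- basis_slope j"] sT unfolding Q_def by auto
      thus ?thesis by (intro exI[of _ K] ballI) auto
    qed
  qed (use c sT in auto)
  moreover have "coord (sol (Q x) (basis_value j) (- basis_slope j) (T - T)) (- sol' (Q x) (basis_value j) (- basis_slope j) (T - T)) i = (if i = j then 1 else 0)" for x i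
    using coord_unit[of j i] by (simp add: sol_at_0[OF Q] sol'_nonpos)
  ultimately have E: "AE x in \<mu>. \<forall>k<n x.
      (\<Sum>i\<in>UNIV. coord (sol (Q x) (basis_value j) (- basis_slope j) (T - s)) (- sol' (Q x) (basis_value j) (- basis_slope j) (T - s)) i * basis_form s i x k) = basis_form T j x k"
    by (simp add: if_distrib[of "\<lambda>x. x * _"] cong: if_cong)
  show ?thesis
    by (rule exI[of _ "\<lambda>x i. coord (sol (Q x) (basis_value j) (- basis_slope j) (T - s)) (- sol' (Q x) (basis_value j) (- basis_slope j) (T - s)) i"],
        rule eventually_mono[OF E]) simp
qed

text \<open>The boundary forms at one point determine those at every other point.\<close>

lemma basis_form_span: "\<exists>M. AE x in \<mu>. \<forall>k<n x. basis_form s j x k = (\<Sum>i\<in>UNIV. M x i * basis_form T i x k)"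
proof (cases "s \<le> T")
  case True
  show ?thesis by (rule exI) (rule basis_form_forward_general[OF True])
next
  case False
  thus ?thesis by (intro basis_form_backward_general) simp
qed

end

section \<open>Injectivity of the boundary forms and the bound on the trace\<close>

text \<open>Gaussian elimination with measurable pivots, by induction on the number \<open>d\<close> of unknowns. If the last column vanishes on a set of positive measure, the last
  unit vector is in the kernel there. Otherwise a pivot exists almost everywhere, and on each set \<open>Sj j\<close> where row \<open>j\<close> is a pivot row
  the last unknown can be eliminated.\<close>

lemma measurable_kernel_selection:
  fixes a :: "'i::finite \<Rightarrow> nat \<Rightarrow> 'x \<Rightarrow> complex"
  assumes S: "S \<in> sets M" and a: "\<And>i k. a i k \<in> borel_measurable M"
  shows "(AE x in M. x \<in> S \<longrightarrow> (\<forall>c. (\<forall>i. (\<Sum>k<d. c k * a i k x) = 0) \<longrightarrow> (\<forall>k<d. c k = 0))) \<or>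
    (\<exists>S' c. S' \<in> sets M \<and> S' \<subseteq> S \<and> emeasure M S' > 0 \<and> (\<forall>k. c k \<in> borel_measurable M) \<and>
       (\<forall>x\<in>S'. (\<forall>i. (\<Sum>k<d. c k x * a i k x) = 0) \<and> (\<exists>k<d. c k x \<noteq> 0)))"
  using assms
proof (induction d arbitrary: S a)
  case 0
  show ?case by simp
next
  case (Suc d)
  note [measurable] = Suc.prems(1) Suc.prems(2)
  define Z where "Z = {x\<in>space M. x \<in> S \<and> (\<forall>i. a i d x = 0)}"
  have Zm [measurable]: "Z \<in> sets M" unfolding Z_def by measurable
  show ?case
  proof (cases "emeasure M Z > 0")
    case True
    show ?thesis
    proof (intro disjI2 exI[of _ Z] exI[of _ "\<lambda>k x. if k = d then 1 else 0 :: complex"] conjI)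
      show "Z \<subseteq> S" by (auto simp: Z_def)
      show "\<forall>k. (\<lambda>x. if k = d then 1 else 0 :: complex) \<in> borel_measurable M" by simp
      show "\<forall>x\<in>Z. (\<forall>i. (\<Sum>k<Suc d. (if k = d then 1 else 0) * a i k x) = 0) \<and> (\<exists>k<Suc d. (if k = d then 1 else 0 :: complex) \<noteq> 0)"
        by (auto simp: Z_def)
    qed (use True in simp_all)
  next
    case False
    hence Znull: "Z \<in> null_sets M" using Zm by (auto simp: null_sets_def)
    define b where "b j i k x = a i k x - a j k x / a j d x * a i d x" for j i k x
    define Sj where "Sj j = {x\<in>space M. x \<in> S \<and> a j d x \<noteq> 0}" for j
    have bm: "b j i k \<in> borel_measurable M" for j i k
      unfolding b_def by measurable
    have Sjm [measurable]: "Sj j \<in> sets M" for j unfolding Sj_def by measurable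
    have elim_eq: "(\<Sum>k<Suc d. c k * a i k x) = (\<Sum>k<d. c k * b j i k x) + (a i d x / a j d x) * (\<Sum>k<Suc d. c k * a j k x)"
      if "a j d x \<noteq> 0" for c j i x
    proof -
      have "(\<Sum>k<d. c k * b j i k x) = (\<Sum>k<d. c k * a i k x) - a i d x / a j d x * (\<Sum>k<d. c k * a j k x)"
        by (simp add: b_def algebra_simps sum_subtractf sum_distrib_left)
      thus ?thesis using that by (simp add: algebra_simps)
    qed
    define Good where "Good j \<longleftrightarrow> (\<exists>S' c. S' \<in> sets M \<and> S' \<subseteq> Sj j \<and> emeasure M S' > 0 \<and> (\<forall>k. c k \<in> borel_measurable M) \<and>
       (\<forall>x\<in>S'. (\<forall>i. (\<Sum>k<d. c k x * b j i k x) = 0) \<and> (\<exists>k<d. c k x \<noteq> 0)))" for j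
    show ?thesis
    proof (cases "\<exists>j. Good j")
      case True
      then obtain j where "Good j" by (rule exE)
      then obtain S' c where j: "S' \<in> sets M" "S' \<subseteq> Sj j" "emeasure M S' > 0" "\<forall>k. c k \<in> borel_measurable M"
        "\<forall>x\<in>S'. (\<forall>i. (\<Sum>k<d. c k x * b j i k x) = 0) \<and> (\<exists>k<d. c k x \<noteq> 0)" unfolding Good_def by (elim exE conjE)
      define c' where "c' k x = (if k = d then - (\<Sum>k<d. c k x * a j k x) / a j d x else c k x)" for k x
      have lt: "(\<Sum>k<d. c' k x * f k) = (\<Sum>k<d. c k x * f k)" for x and f :: "nat \<Rightarrow> complex"
        by (intro sum.cong) (auto simp: c'_def)
      have [measurable]: "c k \<in> borel_measurable M" for k using j(4) by simp
      have c'm: "c' k \<in> borel_measurable M" for k unfolding c'_def by measurable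
      show ?thesis
      proof (intro disjI2 exI[of _ S'] exI[of _ c'] conjI ballI)
        show "S' \<subseteq> S" using j(2) by (auto simp: Sj_def)
        fix x assume x: "x \<in> S'"
        hence ne: "a j d x \<noteq> 0" using j(2) by (auto simp: Sj_def)
        have zero: "(\<Sum>k<Suc d. c' k x * a j k x) = 0"
          using ne lt[of x "\<lambda>k. a j k x"] by (simp add: c'_def[of d])
        show "\<forall>i. (\<Sum>k<Suc d. c' k x * a i k x) = 0"
        proof
          fix i
          show "(\<Sum>k<Suc d. c' k x * a i k x) = 0"
            unfolding elim_eq[OF ne, of "\<lambda>k. c' k x" i] zero lt[of x "\<lambda>k. b j i k x"] using j(5) x by simp
        qed
        obtain k where "k < d" "c k x \<noteq> 0" using j(5) x by blast
        thus "\<exists>k<Suc d. c' k x \<noteq> 0" by (intro exI[of _ k]) (auto simp: c'_def)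
      qed (use j c'm in auto)
    next
      case False
      have "AE x in M. x \<in> Sj j \<longrightarrow> (\<forall>c. (\<forall>i. (\<Sum>k<d. c k * b j i k x) = 0) \<longrightarrow> (\<forall>k<d. c k = 0))" for j
      proof -
        have "(AE x in M. x \<in> Sj j \<longrightarrow> (\<forall>c. (\<forall>i. (\<Sum>k<d. c k * b j i k x) = 0) \<longrightarrow> (\<forall>k<d. c k = 0))) \<or> Good j"
          unfolding Good_def by (rule Suc.IH[OF Sjm bm])
        moreover have "\<not> Good j" using False by simp
        ultimately show ?thesis by (simp only: HOL.simp_thms)
      qed
      hence "AE x in M. \<forall>j\<in>UNIV. x \<in> Sj j \<longrightarrow> (\<forall>c. (\<forall>i. (\<Sum>k<d. c k * b j i k x) = 0) \<longrightarrow> (\<forall>k<d. c k = 0))"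
        by (subst AE_finite_all[OF finite]) (rule ballI)
      moreover have "AE x in M. x \<notin> Z" by (rule AE_not_in[OF Znull])
      ultimately have "AE x in M. x \<in> S \<longrightarrow> (\<forall>c. (\<forall>i. (\<Sum>k<Suc d. c k * a i k x) = 0) \<longrightarrow> (\<forall>k<Suc d. c k = 0))"
        using AE_space
      proof eventually_elim
        case (elim x)
        show ?case
        proof (intro impI allI)
          fix c k assume x: "x \<in> S" and z: "\<forall>i. (\<Sum>k<Suc d. c k * a i k x) = 0" and k: "k < Suc d"
          obtain j where j: "a j d x \<noteq> 0" using elim(2,3) x by (auto simp: Z_def)
          hence xj: "x \<in> Sj j" using x elim(3) by (simp add: Sj_def)
          have zi: "(\<Sum>k<d. c k * b j i k x) = 0" for i
            using elim_eq[OF j, of c i] z by simp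
          have small: "\<forall>k<d. c k = 0"
            by (rule elim(1)[THEN bspec, OF UNIV_I, THEN mp, OF xj, THEN spec, THEN mp]) (rule allI, rule zi)
          have "(\<Sum>k<d. c k * a j k x) = 0" using small by (intro sum.neutral) auto
          hence "c d * a j d x = 0" using z[rule_format, of j] by simp
          hence "c d = 0" using j by simp
          thus "c k = 0" using small k by (cases "k = d") auto
        qed
      qed
      thus ?thesis by (rule disjI1)
    qed
  qed
qed

lemma null_set_negligible:
  assumes "AE t in lebesgue. P (t::real)"
  shows "\<exists>N. negligible N \<and> (\<forall>t. t \<notin> N \<longrightarrow> P t)"
proof -
  obtain N where N: "{t \<in> space lebesgue. \<not> P t} \<subseteq> N" "emeasure lebesgue N = 0" "N \<in> sets lebesgue"
    using assms by (rule AE_E)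
  have "negligible N" using N by (simp add: negligible_iff_null_sets null_sets_def)
  thus ?thesis using N(1) by (intro exI[of _ N]) auto
qed

context potential
begin

lemma real_bump:
  fixes a b :: "complex ^ 'n"
  assumes "\<And>i. cnj (a $ i) = a $ i" "\<And>i. cnj (b $ i) = b $ i"
  shows "cnj (left_bump s a b t $ i) = left_bump s a b t $ i" "cnj (L_left_bump s a b t $ i) = L_left_bump s a b t $ i"
  using assms
  by (auto simp: left_bump_def L_left_bump_def Lbump_def bump_def bump''_def matrix_vector_mult_def cV_entry)

text \<open>Green's identity on \<open>[s - 1, s]\<close> between \<open>u\<close> and the left half bump: only the boundary term at \<open>s\<close> remains. The data are taken real so
  that the conjugation in the inner product has no effect.\<close>

lemma boundary_pairing:
  fixes a b :: "complex ^ 'n"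
  assumes f: "f \<in> L2" and f1: "f1 \<in> L2" and fu: "AE t in lebesgue. f t = u t"
    and u: "weak_derivatives u u' w" and f1w: "AE t in lebesgue. f1 t = - w t + cV t *v u t"
    and real: "\<And>i. cnj (a $ i) = a $ i" "\<And>i. cnj (b $ i) = b $ i"
  shows "ip f (L_left_bump s a b) - ip f1 (left_bump s a b) = bil a (u' s) - bil b (u s)"
proof -
  define p where "p t = (\<Sum>i\<in>UNIV. f t $ i * cnj (L_left_bump s a b t $ i)) - (\<Sum>i\<in>UNIV. f1 t $ i * cnj (left_bump s a b t $ i))" for t
  have ip: "integrable lebesgue p" unfolding p_def
    by (intro Bochner_Integration.integrable_diff ip_integrable f f1 halves_L2)
  have "ip f (L_left_bump s a b) - ip f1 (left_bump s a b) = (LINT t|lebesgue. p t)"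
    unfolding ip_def p_def by (rule Bochner_Integration.integral_diff[symmetric]; intro ip_integrable f f1 halves_L2)
  hence L: "(p has_integral (ip f (L_left_bump s a b) - ip f1 (left_bump s a b))) UNIV"
    using has_integral_integral_lebesgue[OF ip] by simp
  define G where "G t = bil (bump a b (t - s)) (w t) - bil (bump'' a b (t - s)) (u t)" for t
  have "(G has_integral (bil (bump a b (s - s)) (u' s) - bil (bump' a b (s - s)) (u s))
      - (bil (bump a b (s - 1 - s)) (u' (s - 1)) - bil (bump' a b (s - 1 - s)) (u (s - 1)))) {s - 1..s}"
    unfolding G_def by (rule Green_identity[OF _ u weak_derivatives_shift[OF weak_derivatives_bump]]) simp
  hence "(G has_integral (bil a (u' s) - bil b (u s))) {s - 1..s}"
    by (simp add: bump_def[of a b "-1"] bump'_def[of a b "-1"] bil_def)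
  hence H: "((\<lambda>t. if t \<in> {s - 1..s} then G t else 0) has_integral (bil a (u' s) - bil b (u s))) UNIV"
    by (simp only: has_integral_restrict_UNIV)
  have "AE t in lebesgue. f t = u t \<and> f1 t = - w t + cV t *v u t"
    using fu f1w by eventually_elim simp
  from null_set_negligible[OF this]
  obtain N where N': "negligible N \<and> (\<forall>t. t \<notin> N \<longrightarrow> f t = u t \<and> f1 t = - w t + cV t *v u t)"
    by (rule exE)
  note N = N'[THEN conjunct1] N'[THEN conjunct2, rule_format]
  have "(p has_integral (bil a (u' s) - bil b (u s))) UNIV"
  proof (rule has_integral_spike[OF _ _ H])
    show "negligible (N \<union> {s - 1, s})" using N(1) by simp
    fix t assume t: "t \<in> UNIV - (N \<union> {s - 1, s})"
    show "p t = (if t \<in> {s - 1..s} then G t else 0)"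
    proof (cases "t \<in> {s - 1..s}")
      case False
      hence "left_bump s a b t = 0" "L_left_bump s a b t = 0" by (auto simp: left_bump_def L_left_bump_def Lbump_def)
      thus ?thesis using False by (auto simp: p_def)
    next
      case True
      hence ts: "t < s" using t by auto
      have w: "w t = cV t *v u t - f1 t" using N(2)[of t] t by auto
      have l: "left_bump s a b t = bump a b (t - s)" "L_left_bump s a b t = Lbump s a b t" using ts True by (auto simp: left_bump_def L_left_bump_def)
      have r: "cnj (bump a b (t - s) $ i) = bump a b (t - s) $ i" "cnj (Lbump s a b t $ i) = Lbump s a b t $ i" for i
        using real_bump[OF real, of s t i] unfolding l by (simp_all only: HOL.simp_thms)
      have fu': "f t = u t" using N(2)[of t] t by auto
      have "p t = (\<Sum>i\<in>UNIV. u t $ i * Lbump s a b t $ i) - (\<Sum>i\<in>UNIV. f1 t $ i * bump a b (t - s) $ i)"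
        unfolding p_def l r fu' by (rule refl)
      also have "\<dots> = bil (Lbump s a b t) (u t) - bil (bump a b (t - s)) (f1 t)"
        by (simp add: bil_def mult.commute)
      also have "bil (Lbump s a b t) (u t) = bil (bump a b (t - s)) (cV t *v u t) - bil (bump'' a b (t - s)) (u t)"
        unfolding Lbump_def cV_bil[symmetric] by (simp add: bil_def sum_subtractf sum.distrib algebra_simps)
      finally show ?thesis using True by (simp add: G_def w) (simp add: bil_def sum_subtractf algebra_simps)
    qed
  qed
  with L show ?thesis by (rule has_integral_unique)
qed

end

context spectral
begin

text \<open>A measurable family of vectors \<open>c\<close> in the kernels of the boundary forms at \<open>0\<close> over a set \<open>S\<close> of positive measure is an
  element \<open>h\<close> of the spectral space; let \<open>f\<close> be its preimage. Because \<open>S\<close> is bounded, \<open>f\<close> is in the domain. The kernel condition propagates to all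
  \<open>s\<close>, and by \<open>boundary_pairing\<close> the values of \<open>f\<close> vanish at every \<open>s\<close>. Hence \<open>f = 0\<close>, against \<open>h \<noteq> 0\<close>.\<close>

lemma kernel_section_trivial:
  fixes c :: "nat \<Rightarrow> real \<Rightarrow> complex"
  assumes S: "S \<in> sets \<mu>" "emeasure \<mu> S > 0" "emeasure \<mu> S < \<infinity>" "\<And>x. x \<in> S \<Longrightarrow> \<bar>x\<bar> \<le> R" "\<And>x. x \<in> S \<Longrightarrow> n x = d"
    and c: "\<And>k. c k \<in> borel_measurable \<mu>"
    and ker: "\<And>x j. x \<in> S \<Longrightarrow> (\<Sum>k<d. c k x * basis_form 0 j x k) = 0" and nz: "\<And>x. x \<in> S \<Longrightarrow> \<exists>k<d. c k x \<noteq> 0"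
  shows False
proof -
  have [measurable]: "S \<in> sets \<mu>" "c k \<in> borel_measurable \<mu>" for k using S c by auto
  define q where "q x = (\<Sum>k<d. cmod (c k x))" for x
  have qm [measurable]: "q \<in> borel_measurable \<mu>" unfolding q_def by measurable
  have q: "q x > 0" if "x \<in> S" for x
  proof -
    obtain k where k: "k < d" "c k x \<noteq> 0" using nz[OF \<open>x \<in> S\<close>] by blast
    have "cmod (c k x) \<le> q x" unfolding q_def by (rule member_le_sum) (use k in auto)
    thus ?thesis using k by (auto intro: order.strict_trans2[rotated])
  qed
  have cq: "cmod (c k x) \<le> q x" if "k < d" for k x
    unfolding q_def by (rule member_le_sum) (use that in auto)
  \<comment> \<open>Normalized to be bounded, so that both \<open>h\<close> and \<open>x h\<close> are square integrable over \<open>S\<close>.\<close>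
  define h where "h x k = (if x \<in> S then cnj (c k x) / of_real (q x) else 0)" for x k
  have hm [measurable]: "(\<lambda>x. h x k) \<in> borel_measurable \<mu>" for k
  proof -
    have "(\<lambda>x. cnj (c k x)) \<in> borel_measurable \<mu>"
      by (rule measurable_compose[OF c]) (intro borel_measurable_continuous_onI continuous_intros)
    thus ?thesis unfolding h_def by measurable
  qed
  have h1: "cmod (h x k) \<le> 1" if "k < d" for x k
    using cq[OF that, of x] q[of x] by (auto simp: h_def norm_divide divide_le_eq_1)
  have Si: "integrable \<mu> (\<lambda>x. real d * (1 + R\<^sup>2) * indicator S x)"
    using S by (intro integrable_mult_right) (simp add: integrable_indicator_iff)
  have fib: "(\<lambda>x k. r x * h x k) \<in> fibre_L2 \<mu> n" if r: "r \<in> borel_measurable \<mu>" "\<And>x. x \<in> S \<Longrightarrow> (cmod (r x))\<^sup>2 \<le> 1 + R\<^sup>2"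
    for r :: "real \<Rightarrow> complex"
  proof -
    have m: "(\<lambda>x. r x * h x k) \<in> borel_measurable \<mu>" for k using r(1) by measurable
    have "integrable \<mu> (\<lambda>x. \<Sum>k<n x. (cmod (r x * h x k))\<^sup>2)"
    proof (rule Bochner_Integration.integrable_bound[OF Si])
      show "(\<lambda>x. \<Sum>k<n x. (cmod (r x * h x k))\<^sup>2) \<in> borel_measurable \<mu>"
      proof (rule sum_below_n_measurable)
        fix k
        have [measurable]: "(\<lambda>x. r x * h x k) \<in> borel_measurable \<mu>" by (rule m)
        show "(\<lambda>x. (cmod (r x * h x k))\<^sup>2) \<in> borel_measurable \<mu>" by measurable
      qed
      show "AE x in \<mu>. norm (\<Sum>k<n x. (cmod (r x * h x k))\<^sup>2) \<le> norm (real d * (1 + R\<^sup>2) * indicator S x)"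
      proof (rule AE_I2)
        fix x
        show "norm (\<Sum>k<n x. (cmod (r x * h x k))\<^sup>2) \<le> norm (real d * (1 + R\<^sup>2) * indicator S x)"
        proof (cases "x \<in> S")
          case True
          have "(cmod (r x * h x k))\<^sup>2 \<le> 1 + R\<^sup>2" if "k < d" for k
          proof -
            have "(cmod (r x))\<^sup>2 * (cmod (h x k))\<^sup>2 \<le> (1 + R\<^sup>2) * 1"
              using r(2)[OF True] h1[OF that, of x] by (intro mult_mono) (auto simp: power_le_one)
            thus ?thesis by (simp add: norm_mult power_mult_distrib)
          qed
          hence "(\<Sum>k<d. (cmod (r x * h x k))\<^sup>2) \<le> (\<Sum>k<d. 1 + R\<^sup>2)" by (intro sum_mono) simp
          thus ?thesis using True S(5)[OF True] by (simp add: sum_nonneg)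
        qed (simp add: h_def)
      qed
    qed
    thus ?thesis using m by (simp add: fibre_L2_def)
  qed
  have "(\<lambda>x k. 1 * h x k) \<in> fibre_L2 \<mu> n" by (rule fib) simp_all
  hence "(\<lambda>x k. h x k) \<in> fibre_L2 \<mu> n" by simp
  from U_surj[OF this] obtain f where f: "f \<in> L2" and Uf: "AE x in \<mu>. \<forall>k<n x. U f x k = h x k" by (rule bexE)
  have "(\<lambda>x k. of_real x * h x k) \<in> fibre_L2 \<mu> n"
  proof (rule fib)
    show "(\<lambda>x. complex_of_real x) \<in> borel_measurable \<mu>" by measurable
    fix x assume "x \<in> S"
    hence "\<bar>x\<bar>\<^sup>2 \<le> R\<^sup>2" using S(4) by (intro power_mono) auto
    thus "(cmod (complex_of_real x))\<^sup>2 \<le> 1 + R\<^sup>2" by simp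
  qed
  from U_surj[OF this] obtain f1 where f1: "f1 \<in> L2" and Uf1: "AE x in \<mu>. \<forall>k<n x. U f1 x k = of_real x * h x k"
    by (rule bexE)
  have "AE x in \<mu>. \<forall>k<n x. U f1 x k = of_real x * U f x k"
    using Uf Uf1 by eventually_elim simp
  hence "schroedinger V f f1" by (rule U_schroedinger[OF f f1, THEN iffD2])
  then obtain u w where uw: "AE t in lebesgue. f t = u t" "has_weak_second_derivative u w"
    "AE t in lebesgue. f1 t = - w t + complex_matrix (V t) *v u t"
    unfolding schroedinger_def by (elim conjE exE)
  from uw(2) obtain u' where wd: "weak_derivatives u u' w" unfolding has_weak_second_derivative_iff by (rule exE)
  have zero: "bil (basis_value j) (u' s) - bil (basis_slope j) (u s) = 0" for s and j :: "'n + 'n"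
  proof -
    have re: "cnj (basis_value j $ i) = basis_value j $ i" "cnj (basis_slope j $ i) = basis_slope j $ i" for i
      by (auto simp: basis_value_def basis_slope_def axis_def split: sum.splits)
    have "bil (basis_value j) (u' s) - bil (basis_slope j) (u s) = ip f (L_left_bump s (basis_value j) (basis_slope j)) - ip f1 (left_bump s (basis_value j) (basis_slope j))"
      by (rule boundary_pairing[OF f f1 uw(1) wd uw(3)[folded cV_def] re, symmetric])
    also have "\<dots> = uip f (L_left_bump s (basis_value j) (basis_slope j)) - uip f1 (left_bump s (basis_value j) (basis_slope j))"
      by (simp add: uip_eq_ip f f1 halves_L2)
    also have "\<dots> = (LINT x|\<mu>. (\<Sum>k<n x. U f x k * cnj (U (L_left_bump s (basis_value j) (basis_slope j)) x k)) - (\<Sum>k<n x. U f1 x k * cnj (U (left_bump s (basis_value j) (basis_slope j)) x k)))"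
      unfolding uip_def by (rule Bochner_Integration.integral_diff[symmetric]; intro uip_integrable f f1 halves_L2)
    also have "\<dots> = (LINT x|\<mu>. 0)"
    proof (rule integral_cong_AE)
      show "(\<lambda>x. (\<Sum>k<n x. U f x k * cnj (U (L_left_bump s (basis_value j) (basis_slope j)) x k)) - (\<Sum>k<n x. U f1 x k * cnj (U (left_bump s (basis_value j) (basis_slope j)) x k))) \<in> borel_measurable \<mu>"
        by (intro borel_measurable_diff borel_measurable_integrable[OF uip_integrable] f f1 halves_L2)
      obtain M where M: "AE x in \<mu>. \<forall>k<n x. basis_form s j x k = (\<Sum>i\<in>UNIV. M x i * basis_form 0 i x k)"
        using basis_form_span[of s j 0] by (rule exE)
      show "AE x in \<mu>. (\<Sum>k<n x. U f x k * cnj (U (L_left_bump s (basis_value j) (basis_slope j)) x k)) - (\<Sum>k<n x. U f1 x k * cnj (U (left_bump s (basis_value j) (basis_slope j)) x k)) = 0"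
        using M Uf Uf1
      proof eventually_elim
        case (elim x)
        have "(\<Sum>k<n x. U f x k * cnj (U (L_left_bump s (basis_value j) (basis_slope j)) x k)) - (\<Sum>k<n x. U f1 x k * cnj (U (left_bump s (basis_value j) (basis_slope j)) x k))
           = (\<Sum>k<n x. h x k * cnj (basis_form s j x k))"
          unfolding sum_subtractf[symmetric] using elim(2,3)
          by (intro sum.cong refl) (simp add: basis_form_def boundary_form_def algebra_simps)
        also have "\<dots> = 0"
        proof (cases "x \<in> S")
          case True
          have "(\<Sum>k<d. c k x * basis_form s j x k) = (\<Sum>k<d. \<Sum>i\<in>UNIV. M x i * (c k x * basis_form 0 i x k))"
            using elim(1) S(5)[OF True] by (intro sum.cong refl) (simp add: sum_distrib_left mult_ac)
          also have "\<dots> = (\<Sum>i\<in>UNIV. M x i * (\<Sum>k<d. c k x * basis_form 0 i x k))"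
            by (subst sum.swap) (simp add: sum_distrib_left)
          also have "\<dots> = 0" using ker[OF True] by simp
          finally have z: "(\<Sum>k<d. c k x * basis_form s j x k) = 0" .
          have "(\<Sum>k<n x. h x k * cnj (basis_form s j x k)) = cnj (\<Sum>k<d. c k x * basis_form s j x k) / of_real (q x)"
            using True S(5)[OF True] by (simp add: h_def sum_divide_distrib)
          thus ?thesis using z by simp
        qed (simp add: h_def)
        finally show ?case .
      qed
    qed simp
    finally show ?thesis by simp
  qed
  have "u s = 0" for s
  proof (rule vec_eq_iff[THEN iffD2], rule allI)
    fix i
    show "u s $ i = 0 $ i"
      using zero[of "Inr i" s] by (simp add: basis_value_def basis_slope_def bil_def axis_def if_distrib[of "\<lambda>x. x * _"] cong: if_cong)
  qed
  hence "AE t in lebesgue. f t = 0" using uw(1) by simp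
  hence "AE t in lebesgue. (norm (f t))\<^sup>2 = 0" by eventually_elim simp
  hence "sqnorm f = 0" unfolding sqnorm_def by (rule integral_eq_zero_AE)
  hence "(LINT x|\<mu>. (\<Sum>k<n x. (cmod (U f x k))\<^sup>2)) = 0" using U_norm[OF f] by simp
  hence "AE x in \<mu>. (\<Sum>k<n x. (cmod (U f x k))\<^sup>2) = 0"
    by (intro integral_nonneg_eq_0_iff_AE[OF U_integrable[OF f], THEN iffD1] AE_I2 sum_nonneg) auto
  with Uf have "AE x in \<mu>. x \<notin> S"
  proof eventually_elim
    case (elim x)
    show ?case
    proof
      assume x: "x \<in> S"
      obtain k where k: "k < d" "c k x \<noteq> 0" using nz[OF x] by blast
      have "\<forall>k\<in>{..<n x}. (cmod (U f x k))\<^sup>2 = 0" using elim(2) by (subst (asm) sum_nonneg_eq_0_iff) auto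
      hence "h x k = 0" using elim(1) k S(5)[OF x] by auto
      thus False using x k q[OF x] by (simp add: h_def)
    qed
  qed
  hence "emeasure \<mu> S = 0"
    by (subst (asm) AE_iff_measurable[OF S(1)]) auto
  with S(2) show False by simp
qed

end

context spectral
begin

text \<open>The integrals of the squares over bounded energies are bounded uniformly in \<open>m\<close>. Weighted with \<open>1 / (m + 1)\<^sup>2\<close> they are summable, so
  for almost every \<open>x\<close> the weighted series converges and its terms are bounded.\<close>

lemma basis_form_grows_linearly:
  "AE x in \<mu>. \<bar>x\<bar> \<le> R \<longrightarrow> (\<exists>C. \<forall>m::nat. \<forall>j. \<forall>k<n x. cmod (basis_form (- real m) j x k) \<le> C * (real m + 1))"
proof -
  define I where "I = integral {0..1} (\<lambda>t. (1 + v t)\<^sup>2)"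
  have per: "integral {- real m - 1..- real m} (\<lambda>t. (1 + v t)\<^sup>2) = I" for m
  proof -
    have "((\<lambda>t. (1 + v t)\<^sup>2) has_integral I) {of_int (- int m - 1)..of_int (- int m - 1) + 1}"
      unfolding I_def
      by (rule periodic_integrable(1)[OF _ integrable_integral[OF one_plus_v_square_integrable]])
         (simp add: v_def cV_def V_periodic)
    thus ?thesis by (intro integral_unique) simp
  qed
  have I0: "I \<ge> 0" unfolding I_def
    by (rule Henstock_Kurzweil_Integration.integral_nonneg[OF one_plus_v_square_integrable]) simp
  have e: "norm (basis_value j :: complex ^ 'n) \<le> 1" "norm (basis_slope j :: complex ^ 'n) \<le> 1" for j
    by (cases j; simp add: basis_value_def basis_slope_def norm_axis_1)+
  define G where "G = 2 * (64\<^sup>2 * I) + 2 * R\<^sup>2 * (64\<^sup>2 * I)"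
  have G0: "G \<ge> 0" using I0 by (simp add: G_def)
  have sq: "sqnorm (L_left_bump (- real m) (basis_value j) (basis_slope j)) \<le> 64\<^sup>2 * I" "sqnorm (left_bump (- real m) (basis_value j) (basis_slope j)) \<le> 64\<^sup>2 * I" for m j
  proof -
    have "norm (basis_value j :: complex ^ 'n) + norm (basis_slope j :: complex ^ 'n) \<le> 2" using e[of j] by simp
    hence c: "(32 * (norm (basis_value j :: complex ^ 'n) + norm (basis_slope j :: complex ^ 'n)))\<^sup>2 \<le> 64\<^sup>2" by (intro power_mono) auto
    show "sqnorm (L_left_bump (- real m) (basis_value j) (basis_slope j)) \<le> 64\<^sup>2 * I" "sqnorm (left_bump (- real m) (basis_value j) (basis_slope j)) \<le> 64\<^sup>2 * I"
      using halves_L2(5,6)[of "- real m" "basis_value j" "basis_slope j"] mult_right_mono[OF c I0] unfolding per by linarith+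
  qed
  define F where "F m j x = indicator {-R..R} x * (\<Sum>k<n x. (cmod (basis_form (- real m) j x k))\<^sup>2)" for m :: nat and j x
  have Fi: "integrable \<mu> (F m j)" for m j
    unfolding F_def basis_form_def by (rule boundary_form_L2(1))
  have FG: "(LINT x|\<mu>. F m j x) \<le> G" for m j
  proof -
    have "(LINT x|\<mu>. F m j x) \<le> 2 * sqnorm (L_left_bump (- real m) (basis_value j) (basis_slope j)) + 2 * R\<^sup>2 * sqnorm (left_bump (- real m) (basis_value j) (basis_slope j))"
      unfolding F_def basis_form_def by (rule boundary_form_L2(2))
    also have "\<dots> \<le> G" unfolding G_def by (intro add_mono mult_left_mono sq) auto
    finally show ?thesis .
  qed
  have F0: "F m j x \<ge> 0" for m j x by (simp add: F_def sum_nonneg)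
  define w where "w m = inverse ((real (Suc m))^2)" for m
  have w0: "w m \<ge> 0" for m by (simp add: w_def)
  have sw: "summable (\<lambda>m. G * w m)"
    unfolding w_def using inverse_power_summable[of 2, where 'a = real]
    by (intro summable_mult) (subst summable_Suc_iff, simp)
  have one: "AE x in \<mu>. (\<Sum>m. ennreal (w m * F m j x)) \<noteq> \<infinity>" for j
  proof (rule nn_integral_PInf_AE)
    have m: "(\<lambda>x. ennreal (w m * F m j x)) \<in> borel_measurable \<mu>" for m
      using borel_measurable_integrable[OF Fi[of m j]] by measurable
    thus "(\<lambda>x. \<Sum>m. ennreal (w m * F m j x)) \<in> borel_measurable \<mu>" by measurable
    have "(\<integral>\<^sup>+x. (\<Sum>m. ennreal (w m * F m j x)) \<partial>\<mu>) = (\<Sum>m. \<integral>\<^sup>+x. ennreal (w m * F m j x) \<partial>\<mu>)"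
      by (rule nn_integral_suminf[OF m])
    also have "\<dots> \<le> (\<Sum>m. ennreal (G * w m))"
    proof (rule suminf_le)
      fix m
      have "(\<integral>\<^sup>+x. ennreal (w m * F m j x) \<partial>\<mu>) = ennreal (LINT x|\<mu>. w m * F m j x)"
        by (rule nn_integral_eq_integral) (use Fi F0 w0 in auto)
      also have "\<dots> \<le> ennreal (G * w m)"
        using mult_right_mono[OF FG w0, of m j m] by (intro ennreal_leI) (simp add: mult.commute)
      finally show "(\<integral>\<^sup>+x. ennreal (w m * F m j x) \<partial>\<mu>) \<le> ennreal (G * w m)" .
    qed simp_all
    also have "\<dots> = ennreal (\<Sum>m. G * w m)"
      by (rule suminf_ennreal2) (use sw G0 w0 in auto)
    finally show "(\<integral>\<^sup>+x. (\<Sum>m. ennreal (w m * F m j x)) \<partial>\<mu>) \<noteq> \<infinity>"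
      using ennreal_less_top by (auto simp: top_unique)
  qed
  have "AE x in \<mu>. \<forall>j\<in>UNIV. (\<Sum>m. ennreal (w m * F m j x)) \<noteq> \<infinity>"
    by (subst AE_finite_all[OF finite]) (use one in blast)
  thus ?thesis
  proof eventually_elim
    case (elim x)
    show ?case
    proof
      assume x: "\<bar>x\<bar> \<le> R"
      have fin: "(\<Sum>m. ennreal (w m * F m j x)) \<noteq> \<infinity>" for j using elim by simp
      define s where "s j = enn2real (\<Sum>m. ennreal (w m * F m j x))" for j
      have Fs: "F m j x \<le> s j * (real m + 1)\<^sup>2" for m j
      proof -
        have "ennreal (w m * F m j x) \<le> (\<Sum>m. ennreal (w m * F m j x))"
          using sum_le_suminf[of "\<lambda>m. ennreal (w m * F m j x)" "{m}"] by simp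
        also have "\<dots> = ennreal (s j)" using fin[of j] by (simp add: s_def less_top)
        finally have "w m * F m j x \<le> s j" by (subst (asm) ennreal_le_iff) (simp_all add: s_def)
        hence le: "(w m * F m j x) * (real m + 1)\<^sup>2 \<le> s j * (real m + 1)\<^sup>2" by (rule mult_right_mono) simp
        have "F m j x = (w m * F m j x) * (real m + 1)\<^sup>2" by (simp add: w_def add.commute)
        also note le
        finally show ?thesis .
      qed
      define C where "C = (\<Sum>j\<in>UNIV. sqrt (s j))"
      have s0: "s j \<ge> 0" for j by (simp add: s_def)
      show "\<exists>C. \<forall>m::nat. \<forall>j. \<forall>k<n x. cmod (basis_form (- real m) j x k) \<le> C * (real m + 1)"
      proof (intro exI[of _ C] allI impI)
        fix m :: nat and j k assume k: "k < n x"
        have "(cmod (basis_form (- real m) j x k))\<^sup>2 \<le> (\<Sum>k<n x. (cmod (basis_form (- real m) j x k))\<^sup>2)"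
          by (rule member_le_sum) (use k in auto)
        also have "\<dots> = F m j x" using x by (auto simp: F_def indicator_def)
        also have "\<dots> \<le> (sqrt (s j) * (real m + 1))\<^sup>2" using Fs[of m j] s0 by (simp add: power_mult_distrib)
        finally have "cmod (basis_form (- real m) j x k) \<le> sqrt (s j) * (real m + 1)"
          by (rule power2_le_imp_le) (simp add: s0)
        also have "sqrt (s j) \<le> C" unfolding C_def by (rule member_le_sum) (use s0 in auto)
        finally show "cmod (basis_form (- real m) j x k) \<le> C * (real m + 1)" by (simp add: mult_right_mono)
      qed
    qed
  qed
qed

lemma finite_positive_subset:
  assumes "B \<in> sets \<mu>" "emeasure \<mu> B > 0"
  shows "\<exists>B0. B0 \<in> sets \<mu> \<and> B0 \<subseteq> B \<and> emeasure \<mu> B0 > 0 \<and> emeasure \<mu> B0 < \<infinity>"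
proof (cases "emeasure \<mu> B = \<infinity>")
  case True
  from sigma_finite_measure.approx_PInf_emeasure_with_finite[OF sigma_finite_mu assms(1) True, of 0]
  obtain Z where "Z \<in> sets \<mu>" "Z \<subseteq> B" "emeasure \<mu> Z < \<infinity>" "emeasure \<mu> Z > ennreal 0" .
  thus ?thesis by auto
next
  case False
  thus ?thesis using assms by (intro exI[of _ B]) (auto simp: less_top)
qed

text \<open>Where the multiplicity is \<open>2 N\<close>, the boundary forms at \<open>0\<close> are a square matrix, injective for almost every \<open>x\<close>, whose images under
  the powers of the transfer matrix grow at most linearly.\<close>

lemma transfer_trace_bound:
  assumes pos: "emeasure \<mu> {x. \<bar>x - l\<bar> < e \<and> n x = 2 * CARD('n)} > 0"
  shows "\<exists>x. \<bar>x - l\<bar> < e \<and> cmod (\<Sum>j\<in>UNIV. transfer (of_real x) j j) \<le> 2 * real CARD('n)"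
proof -
  define d where "d = 2 * CARD('n)"
  have dc: "d = CARD('n + 'n)" by (simp add: d_def)
  define B where "B = {x. \<bar>x - l\<bar> < e \<and> n x = d}"
  have "{x \<in> space \<mu>. \<bar>x - l\<bar> < e \<and> n x = d} \<in> sets \<mu>" by measurable
  hence "B \<in> sets \<mu>" by (simp add: B_def)
  moreover have "emeasure \<mu> B > 0" using pos by (simp add: B_def d_def)
  ultimately have "\<exists>B0. B0 \<in> sets \<mu> \<and> B0 \<subseteq> B \<and> emeasure \<mu> B0 > 0 \<and> emeasure \<mu> B0 < \<infinity>"
    by (rule finite_positive_subset)
  then obtain B0 where B0: "B0 \<in> sets \<mu>" "B0 \<subseteq> B" "emeasure \<mu> B0 > 0" "emeasure \<mu> B0 < \<infinity>" by (elim exE conjE)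
  define R where "R = \<bar>l\<bar> + e"
  have R: "\<bar>x\<bar> \<le> R" "n x = d" if "x \<in> B" for x using that by (auto simp: B_def R_def)
  have inj: "AE x in \<mu>. x \<in> B0 \<longrightarrow> (\<forall>c. (\<forall>i. (\<Sum>k<d. c k * basis_form 0 i x k) = 0) \<longrightarrow> (\<forall>k<d. c k = 0))"
    using measurable_kernel_selection[of B0 \<mu> "\<lambda>i k x. basis_form 0 i x k" d, OF B0(1) basis_form_measurable]
  proof
    assume "\<exists>S' c. S' \<in> sets \<mu> \<and> S' \<subseteq> B0 \<and> emeasure \<mu> S' > 0 \<and> (\<forall>k. c k \<in> borel_measurable \<mu>) \<and>
       (\<forall>x\<in>S'. (\<forall>i. (\<Sum>k<d. c k x * basis_form 0 i x k) = 0) \<and> (\<exists>k<d. c k x \<noteq> 0))"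
    then obtain S' c where S': "S' \<in> sets \<mu>" "S' \<subseteq> B0" "emeasure \<mu> S' > 0" "\<forall>k. c k \<in> borel_measurable \<mu>"
       "\<forall>x\<in>S'. (\<forall>i. (\<Sum>k<d. c k x * basis_form 0 i x k) = 0) \<and> (\<exists>k<d. c k x \<noteq> 0)" by (elim exE conjE)
    have "emeasure \<mu> S' \<le> emeasure \<mu> B0" by (rule emeasure_mono[OF S'(2) B0(1)])
    hence fin: "emeasure \<mu> S' < \<infinity>" using B0(4) by (rule le_less_trans)
    have sub: "S' \<subseteq> B" using S'(2) B0(2) by blast
    have False
      by (rule kernel_section_trivial[OF S'(1,3) fin R(1) R(2), of c]) (use S'(4,5) sub in auto)
    thus ?thesis ..
  qed
  have rec: "AE x in \<mu>. \<forall>m::nat. \<forall>j\<in>UNIV. \<forall>k<n x. basis_form (- real m - 1) j x k = (\<Sum>i\<in>UNIV. transfer (of_real x) j i * basis_form (- real m) i x k)"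
    unfolding AE_all_countable
  proof (intro allI)
    fix m :: nat
    show "AE x in \<mu>. \<forall>j\<in>UNIV. \<forall>k<n x. basis_form (- real m - 1) j x k = (\<Sum>i\<in>UNIV. transfer (of_real x) j i * basis_form (- real m) i x k)"
      by (subst AE_finite_all[OF finite]) (use basis_form_transfer[of "- int m"] in simp)
  qed
  have notnull: "\<not> (AE x in \<mu>. x \<notin> B0)"
    using B0(1,3) by (subst AE_iff_measurable[OF B0(1)]) auto
  have bd: "AE x in \<mu>. x \<in> B0 \<longrightarrow> cmod (\<Sum>j\<in>UNIV. transfer (of_real x) j j) \<le> real d"
    using inj rec basis_form_grows_linearly[of R]
  proof eventually_elim
    case (elim x)
    show ?case
    proof
      assume x0: "x \<in> B0"
      hence x: "\<bar>x\<bar> \<le> R" "n x = d" using R B0(2) by auto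
      obtain C where C: "\<forall>m::nat. \<forall>j. \<forall>k<n x. cmod (basis_form (- real m) j x k) \<le> C * (real m + 1)"
        using elim(3) x(1) by blast
      have "cmod (\<Sum>j\<in>UNIV. transfer (of_real x) j j) \<le> real CARD('n + 'n)"
      proof (rule norm_trace_le_if_powers_grow_linearly[where P = "\<lambda>j i. transfer (of_real x) j i" and A = "\<lambda>m j k. basis_form (- real m) j x k" and C = C])
        fix m j k assume "k < CARD('n + 'n)"
        hence k: "k < n x" using x(2) dc by simp
        have m: "- real (Suc m) = - real m - 1" by simp
        show "basis_form (- real (Suc m)) j x k = (\<Sum>i\<in>UNIV. transfer (of_real x) j i * basis_form (- real m) i x k)"
          unfolding m by (rule elim(2)[rule_format, OF UNIV_I k])
        show "cmod (basis_form (- real m) j x k) \<le> C * (real m + 1)" using C k by simp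
      next
        fix c :: "nat \<Rightarrow> complex"
        assume "\<forall>j. (\<Sum>k<CARD('n + 'n). c k * basis_form (- real 0) j x k) = 0"
        hence "\<forall>i. (\<Sum>k<d. c k * basis_form 0 i x k) = 0" by (simp only: dc of_nat_0 minus_zero HOL.simp_thms)
        from elim(1)[THEN mp, OF x0, THEN spec, THEN mp, OF this]
        show "\<forall>k<CARD('n + 'n). c k = 0" by (simp only: dc)
      qed
      thus "cmod (\<Sum>j\<in>UNIV. transfer (of_real x) j j) \<le> real d" unfolding dc .
    qed
  qed
  have "\<exists>x\<in>B0. cmod (\<Sum>j\<in>UNIV. transfer (of_real x) j j) \<le> real d"
  proof (rule ccontr)
    assume "\<not> (\<exists>x\<in>B0. cmod (\<Sum>j\<in>UNIV. transfer (of_real x) j j) \<le> real d)"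
    hence "AE x in \<mu>. x \<notin> B0" using bd by (elim eventually_mono) auto
    with notnull show False ..
  qed
  then obtain x where "x \<in> B0" "cmod (\<Sum>j\<in>UNIV. transfer (of_real x) j j) \<le> real d" by (rule bexE)
  thus ?thesis using B0(2) by (intro exI[of _ x]) (auto simp: B_def d_def)
qed

end

section \<open>A nonnegative spectrum makes the operator nonnegative\<close>

context spectral
begin

text \<open>If \<open>\<mu>\<close> charged every neighbourhood of \<open>z\<close>, a function \<open>f\<close> spectrally concentrated within \<open>e\<close> of \<open>z\<close> would have
  \<open>\<parallel>(L - z) f\<parallel> \<le> e \<parallel>f\<parallel>\<close>, which contradicts the bound on the resolvent for small \<open>e\<close>.\<close>

lemma real_resolvent_point_null:
  fixes z :: real
  assumes z: "of_real z \<in> resolvent_set V"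
  shows "\<exists>e>0. emeasure \<mu> {x. \<bar>x - z\<bar> < e} = 0"
proof -
  obtain C where C: "\<forall>f\<in>L2. \<exists>y. schroedinger V y (\<lambda>t. f t + of_real z *s y t) \<and> sqnorm y \<le> C * sqnorm f \<and>
           (\<forall>y'. schroedinger V y' (\<lambda>t. f t + of_real z *s y' t) \<longrightarrow> (AE t in lebesgue. y' t = y t))"
    using z by (auto simp: resolvent_set_def)
  \<comment> \<open>Small enough for \<open>|C| e\<^sup>2 \<le> 1/4\<close>.\<close>
  define e where "e = 1 / (2 * (\<bar>C\<bar> + 1))"
  have e: "e > 0" by (simp add: e_def)
  have e1: "e \<le> 1/2" by (simp add: e_def field_simps)
  have Ce: "\<bar>C\<bar> * e\<^sup>2 \<le> 1/4"
  proof -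
    have "\<bar>C\<bar> * e\<^sup>2 = (\<bar>C\<bar> * e) * e" by (simp add: power2_eq_square)
    also have "\<dots> \<le> (1/2) * (1/2)" using e e1 by (intro mult_mono) (auto simp: e_def field_simps)
    finally show ?thesis by simp
  qed
  define B where "B = {x. \<bar>x - z\<bar> < e}"
  have "{x \<in> space \<mu>. \<bar>x - z\<bar> < e} \<in> sets \<mu>" by measurable
  hence Bm: "B \<in> sets \<mu>" by (simp add: B_def)
  have "emeasure \<mu> B = 0"
  proof (rule ccontr)
    assume "emeasure \<mu> B \<noteq> 0"
    hence "emeasure \<mu> B > 0" by (simp add: zero_less_iff_neq_zero)
    from finite_positive_subset[OF Bm this]
    obtain B0 where B0: "B0 \<in> sets \<mu>" "B0 \<subseteq> B" "emeasure \<mu> B0 > 0" "emeasure \<mu> B0 < \<infinity>" by (elim exE conjE)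
    note [measurable] = B0(1)
    define h where "h x k = (if x \<in> B0 then if k = 0 then 1 else 0 else 0 :: complex)" for x :: real and k :: nat
    have fib: "(\<lambda>x k. r x * h x k) \<in> fibre_L2 \<mu> n"
      if r: "r \<in> borel_measurable \<mu>" "\<And>x. x \<in> B0 \<Longrightarrow> cmod (r x) \<le> K" for r K
    proof -
      have "(\<lambda>x. h x k) \<in> borel_measurable \<mu>" for k unfolding h_def by measurable
      hence m: "(\<lambda>x. r x * h x k) \<in> borel_measurable \<mu>" for k by (rule borel_measurable_times[OF r(1)])
      have "integrable \<mu> (\<lambda>x. \<Sum>k<n x. (cmod (r x * h x k))\<^sup>2)"
      proof (rule Bochner_Integration.integrable_bound)
        show "integrable \<mu> (\<lambda>x. K\<^sup>2 * indicator B0 x)"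
          using B0 by (intro integrable_mult_right) (simp add: integrable_indicator_iff)
        show "(\<lambda>x. \<Sum>k<n x. (cmod (r x * h x k))\<^sup>2) \<in> borel_measurable \<mu>"
          by (intro sum_below_n_measurable borel_measurable_power measurable_compose[OF m borel_measurable_norm]) 
        show "AE x in \<mu>. norm (\<Sum>k<n x. (cmod (r x * h x k))\<^sup>2) \<le> norm (K\<^sup>2 * indicator B0 x)"
        proof (rule AE_I2)
          fix x
          show "norm (\<Sum>k<n x. (cmod (r x * h x k))\<^sup>2) \<le> norm (K\<^sup>2 * indicator B0 x)"
          proof (cases "x \<in> B0")
            case True
            have "(\<Sum>k<n x. (cmod (r x * h x k))\<^sup>2) = (\<Sum>k<n x. if k = 0 then (cmod (r x))\<^sup>2 else 0)"
              using True by (intro sum.cong) (auto simp: h_def)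
            also have "\<dots> \<le> (cmod (r x))\<^sup>2" by simp
            also have "\<dots> \<le> K\<^sup>2" using r(2)[OF True] by (intro power_mono) auto
            finally show ?thesis using True by (simp add: sum_nonneg)
          qed (simp add: h_def)
        qed
      qed
      thus ?thesis using m by (simp add: fibre_L2_def)
    qed
    have "(\<lambda>x k. 1 * h x k) \<in> fibre_L2 \<mu> n" by (rule fib[where K = 1]) simp_all
    hence "(\<lambda>x k. h x k) \<in> fibre_L2 \<mu> n" by simp
    from U_surj[OF this] obtain f where f: "f \<in> L2" and Uf: "AE x in \<mu>. \<forall>k<n x. U f x k = h x k" by (rule bexE)
    have "(\<lambda>x k. of_real x * h x k) \<in> fibre_L2 \<mu> n"
    proof (rule fib[where K = "\<bar>z\<bar> + e"])
      show "(\<lambda>x. complex_of_real x) \<in> borel_measurable \<mu>" by measurable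
      fix x assume "x \<in> B0"
      hence "\<bar>x - z\<bar> < e" using B0(2) by (auto simp: B_def)
      thus "cmod (complex_of_real x) \<le> \<bar>z\<bar> + e" by simp
    qed
    from U_surj[OF this] obtain f1 where f1: "f1 \<in> L2" and Uf1: "AE x in \<mu>. \<forall>k<n x. U f1 x k = of_real x * h x k"
      by (rule bexE)
    have "AE x in \<mu>. \<forall>k<n x. U f1 x k = of_real x * U f x k"
      using Uf Uf1 by eventually_elim simp
    hence S: "schroedinger V f f1" by (rule U_schroedinger[OF f f1, THEN iffD2])
    define g where "g t = 1 *s f1 t + (- of_real z) *s f t" for t
    have g: "g \<in> L2" unfolding g_def[abs_def] by (rule L2_lincomb[OF f1 f])
    have gf: "(\<lambda>t. g t + of_real z *s f t) = f1" by (simp add: g_def fun_eq_iff vec_eq_iff algebra_simps)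
    from C[rule_format, OF g] obtain y where y: "sqnorm y \<le> C * sqnorm g"
      "\<forall>y'. schroedinger V y' (\<lambda>t. g t + of_real z *s y' t) \<longrightarrow> (AE t in lebesgue. y' t = y t)"
      "schroedinger V y (\<lambda>t. g t + of_real z *s y t)"
      by (elim exE conjE)
    have fy: "AE t in lebesgue. f t = y t" using y(2)[rule_format, of f] S unfolding gf by simp
    have yL: "y \<in> L2" by (rule y(3)[unfolded schroedinger_def, THEN conjunct1])
    have "sqnorm f = sqnorm y" unfolding sqnorm_def
    proof (rule integral_cong_AE)
      show "(\<lambda>t. (norm (f t))\<^sup>2) \<in> borel_measurable lebesgue" "(\<lambda>t. (norm (y t))\<^sup>2) \<in> borel_measurable lebesgue"
        using f yL by (auto simp: L2_def)
      show "AE t in lebesgue. (norm (f t))\<^sup>2 = (norm (y t))\<^sup>2" using fy by eventually_elim simp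
    qed
    hence fg: "sqnorm f \<le> C * sqnorm g" using y(1) by simp
    have g0: "sqnorm g \<ge> 0" "sqnorm f \<ge> 0" by (simp_all add: sqnorm_def)
    have Ug: "AE x in \<mu>. \<forall>k<n x. U g x k = 1 * U f1 x k + (- of_real z) * U f x k"
      unfolding g_def[abs_def] by (rule U_lincomb[OF f1 f])
    have "sqnorm g \<le> (LINT x|\<mu>. e\<^sup>2 * (\<Sum>k<n x. (cmod (U f x k))\<^sup>2))"
      unfolding U_norm[OF g, symmetric]
    proof (rule integral_mono_AE[OF U_integrable[OF g] integrable_mult_right[OF U_integrable[OF f]]])
      show "AE x in \<mu>. (\<Sum>k<n x. (cmod (U g x k))\<^sup>2) \<le> e\<^sup>2 * (\<Sum>k<n x. (cmod (U f x k))\<^sup>2)"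
        using Ug Uf Uf1
      proof eventually_elim
        case (elim x)
        have "(cmod (U g x k))\<^sup>2 \<le> e\<^sup>2 * (cmod (U f x k))\<^sup>2" if k: "k < n x" for k
        proof (cases "x \<in> B0")
          case True
          hence "\<bar>x - z\<bar> < e" using B0(2) by (auto simp: B_def)
          hence le: "\<bar>x - z\<bar>\<^sup>2 \<le> e\<^sup>2" by (intro power_mono) auto
          have "U g x k = of_real (x - z) * U f x k" using elim k by (simp add: algebra_simps)
          hence sq: "(cmod (U g x k))\<^sup>2 = \<bar>x - z\<bar>\<^sup>2 * (cmod (U f x k))\<^sup>2"
            by (simp only: norm_mult norm_of_real power_mult_distrib)
          show ?thesis unfolding sq by (rule mult_right_mono[OF le]) simp
        next
          case False
          thus ?thesis using elim k by (simp add: h_def)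
        qed
        thus ?case unfolding sum_distrib_left by (intro sum_mono) simp
      qed
    qed
    hence "sqnorm g \<le> e\<^sup>2 * sqnorm f" by (simp add: U_norm[OF f])
    hence "\<bar>C\<bar> * sqnorm g \<le> (\<bar>C\<bar> * e\<^sup>2) * sqnorm f" by (simp add: mult.assoc mult_left_mono)
    also have "\<dots> \<le> 1/4 * sqnorm f" by (rule mult_right_mono[OF Ce g0(2)])
    also have "C * sqnorm g \<le> \<bar>C\<bar> * sqnorm g" by (intro mult_right_mono g0) simp
    ultimately have "sqnorm f = 0" using fg g0 by linarith
    hence "(LINT x|\<mu>. (\<Sum>k<n x. (cmod (U f x k))\<^sup>2)) = 0" using U_norm[OF f] by simp
    hence "AE x in \<mu>. (\<Sum>k<n x. (cmod (U f x k))\<^sup>2) = 0"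
      by (intro integral_nonneg_eq_0_iff_AE[OF U_integrable[OF f], THEN iffD1] AE_I2 sum_nonneg) auto
    moreover have "AE x in \<mu>. n x \<ge> 1" using rep by (simp add: spectral_representation_def)
    ultimately have "AE x in \<mu>. x \<notin> B0" using Uf
    proof eventually_elim
      case (elim x)
      have "\<forall>k\<in>{..<n x}. (cmod (U f x k))\<^sup>2 = 0" using elim(1) by (subst (asm) sum_nonneg_eq_0_iff) auto
      hence "h x 0 = 0" using elim(2,3) by auto
      thus ?case by (auto simp: h_def)
    qed
    hence "emeasure \<mu> B0 = 0" by (subst (asm) AE_iff_measurable[OF B0(1)]) auto
    with B0(3) show False by simp
  qed
  thus ?thesis using e by (auto simp: B_def)
qed

text \<open>The negative half-line is covered by null neighbourhoods, of which countably many suffice.\<close>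

lemma spectral_measure_nonneg:
  assumes "\<forall>z\<in>spectrum V. 0 \<le> Re z"
  shows "AE x in \<mu>. 0 \<le> x"
proof -
  have ex: "\<exists>e>0. emeasure \<mu> {x. \<bar>x - z\<bar> < e} = 0" if "z < 0" for z
  proof (rule real_resolvent_point_null, rule ccontr)
    assume "of_real z \<notin> resolvent_set V"
    hence "of_real z \<in> spectrum V" by (simp add: spectrum_def)
    with assms have "0 \<le> Re (of_real z)" by (rule bspec)
    thus False using that by simp
  qed
  define r where "r z = (SOME e. e > 0 \<and> emeasure \<mu> {x. \<bar>x - z\<bar> < e} = 0)" for z
  have r': "r z > 0 \<and> emeasure \<mu> {x. \<bar>x - z\<bar> < r z} = 0" if z: "z < 0" for z
    unfolding r_def[of z] using ex[OF z] by (rule someI_ex)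
  note r = r'[THEN conjunct1] r'[THEN conjunct2]
  define \<F> where "\<F> = (\<lambda>z. ball z (r z)) ` {..<0}"
  have "open S" if "S \<in> \<F>" for S using that by (auto simp: \<F>_def)
  from Lindelof[of \<F>, OF this] obtain \<F>' where F': "\<F>' \<subseteq> \<F>" "countable \<F>'" "\<Union>\<F>' = \<Union>\<F>" .
  have "(\<Union>S\<in>\<F>'. S) \<in> null_sets \<mu>"
  proof (rule null_sets_UN'[OF F'(2)])
    fix S assume "S \<in> \<F>'"
    hence "S \<in> \<F>" using F'(1) by (rule rev_subsetD)
    then obtain z where z: "z < 0" "S = ball z (r z)" unfolding \<F>_def by (elim imageE) simp
    have "S = {x. \<bar>x - z\<bar> < r z}" using z by (auto simp: dist_real_def)
    moreover have "S \<in> sets \<mu>" using z by simp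
    ultimately show "S \<in> null_sets \<mu>" using r(2)[OF z(1)] by (simp add: null_sets_def)
  qed
  hence "\<Union>\<F>' \<in> null_sets \<mu>" by simp
  hence "AE x in \<mu>. x \<notin> \<Union>\<F>'" by (rule AE_not_in)
  thus ?thesis
  proof eventually_elim
    case (elim x)
    show ?case
    proof (rule ccontr)
      assume "\<not> 0 \<le> x"
      hence "ball x (r x) \<in> \<F>" "x \<in> ball x (r x)" using r(1)[of x] by (auto simp: \<F>_def)
      hence "x \<in> \<Union>\<F>" by (rule UnionI)
      thus False using elim by (simp only: F'(3) HOL.simp_thms)
    qed
  qed
qed

text \<open>In the spectral representation \<open>\<langle>L f, f\<rangle>\<close> is the integral of \<open>x |U f|\<^sup>2\<close>.\<close>

lemma schroedinger_nonneg:
  assumes pos: "AE x in \<mu>. 0 \<le> x" and S: "schroedinger V f g"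
  shows "0 \<le> Re (ip g f)"
proof -
  note fg = S[unfolded schroedinger_def]
  have f: "f \<in> L2" and g: "g \<in> L2" by (rule fg[THEN conjunct1], rule fg[THEN conjunct2, THEN conjunct1])
  have E: "AE x in \<mu>. \<forall>k<n x. U g x k = of_real x * U f x k"
    by (rule U_schroedinger[OF f g, THEN iffD1, OF S])
  have "Re (ip g f) = (LINT x|\<mu>. Re (\<Sum>k<n x. U g x k * cnj (U f x k)))"
    unfolding uip_eq_ip[OF g f, symmetric] uip_def by (rule integral_Re[OF uip_integrable[OF g f], symmetric])
  also have "\<dots> \<ge> 0"
  proof (rule integral_nonneg_AE)
    show "AE x in \<mu>. 0 \<le> Re (\<Sum>k<n x. U g x k * cnj (U f x k))"
      using pos E
    proof eventually_elim
      case (elim x)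
      have nn: "Re (U g x k * cnj (U f x k)) \<ge> 0" if "k < n x" for k
      proof -
        have "U g x k * cnj (U f x k) = of_real x * (U f x k * cnj (U f x k))"
          using elim(2) that by (simp add: mult.assoc)
        hence "U g x k * cnj (U f x k) = of_real (x * (cmod (U f x k))\<^sup>2)"
          by (simp only: of_real_mult complex_norm_square)
        thus ?thesis using elim(1) by simp
      qed
      show ?case unfolding Re_sum by (rule sum_nonneg, rule nn, simp)
    qed
  qed
  finally show ?thesis .
qed

end

section \<open>Periodic trial functions\<close>

lemma primitive_exists:
  fixes w :: "real \<Rightarrow> 'a::euclidean_space"
  assumes w: "\<And>a b. w integrable_on {a..b}"
  shows "\<exists>P. \<forall>a b. a \<le> b \<longrightarrow> (w has_integral (P b - P a)) {a..b}"
proof -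
  define P where "P t = (if 0 \<le> t then integral {0..t} w else - integral {t..0} w)" for t
  have "integral {a..b} w = P b - P a" if ab: "a \<le> b" for a b
  proof -
    consider "0 \<le> a" | "a < 0" "0 \<le> b" | "b < 0" by linarith
    thus ?thesis
    proof cases
      case 1
      have "integral {0..a} w + integral {a..b} w = integral {0..b} w"
        by (rule Henstock_Kurzweil_Integration.integral_combine[OF 1 ab w])
      thus ?thesis using 1 ab by (simp add: P_def algebra_simps)
    next
      case 2
      have "integral {a..0} w + integral {0..b} w = integral {a..b} w"
        by (rule Henstock_Kurzweil_Integration.integral_combine[OF _ 2(2) w]) (use 2 in simp)
      thus ?thesis using 2 by (simp add: P_def algebra_simps)
    next
      case 3
      have "integral {a..b} w + integral {b..0} w = integral {a..0} w"
        by (rule Henstock_Kurzweil_Integration.integral_combine[OF ab _ w]) (use 3 in simp)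
      thus ?thesis using 3 ab by (simp add: P_def algebra_simps)
    qed
  qed
  hence "(w has_integral (P b - P a)) {a..b}" if "a \<le> b" for a b
    using integrable_integral[OF w[of a b]] that by simp
  thus ?thesis by (intro exI[of _ P] allI impI)
qed

text \<open>The increment of a primitive over one period is constant, and it is the mean of \<open>w\<close> over a period.\<close>

lemma periodic_primitive:
  fixes w :: "real \<Rightarrow> 'a::euclidean_space"
  assumes per: "\<And>t. w (t + 1) = w t" and mean: "(w has_integral 0) {0..1}"
  shows "\<exists>P. (\<forall>a b. a \<le> b \<longrightarrow> (w has_integral (P b - P a)) {a..b}) \<and> (\<forall>t. P (t + 1) = P t)"
proof -
  obtain P where "\<forall>a b. a \<le> b \<longrightarrow> (w has_integral (P b - P a)) {a..b}"
    using primitive_exists[OF periodic_integrable(2)[OF per mean]] by (rule exE)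
  hence P: "(w has_integral (P b - P a)) {a..b}" if "a \<le> b" for a b using that by simp
  have D: "P (b + 1) - P b = P (a + 1) - P a" if ab: "a \<le> b" for a b
  proof -
    have "(w has_integral (P (b + 1) - P (a + 1))) {a - (-1)..b - (-1)}" using P[of "a + 1" "b + 1"] ab by simp
    hence "((\<lambda>t. w (t - (-1))) has_integral (P (b + 1) - P (a + 1))) {a..b}" by (rule has_integral_shift_interval)
    hence "(w has_integral (P (b + 1) - P (a + 1))) {a..b}" by (simp add: per)
    hence "P (b + 1) - P (a + 1) = P b - P a" using P[OF ab] by (rule has_integral_unique)
    thus ?thesis by (simp add: algebra_simps)
  qed
  have "(w has_integral (P 1 - P 0)) {0..1}" by (rule P) simp
  hence "P 1 - P 0 = 0" using mean by (rule has_integral_unique)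
  hence "P (t + 1) = P t" for t using D[of 0 t] D[of t 0] by (cases "0 \<le> t") auto
  thus ?thesis using P by (intro exI[of _ P]) auto
qed

lemma primitive_continuous:
  fixes w :: "real \<Rightarrow> 'a::euclidean_space"
  assumes P: "\<And>a b. a \<le> b \<Longrightarrow> (w has_integral (P b - P a)) {a..b}"
  shows "continuous_on UNIV P"
  unfolding continuous_on_eq_continuous_at[OF open_UNIV]
proof
  fix t :: real
  have "continuous_on {t - 1..t + 1} (\<lambda>x. P (t - 1) + integral {t - 1..x} w)"
    by (intro continuous_intros indefinite_integral_continuous_1 has_integral_integrable[OF P]) simp
  moreover have "P (t - 1) + integral {t - 1..x} w = P x" if "x \<in> {t - 1..t + 1}" for x
    using integral_unique[OF P[of "t - 1" x]] that by simp
  ultimately have "continuous_on {t - 1..t + 1} P" by (rule continuous_on_eq)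
  thus "isCont P t" by (rule continuous_on_interior) simp
qed

lemma primitive_of_continuous:
  fixes P :: "real \<Rightarrow> 'a::euclidean_space"
  assumes g: "\<And>a b. a \<le> b \<Longrightarrow> (P has_integral (g b - g a)) {a..b}" and P: "continuous_on UNIV P"
  shows "(g has_vector_derivative P t) (at t)"
proof -
  have "((\<lambda>x. integral {t - 1..x} P) has_vector_derivative P t) (at t within {t - 1..t + 1})"
    by (rule integral_has_vector_derivative[OF continuous_on_subset[OF P]]) auto
  hence "((\<lambda>x. integral {t - 1..x} P) has_vector_derivative P t) (at t)"
    by (simp add: at_within_Icc_at)
  hence "((\<lambda>x. g (t - 1) + integral {t - 1..x} P) has_vector_derivative 0 + P t) (at t)"
    by (intro has_vector_derivative_add has_vector_derivative_const)
  hence "((\<lambda>x. g (t - 1) + integral {t - 1..x} P) has_vector_derivative P t) (at t)" by simp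
  thus ?thesis
  proof (rule has_vector_derivative_transform_within_open)
    show "open {t - 1<..<t + 1}" "t \<in> {t - 1<..<t + 1}" by auto
    show "g (t - 1) + integral {t - 1..x} P = g x" if "x \<in> {t - 1<..<t + 1}" for x
      using integral_unique[OF g[of "t - 1" x]] that by simp
  qed
qed

text \<open>A direct consequence of the Henstock lemma: Riemann sums of \<open>norm w\<close> are sums of
  \<open>norm (content k * w x - \<integral>\<^sub>k w)\<close>, as the integrals over the cells vanish.\<close>

lemma norm_integral_zero_if_interval_integrals_zero:
  fixes w :: "real \<Rightarrow> 'a::euclidean_space"
  assumes z: "\<And>c d. a \<le> c \<Longrightarrow> c \<le> d \<Longrightarrow> d \<le> b \<Longrightarrow> (w has_integral 0) {c..d}" and ab: "a \<le> b"
  shows "((\<lambda>t. norm (w t)) has_integral 0) {a..b}"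
  unfolding cbox_interval[symmetric] has_integral
proof (intro allI impI)
  fix e :: real assume e: "e > 0"
  have "w integrable_on cbox a b" using z[of a b] ab by (auto intro: has_integral_integrable)
  from Henstock_lemma[OF this e] obtain \<gamma> where \<gamma>: "gauge \<gamma>"
    "\<And>p. \<lbrakk>p tagged_partial_division_of (cbox a b); \<gamma> fine p\<rbrakk> \<Longrightarrow> sum (\<lambda>(x,k). norm(measure lborel k *\<^sub>R w x - integral k w)) p < e" by blast
  show "\<exists>\<gamma>. gauge \<gamma> \<and> (\<forall>D. D tagged_division_of cbox a b \<and> \<gamma> fine D \<longrightarrow>
      norm ((\<Sum>(x, k)\<in>D. measure lborel k *\<^sub>R norm (w x)) - 0) < e)"
  proof (intro exI[of _ \<gamma>] conjI allI impI \<gamma>(1))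
    fix D assume D: "D tagged_division_of cbox a b \<and> \<gamma> fine D"
    hence part: "D tagged_partial_division_of cbox a b" by (simp add: tagged_division_of_def)
    have "(\<Sum>(x, k)\<in>D. measure lborel k *\<^sub>R norm (w x)) = (\<Sum>(x, k)\<in>D. norm (measure lborel k *\<^sub>R w x - integral k w))"
    proof (rule sum.cong[OF refl], clarify)
      fix x k assume xk: "(x, k) \<in> D"
      obtain c d where k: "k = cbox c d" using tagged_partial_division_ofD(4)[OF part xk] by blast
      have sub: "k \<subseteq> cbox a b" "x \<in> k" using tagged_partial_division_ofD(2,3)[OF part xk] by auto
      hence "c \<le> d" unfolding k by auto
      hence "integral k w = 0" using z[of c d] sub unfolding k by (auto intro: integral_unique)
      thus "measure lborel k *\<^sub>R norm (w x) = norm (measure lborel k *\<^sub>R w x - integral k w)" by simp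
    qed
    also have "\<dots> < e" using D by (intro \<gamma>(2)[OF part]) simp
    finally have "(\<Sum>(x, k)\<in>D. measure lborel k *\<^sub>R norm (w x)) < e" .
    moreover have "0 \<le> (\<Sum>(x, k)\<in>D. measure lborel k *\<^sub>R norm (w x))" by (intro sum_nonneg) auto
    ultimately show "norm ((\<Sum>(x, k)\<in>D. measure lborel k *\<^sub>R norm (w x)) - 0) < e" by simp
  qed
qed

lemma AE_zero_if_norm_integral_zero:
  fixes w :: "real \<Rightarrow> 'a::euclidean_space"
  assumes "((\<lambda>t. norm (w t)) has_integral 0) {a..b}"
  shows "AE t in lebesgue. t \<in> {a..b} \<longrightarrow> w t = 0"
proof -
  have ai: "(\<lambda>t. norm (w t)) absolutely_integrable_on {a..b}"
    by (rule nonnegative_absolutely_integrable_1[OF has_integral_integrable[OF assms]]) simp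
  have "(LINT t|lebesgue. indicator {a..b} t *\<^sub>R norm (w t)) = 0"
    using set_lebesgue_integral_eq_integral(2)[OF ai] integral_unique[OF assms]
    by (simp add: set_lebesgue_integral_def)
  hence "AE t in lebesgue. indicator {a..b} t *\<^sub>R norm (w t) = 0"
    by (intro integral_nonneg_eq_0_iff_AE[OF ai[unfolded set_integrable_def], THEN iffD1] AE_I2) auto
  thus ?thesis by eventually_elim (auto simp: indicator_def)
qed

text \<open>The test functions are real; \<open>cx\<close> embeds them into the complex space on which the operator acts.\<close>

definition cx :: "real ^ 'n \<Rightarrow> complex ^ 'n::finite" where "cx x = (\<chi> i. of_real (x $ i))"

lemma cx_nth [simp]: "cx x $ i = of_real (x $ i)" by (simp add: cx_def)

lemma cx_linear: "cx (x + y) = cx x + cx y" "cx (c *\<^sub>R x) = of_real c *s cx x" "cx (- x) = - cx x" "cx (x - y) = cx x - cx y"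
  by (simp_all add: vec_eq_iff)

lemma bounded_linear_cx: "bounded_linear cx"
  by (intro linear_conv_bounded_linear[THEN iffD1] linearI) (simp_all add: vec_eq_iff scaleR_conv_of_real[where 'a = complex])

lemma norm_cx: "norm (cx x) = norm x"
  by (simp add: norm_vec_def)

lemma bil_cx: "bil (cx x) (cx y) = of_real (x \<bullet> y)"
  by (simp add: bil_def inner_vec_def)

context potential
begin

lemma cV_cx: "cV t *v cx x = cx (V t *v x)"
  by (simp add: vec_eq_iff matrix_vector_mult_def cV_entry)

text \<open>Cut \<open>p\<close> off to \<open>[0, m]\<close> and continue it by half bumps. The ends contribute the same amount to \<open>\<langle>L u, u\<rangle>\<close>
  for every \<open>m\<close>, each period contributes \<open>X\<close>, and the total is nonnegative; let \<open>m\<close> tend to infinity.\<close>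

lemma periodic_test_function:
  fixes p p' p'' :: "real \<Rightarrow> real ^ 'n"
  assumes pos: "\<And>f g. schroedinger V f g \<Longrightarrow> 0 \<le> Re (ip g f)"
    and wd: "weak_derivatives (\<lambda>t. cx (p t)) (\<lambda>t. cx (p' t)) (\<lambda>t. cx (p'' t))"
    and per: "\<And>t. p (t + 1) = p t" "\<And>t. p' (t + 1) = p' t" "\<And>t. p'' (t + 1) = p'' t"
    and bd: "\<And>t. norm (p'' t) \<le> K * (1 + v t)"
  shows "\<exists>X\<ge>0. ((\<lambda>t. (- p'' t + V t *v p t) \<bullet> p t) has_integral X) {0..1}"
proof -
  define a b where "a = cx (p 0)" and "b = cx (p' 0)"
  have pm: "p (real m) = p 0" "p' (real m) = p' 0" for m
    using periodic_int_shift[of p 0 "int m", OF per(1)] periodic_int_shift[of p' 0 "int m", OF per(2)] by simp_all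
  define u where "u m t = (if t < 0 then bump a b t else if t < real m then cx (p t) else bump a b (t - real m))" for m t
  define u' where "u' m t = (if t < 0 then bump' a b t else if t < real m then cx (p' t) else bump' a b (t - real m))" for m t
  define z where "z m t = (if t < 0 then bump'' a b t else if t < real m then cx (p'' t) else bump'' a b (t - real m))" for m t
  have wdm: "weak_derivatives (u m) (u' m) (z m)" for m
    unfolding u_def[abs_def] u'_def[abs_def] z_def[abs_def]
    by (intro weak_derivatives_glue weak_derivatives_bump weak_derivatives_shift[OF weak_derivatives_bump] wd)
       (auto simp: a_def b_def pm)
  define f where "f m t = - z m t + cV t *v u m t" for m t
  have S: "schroedinger V (u m) (f m)" "f m \<in> L2" "u m \<in> L2" for m
  proof -
    obtain B where B: "\<And>t. t \<in> {0..real m} \<Longrightarrow> norm (cx (p t)) \<le> B"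
      using compact_imp_bounded[OF compact_continuous_image[OF weak_derivatives_continuous(1)[OF wd, of "{0..real m}"] compact_Icc]]
      unfolding bounded_iff by blast
    define C where "C = 32 * (norm a + norm b) + \<bar>K\<bar> + \<bar>B\<bar>"
    have n0: "0 \<le> 32 * (norm a + norm b)" by simp
    have C: "32 * (norm a + norm b) \<le> C" "K \<le> C" "B \<le> C" "0 \<le> C" unfolding C_def using n0 by linarith+
    have uC: "norm (u m t) \<le> C" for t
      using order_trans[OF norm_bump_le_32[of a b t] C(1)] order_trans[OF norm_bump_le_32[of a b "t - real m"] C(1)]
        order_trans[OF B[of t] C(3)] by (auto simp: u_def)
    have zC: "norm (z m t) \<le> C * (1 + v t)" for t
    proof -
      have 1: "norm (bump'' a b s) \<le> C * (1 + v t)" for s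
      proof -
        have "norm (bump'' a b s) \<le> 32 * (norm a + norm b)" by (rule norm_bump''_le)
        also have "\<dots> \<le> C * 1" using C(1) by simp
        also have "\<dots> \<le> C * (1 + v t)" using C(4) by (intro mult_left_mono) auto
        finally show ?thesis .
      qed
      have "norm (cx (p'' t)) \<le> K * (1 + v t)" using bd[of t] by (simp add: norm_cx)
      also have "\<dots> \<le> C * (1 + v t)" using C(2) by (intro mult_right_mono) auto
      finally show ?thesis using 1 by (auto simp: z_def)
    qed
    have fC: "norm (f m t) \<le> (2 * C) * (1 + v t)" for t
    proof -
      have "norm (f m t) \<le> norm (z m t) + v t * norm (u m t)"
        unfolding f_def using norm_triangle_ineq[of "- z m t" "cV t *v u m t"] norm_matrix_le[of t "u m t"] by simp
      also have "\<dots> \<le> C * (1 + v t) + v t * C" by (intro add_mono zC mult_left_mono uC) simp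
      also have "\<dots> \<le> (2 * C) * (1 + v t)" using C(4) by (simp add: algebra_simps)
      finally show ?thesis .
    qed
    have supp: "u m t = 0" "z m t = 0" if "t \<notin> {-1..real m + 1}" for t
      using that by (auto simp: u_def z_def)
    show "schroedinger V (u m) (f m)" "f m \<in> L2" "u m \<in> L2"
      by (rule schroedinger_compact_support[OF wdm supp _ fC]; simp add: f_def)+
  qed
  define q where "q m t = (\<Sum>i\<in>UNIV. f m t $ i * cnj (u m t $ i))" for m t
  have qi: "(q m has_integral ip (f m) (u m)) UNIV" for m
    using has_integral_integral_lebesgue[OF ip_integrable[OF S(2,3), of m m]] by (simp add: ip_def q_def[abs_def])
  have qI: "q m integrable_on {c..d}" for m c d
    by (rule integrable_on_subinterval[OF has_integral_integrable[OF qi]]) simp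
  define qc where "qc t = complex_of_real ((- p'' t + V t *v p t) \<bullet> p t)" for t
  have mid: "q m t = qc t" if "0 \<le> t" "t < real m" for m t
  proof -
    have "f m t = cx (- p'' t + V t *v p t)" using that by (simp add: f_def z_def u_def cV_cx cx_linear)
    moreover have "u m t = cx (p t)" using that by (simp add: u_def)
    ultimately show ?thesis by (simp add: q_def qc_def inner_vec_def)
  qed
  have left: "q m t = q 0 t" if "t < 0" for m t using that by (simp add: q_def f_def z_def u_def)
  have right: "q m t = q 0 (t - real m)" if "real m \<le> t" for m t
  proof -
    have "cV t = cV (t - real m)" using cV_periodic[of "t - real m" "int m"] by simp
    thus ?thesis using that by (simp add: q_def f_def z_def u_def)
  qed
  define I1 I2 where "I1 = integral {-1..0} (q 0)" and "I2 = integral {0..1} (q 0)"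
  define Xc where "Xc = integral {0..1} (q 1)"
  have c01: "(qc has_integral Xc) {0..1}"
    by (rule has_integral_spike_finite[of "{1}" _ _ "q 1"]) (auto simp: Xc_def mid intro: integrable_integral qI)
  have qper: "qc (t + 1) = qc t" for t by (simp add: qc_def per V_periodic)
  have cm: "(qc has_integral (of_nat m * Xc)) {0..real m}" for m
  proof (induction m)
    case 0
    show ?case using has_integral_refl(2)[of qc "0::real"] by simp
  next
    case (Suc m)
    have "(qc has_integral (of_nat m * Xc + Xc)) {0..real (Suc m)}"
    proof (rule has_integral_combine[OF _ _ Suc])
      show "(qc has_integral Xc) {real m..real (Suc m)}"
        using periodic_integrable(1)[OF qper c01, of "int m"] by (simp add: add.commute)
    qed auto
    thus ?case by (simp add: algebra_simps)
  qed
  have ipm: "ip (f m) (u m) = I1 + of_nat m * Xc + I2" for m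
  proof -
    have 1: "(q m has_integral I1) {-1..0}"
    proof (rule has_integral_spike_finite)
      show "(q 0 has_integral I1) {-1..0}" unfolding I1_def by (rule integrable_integral[OF qI])
      show "q m t = q 0 t" if "t \<in> {-1..0} - {0}" for t by (rule left) (use that in auto)
    qed simp
    have 2: "(q m has_integral (of_nat m * Xc)) {0..real m}"
    proof (rule has_integral_spike_finite[OF _ _ cm])
      show "q m t = qc t" if "t \<in> {0..real m} - {real m}" for t by (rule mid) (use that in auto)
    qed simp
    have "(q 0 has_integral I2) {real m - real m..(real m + 1) - real m}" by (simp add: I2_def integrable_integral qI)
    hence "((\<lambda>t. q 0 (t - real m)) has_integral I2) {real m..real m + 1}" by (rule has_integral_shift_interval)
    hence 3: "(q m has_integral I2) {real m..real m + 1}"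
      by (rule has_integral_eq[rotated]) (rule right[symmetric], simp)
    have "(q m has_integral (I1 + of_nat m * Xc + I2)) {-1..real m + 1}"
      by (rule has_integral_combine[OF _ _ has_integral_combine[OF _ _ 1 2] 3]) auto
    hence "(q m has_integral (I1 + of_nat m * Xc + I2)) UNIV"
      by (rule has_integral_on_superset) (auto simp: q_def u_def)
    with qi show ?thesis by (rule has_integral_unique)
  qed
  have nn: "- (real m * Re Xc) \<le> Re I1 + Re I2" for m
  proof -
    have "0 \<le> Re I1 + real m * Re Xc + Re I2" using pos[OF S(1)[of m]] by (simp add: ipm)
    thus ?thesis by linarith
  qed
  have "0 \<le> Re Xc"
  proof (rule ccontr)
    assume neg: "\<not> 0 \<le> Re Xc"
    obtain m where m: "(Re I1 + Re I2) / (- Re Xc) < real m" using reals_Archimedean2 by blast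
    have "- Re Xc > 0" using neg by simp
    from m[unfolded pos_divide_less_eq[OF this]] have "Re I1 + Re I2 < - (real m * Re Xc)" by (simp only: mult_minus_right)
    thus False using nn[of m] by linarith
  qed
  moreover have "((\<lambda>t. (- p'' t + V t *v p t) \<bullet> p t) has_integral Re Xc) {0..1}"
    using has_integral_linear[OF c01 bounded_linear_Re] by (simp add: o_def qc_def)
  ultimately show ?thesis by (intro exI[of _ "Re Xc"] conjI)
qed

lemma V_entry_integrable: "(\<lambda>t. V t $ i $ j) integrable_on {a..b}"
proof -
  have "(\<lambda>t. cV t $ i $ j) integrable_on {a..b}"
    by (rule set_lebesgue_integral_eq_integral(1)[OF absolutely_integrable_entry[OF locally_integrableD[OF locally_integrable_cV]]])
  from integrable_linear[OF this bounded_linear_Re] show ?thesis by (simp add: o_def cV_entry)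
qed

text \<open>Constant functions then minimize the nonnegative quadratic form on periodic functions, so its first variation vanishes there. Test this
  with the periodic solution \<open>g\<close> of \<open>g'' = V e\<close>, which exists since \<open>V e\<close> has mean zero: the variation is \<open>2 \<integral> g \<bullet> V e = - 2 \<integral> |g'|\<^sup>2\<close>.
  Thus \<open>g' = 0\<close> and \<open>V e = 0\<close>.\<close>

lemma V_vanishes_if_mean_zero:
  assumes pos: "\<And>f g. schroedinger V f g \<Longrightarrow> 0 \<le> Re (ip g f)"
    and mean: "\<And>i j. ((\<lambda>t. V t $ i $ j) has_integral 0) {0..1}"
  shows "AE t in lebesgue. V t = 0"
proof -
  have column: "AE t in lebesgue. V t *v axis j 1 = 0" for j
  proof -
    define e :: "real ^ 'n" where "e = axis j 1"
    define w where "w t = V t *v e" for t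
    have we: "w t $ i = V t $ i $ j" for t i
      by (simp add: w_def e_def matrix_vector_mult_def axis_def if_distrib[of "\<lambda>x. _ * x"] cong: if_cong)
    have wper: "w (t + 1) = w t" for t by (simp add: w_def V_periodic)
    have w0: "(w has_integral 0) {0..1}"
      unfolding has_integral_componentwise_iff[of w] 
      by (auto simp: Basis_vec_def inner_axis we mean)
    obtain W0 where "(\<forall>a b. a \<le> b \<longrightarrow> (w has_integral (W0 b - W0 a)) {a..b}) \<and> (\<forall>t. W0 (t + 1) = W0 t)"
      using periodic_primitive[OF wper w0] by (rule exE)
    hence W0: "(w has_integral (W0 b - W0 a)) {a..b}" "W0 (t + 1) = W0 t" if "a \<le> b" for a b t using that by simp_all
    have cW0: "continuous_on UNIV W0" by (rule primitive_continuous[OF W0(1)])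
    define W where "W t = W0 t - integral {0..1} W0" for t
    have W: "(w has_integral (W b - W a)) {a..b}" if "a \<le> b" for a b using W0(1)[OF that] by (simp add: W_def)
    have Wper: "W (t + 1) = W t" for t using W0(2)[of 0 0 t] by (simp add: W_def)
    have cW: "continuous_on UNIV W" unfolding W_def by (intro continuous_intros cW0)
    have "(W0 has_integral integral {0..1} W0) {0..1}"
      by (intro integrable_integral integrable_continuous_interval continuous_on_subset[OF cW0]) simp
    from has_integral_diff[OF this has_integral_const_real[of "integral {0..1} W0" 0 1]]
    have Wi: "(W has_integral 0) {0..1}" by (simp add: W_def[abs_def])
    obtain g where "(\<forall>a b. a \<le> b \<longrightarrow> (W has_integral (g b - g a)) {a..b}) \<and> (\<forall>t. g (t + 1) = g t)"
      using periodic_primitive[where w = W, OF Wper Wi] by (rule exE)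
    hence g: "(W has_integral (g b - g a)) {a..b}" "g (t + 1) = g t" if "a \<le> b" for a b t using that by simp_all
    have gper: "g (t + 1) = g t" for t by (rule g(2)[of 0 0]) simp
    have dg: "(g has_vector_derivative W t) (at t)" for t by (rule primitive_of_continuous[OF g(1) cW])
    have wai: "(\<lambda>t. cx (w t)) absolutely_integrable_on {a..b}" for a b
      unfolding w_def cV_cx[symmetric]
      by (rule absolutely_integrable_matrix_vector[OF locally_integrableD[OF locally_integrable_cV] continuous_on_const])
    have gwd: "weak_derivatives (\<lambda>t. cx (g t)) (\<lambda>t. cx (W t)) (\<lambda>t. cx (w t))"
      unfolding weak_derivatives_def
    proof (intro conjI allI impI wai)
      show "((\<lambda>t. cx (g t)) has_vector_derivative cx (W t)) (at t)" for t
        by (rule bounded_linear.has_vector_derivative[OF bounded_linear_cx dg])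
      fix a b :: real assume ab: "a \<le> b"
      show "((\<lambda>t. cx (w t)) has_integral (cx (W b) - cx (W a))) {a..b}"
        using has_integral_linear[OF W[OF ab] bounded_linear_cx] by (simp add: o_def cx_linear)
    qed
    have wv: "norm (w t) \<le> v t" for t
    proof -
      have "norm (w t) = norm (cV t *v cx e)" by (simp add: w_def cV_cx norm_cx)
      also have "\<dots> \<le> v t * norm (cx e)" by (rule norm_matrix_le)
      finally show ?thesis by (simp add: norm_cx e_def norm_axis_1)
    qed
    have sym: "(V t *v x) \<bullet> y = x \<bullet> (V t *v y)" for t x y
      using cV_bil[of t "cx x" "cx y"] unfolding cV_cx bil_cx of_real_eq_iff .
    have ex: "\<exists>X\<ge>0. ((\<lambda>t. (- (s *\<^sub>R w t) + V t *v (e + s *\<^sub>R g t)) \<bullet> (e + s *\<^sub>R g t)) has_integral X) {0..1}" for s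
    proof (rule periodic_test_function[OF pos, where p' = "\<lambda>t. s *\<^sub>R W t" and K = "\<bar>s\<bar>"])
      have c: "weak_derivatives (\<lambda>t. cx e) (\<lambda>t. 0) (\<lambda>t. 0)" by (rule weak_derivatives_C2) auto
      show "weak_derivatives (\<lambda>t. cx (e + s *\<^sub>R g t)) (\<lambda>t. cx (s *\<^sub>R W t)) (\<lambda>t. cx (s *\<^sub>R w t))"
        using weak_derivatives_add[OF c weak_derivatives_scale[OF gwd, of "of_real s"]] by (simp add: cx_linear)
      show "norm (s *\<^sub>R w t) \<le> \<bar>s\<bar> * (1 + v t)" for t
        unfolding norm_scaleR real_norm_def using wv[of t] by (intro mult_left_mono) auto
    qed (simp_all add: gper Wper wper)
    have we0: "((\<lambda>t. w t \<bullet> e) has_integral 0) {0..1}"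
      using mean[of j j] by (simp add: e_def inner_axis we)
    define al where "al t = g t \<bullet> w t" for t
    define be where "be t = - al t + (V t *v g t) \<bullet> g t" for t
    have expand: "(- (s *\<^sub>R w t) + V t *v (e + s *\<^sub>R g t)) \<bullet> (e + s *\<^sub>R g t)
        = (1 - s) * (w t \<bullet> e) + (2 * s) * al t + s\<^sup>2 * be t" for s t
    proof -
      have "(V t *v g t) \<bullet> e = g t \<bullet> w t" by (simp add: sym w_def)
      moreover have "V t *v (e + s *\<^sub>R g t) = w t + s *\<^sub>R (V t *v g t)"
        by (simp add: w_def matrix_vector_right_distrib matrix_vector_mult_scaleR)
      ultimately show ?thesis
        by (simp add: be_def al_def inner_add_left inner_add_right inner_commute[of "w t" "g t"] algebra_simps power2_eq_square)
    qed
    note bp = weak_derivatives_by_parts[OF zero_le_one gwd gwd]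
    have alc: "(\<lambda>t. complex_of_real (al t)) integrable_on {0..1}"
      using set_lebesgue_integral_eq_integral(1)[OF bp(1)] by (simp add: bil_cx al_def)
    define Aa where "Aa = integral {0..1} al"
    have ali: "(al has_integral Aa) {0..1}"
      using integrable_integral[OF integrable_linear[OF alc bounded_linear_Re]] by (simp add: o_def Aa_def)
    obtain X1 where X1: "((\<lambda>t. (1 - 1) * (w t \<bullet> e) + (2 * 1) * al t + 1\<^sup>2 * be t) has_integral X1) {0..1}"
      using ex[of 1] unfolding expand by blast
    define Bb where "Bb = X1 - 2 * Aa"
    have bei: "(be has_integral Bb) {0..1}"
      using has_integral_diff[OF X1 has_integral_mult_right[OF ali, of 2]] by (simp add: Bb_def)
    \<comment> \<open>The values of the form at \<open>e + s g\<close>; there is no constant term because \<open>V\<close> has mean zero.\<close>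
    have quad: "0 \<le> 2 * s * Aa + s\<^sup>2 * Bb" for s
    proof -
      obtain X where X: "X \<ge> 0 \<and> ((\<lambda>t. (1 - s) * (w t \<bullet> e) + (2 * s) * al t + s\<^sup>2 * be t) has_integral X) {0..1}"
        using ex[of s] unfolding expand by (rule exE)
      have "((\<lambda>t. (1 - s) * (w t \<bullet> e) + (2 * s) * al t + s\<^sup>2 * be t) has_integral ((1 - s) * 0 + (2 * s) * Aa + s\<^sup>2 * Bb)) {0..1}"
        by (intro has_integral_add has_integral_mult_right we0 ali bei)
      from has_integral_unique[OF X[THEN conjunct2] this] show ?thesis using X[THEN conjunct1] by simp
    qed
    have "Aa = 0"
    proof (rule ccontr)
      assume ne: "Aa \<noteq> 0"
      \<comment> \<open>At \<open>s = - Aa / c\<close> the linear term outweighs the quadratic one.\<close>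
      define c where "c = \<bar>Bb\<bar> + 1"
      have c: "c > 0" "Bb \<le> c" by (auto simp: c_def)
      have "0 \<le> 2 * (- Aa / c) * Aa + (- Aa / c)\<^sup>2 * Bb" by (rule quad)
      also have "\<dots> \<le> 2 * (- Aa / c) * Aa + (- Aa / c)\<^sup>2 * c" by (intro add_left_mono mult_left_mono c) simp
      also have "\<dots> = - (Aa\<^sup>2 / c)" using c(1) by (simp add: power2_eq_square field_simps)
      finally have "Aa\<^sup>2 / c \<le> 0" by simp
      moreover have "Aa\<^sup>2 / c > 0" using ne c(1) by simp
      ultimately show False by linarith
    qed
    have "integral {0..1} (\<lambda>t. bil (cx (g t)) (cx (w t))) = - integral {0..1} (\<lambda>t. bil (cx (W t)) (cx (W t)))"
      unfolding bp(2) using gper[of 0] Wper[of 0] by simp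
    moreover have "integral {0..1} (\<lambda>t. bil (cx (g t)) (cx (w t))) = of_real Aa"
      using has_integral_linear[OF ali bounded_linear_of_real[where 'a = complex]]
      by (intro integral_unique) (simp add: o_def bil_cx al_def)
    moreover have WW: "(\<lambda>t. W t \<bullet> W t) integrable_on {0..1}"
      by (intro integrable_continuous_interval continuous_intros continuous_on_subset[OF cW]) auto
    have "integral {0..1} (\<lambda>t. bil (cx (W t)) (cx (W t))) = of_real (integral {0..1} (\<lambda>t. W t \<bullet> W t))"
      using has_integral_linear[OF integrable_integral[OF WW] bounded_linear_of_real[where 'a = complex]]
      by (intro integral_unique) (simp add: o_def bil_cx)
    ultimately have "integral {0..1} (\<lambda>t. W t \<bullet> W t) = 0" using \<open>Aa = 0\<close> by simp
    moreover have "continuous_on {0..1} (\<lambda>t. W t \<bullet> W t)"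
      by (intro continuous_intros continuous_on_subset[OF cW]) auto
    ultimately have Wz: "W t = 0" if "t \<in> {0..1}" for t
      using integral_eq_0_iff[of 0 1 "\<lambda>t. W t \<bullet> W t"] that by simp
    have "((\<lambda>t. norm (w t)) has_integral 0) {0..1}"
    proof (rule norm_integral_zero_if_interval_integrals_zero)
      fix c d :: real assume "0 \<le> c" "c \<le> d" "d \<le> 1"
      thus "(w has_integral 0) {c..d}" using W[of c d] Wz[of c] Wz[of d] by simp
    qed simp
    hence "((\<lambda>t. norm (w t)) has_integral 0) {of_int m..of_int m + 1}" for m
      by (rule periodic_integrable(1)[rotated]) (simp add: wper)
    hence "AE t in lebesgue. t \<in> {of_int m..of_int m + 1} \<longrightarrow> w t = 0" for m :: int
      by (rule AE_zero_if_norm_integral_zero)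
    hence "AE t in lebesgue. \<forall>m::int. t \<in> {of_int m..of_int m + 1} \<longrightarrow> w t = 0"
      unfolding AE_all_countable by (rule allI)
    thus ?thesis
    proof eventually_elim
      case (elim t)
      have "t \<in> {of_int \<lfloor>t\<rfloor>..of_int \<lfloor>t\<rfloor> + 1}" by (simp; linarith)
      from elim[THEN spec, THEN mp, OF this] show ?case by (simp only: w_def e_def)
    qed
  qed
  have "AE t in lebesgue. \<forall>j\<in>UNIV. V t *v axis j 1 = 0"
    by (subst AE_finite_all[OF finite]) (use column in blast)
  thus ?thesis
  proof eventually_elim
    case (elim t)
    have "V t $ i $ j = 0" for i j
    proof -
      have "(V t *v axis j 1) $ i = V t $ i $ j"
        by (simp add: matrix_vector_mult_def axis_def if_distrib[of "\<lambda>x. _ * x"] cong: if_cong)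
      thus ?thesis using elim by simp
    qed
    thus ?case by (simp add: vec_eq_iff)
  qed
qed

end

section \<open>Large energies\<close>

lemma norm_sin_cos_le:
  fixes z :: complex and \<tau> :: real
  assumes "\<tau> \<ge> 0"
  shows "cmod (sin (z * of_real \<tau>)) \<le> exp (\<bar>Im z\<bar> * \<tau>)" "cmod (cos (z * of_real \<tau>)) \<le> exp (\<bar>Im z\<bar> * \<tau>)"
  using cmod_sin_le_exp[of 1 "z * of_real \<tau>"] cmod_cos_le_exp[of 1 "z * of_real \<tau>"] assms
  by (simp_all add: abs_mult)

lemma bil_axis: "bil (c *s axis i 1) x = c * x $ i"
  by (simp add: bil_def axis_def if_distrib[of "\<lambda>x. c * x"] if_distrib[of "\<lambda>y. y * _"] cong: if_cong)

lemma weak_derivatives_axis: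
  fixes \<phi> \<phi>' \<psi> :: "real \<Rightarrow> complex"
  assumes "\<And>s. (\<phi> has_vector_derivative \<phi>' s) (at s)" "\<And>s. (\<phi>' has_vector_derivative \<psi> s) (at s)" "continuous_on UNIV \<psi>"
  shows "weak_derivatives (\<lambda>s. \<phi> s *s (axis i 1 :: complex ^ 'n::finite)) (\<lambda>s. \<phi>' s *s axis i 1) (\<lambda>s. \<psi> s *s axis i 1)"
proof -
  have bl: "bounded_linear (\<lambda>c. c *s (axis i 1 :: complex ^ 'n))"
    by (intro linear_conv_bounded_linear[THEN iffD1] linearI) (simp_all add: vec_eq_iff algebra_simps)
  show ?thesis
    by (rule weak_derivatives_C2[OF bounded_linear.has_vector_derivative[OF bl assms(1)]
          bounded_linear.has_vector_derivative[OF bl assms(2)] bounded_linear.continuous_on[OF bl assms(3)]])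
qed

context potential
begin

lemma v_integrable: "v integrable_on {a..b}"
  using integrable_entry_norm[OF locally_integrableD[OF locally_integrable_cV, of a b]] by (simp add: v_def[abs_def])

text \<open>The \<open>L\<^sup>1\<close> size of the potential over a period, against which energies are large or small.\<close>

definition total_v :: real where "total_v = integral {0..1} v"

lemma integral_v_le: "0 \<le> t \<Longrightarrow> t \<le> 1 \<Longrightarrow> integral {0..t} v \<le> total_v"
  unfolding total_v_def by (intro integral_subset_le v_integrable) auto

lemma total_v_nonneg: "total_v \<ge> 0"
  unfolding total_v_def by (rule Henstock_Kurzweil_Integration.integral_nonneg[OF v_integrable]) simp

text \<open>Green's identity with a scalar solution \<open>\<phi>\<close> of the free equation in one coordinate: the energy cancels and only \<open>V\<close> remains.\<close>

lemma Green_sol: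
  fixes z :: complex and \<phi> \<phi>' :: "real \<Rightarrow> complex" and a b :: "complex ^ 'n"
  assumes d: "\<And>s. (\<phi> has_vector_derivative \<phi>' s) (at s)" "\<And>s. (\<phi>' has_vector_derivative - (z\<^sup>2 * \<phi> s)) (at s)" and t: "t \<ge> 0"
  shows "((\<lambda>s. \<phi> s * (cV s *v sol (\<lambda>r. cV r - mat (z\<^sup>2)) a b s) $ i) has_integral
     (\<phi> t * sol' (\<lambda>r. cV r - mat (z\<^sup>2)) a b t $ i - \<phi>' t * sol (\<lambda>r. cV r - mat (z\<^sup>2)) a b t $ i) - (\<phi> 0 * b $ i - \<phi>' 0 * a $ i)) {0..t}"
proof -
  define Q where "Q r = cV r - mat (z\<^sup>2)" for r
  have Q: "locally_integrable Q" unfolding Q_def by (rule locally_integrable_shifted[OF locally_integrable_cV])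
  have "continuous_on UNIV \<phi>"
    by (intro continuous_at_imp_continuous_on ballI has_vector_derivative_continuous[OF d(1)])
  hence c: "continuous_on UNIV (\<lambda>s. - (z\<^sup>2 * \<phi> s))" by (intro continuous_intros)
  have "((\<lambda>s. bil (\<phi> s *s axis i 1) (if s < 0 then 0 else Q s *v sol Q a b s) - bil (- (z\<^sup>2 * \<phi> s) *s axis i 1) (sol Q a b s))
     has_integral (bil (\<phi> t *s axis i 1) (sol' Q a b t) - bil (\<phi>' t *s axis i 1) (sol Q a b t))
       - (bil (\<phi> 0 *s axis i 1) (sol' Q a b 0) - bil (\<phi>' 0 *s axis i 1) (sol Q a b 0))) {0..t}"
    by (rule Green_identity[OF t weak_derivatives_sol[OF Q] weak_derivatives_axis[OF d c]])
  hence "((\<lambda>s. bil (\<phi> s *s axis i 1) (if s < 0 then 0 else Q s *v sol Q a b s) - bil (- (z\<^sup>2 * \<phi> s) *s axis i 1) (sol Q a b s))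
     has_integral (\<phi> t * sol' Q a b t $ i - \<phi>' t * sol Q a b t $ i) - (\<phi> 0 * b $ i - \<phi>' 0 * a $ i)) {0..t}"
    by (simp only: bil_axis sol_at_0[OF Q] sol'_nonpos[OF order_refl])
  hence "((\<lambda>s. \<phi> s * (cV s *v sol Q a b s) $ i)
     has_integral (\<phi> t * sol' Q a b t $ i - \<phi>' t * sol Q a b t $ i) - (\<phi> 0 * b $ i - \<phi>' 0 * a $ i)) {0..t}"
  proof (rule has_integral_eq[rotated])
    fix s assume "s \<in> {0..t}"
    thus "bil (\<phi> s *s axis i 1) (if s < 0 then 0 else Q s *v sol Q a b s) - bil (- (z\<^sup>2 * \<phi> s) *s axis i 1) (sol Q a b s)
        = \<phi> s * (cV s *v sol Q a b s) $ i"
      unfolding bil_axis by (simp add: Q_def matrix_vector_mult_diff_rdistrib mat_vector_mult algebra_simps)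
  qed
  thus ?thesis unfolding Q_def .
qed

text \<open>The free solutions \<open>sin (z (t - s)) / z\<close> and \<open>cos (z (t - s))\<close> have unit data at \<open>s = t\<close>, up to sign, so they isolate the slope and the
  value of the solution there.\<close>

lemma variation_of_constants:
  fixes z :: complex and a b :: "complex ^ 'n"
  assumes z: "z \<noteq> 0" and t: "t \<ge> 0"
  shows "((\<lambda>s. sin (z * of_real (t - s)) / z * (cV s *v sol (\<lambda>r. cV r - mat (z\<^sup>2)) a b s) $ i) has_integral
     sol (\<lambda>r. cV r - mat (z\<^sup>2)) a b t $ i - (cos (z * of_real t) * a $ i + sin (z * of_real t) / z * b $ i)) {0..t}"
    and "((\<lambda>s. cos (z * of_real (t - s)) * (cV s *v sol (\<lambda>r. cV r - mat (z\<^sup>2)) a b s) $ i) has_integral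
     sol' (\<lambda>r. cV r - mat (z\<^sup>2)) a b t $ i - (cos (z * of_real t) * b $ i - z * sin (z * of_real t) * a $ i)) {0..t}"
proof -
  have d1: "((\<lambda>s. sin (z * of_real (t - s)) / z) has_vector_derivative - cos (z * of_real (t - s))) (at s)" for s
    unfolding of_real_diff
    by (rule has_vector_derivative_real_field) (use z in \<open>auto intro!: derivative_eq_intros\<close>)
  have d2: "((\<lambda>s. - cos (z * of_real (t - s))) has_vector_derivative - (z\<^sup>2 * (sin (z * of_real (t - s)) / z))) (at s)" for s
    unfolding of_real_diff
    by (rule has_vector_derivative_real_field) (use z in \<open>auto intro!: derivative_eq_intros simp: power2_eq_square\<close>)
  have d3: "((\<lambda>s. cos (z * of_real (t - s))) has_vector_derivative z * sin (z * of_real (t - s))) (at s)" for s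
    unfolding of_real_diff
    by (rule has_vector_derivative_real_field) (auto intro!: derivative_eq_intros)
  have d4: "((\<lambda>s. z * sin (z * of_real (t - s))) has_vector_derivative - (z\<^sup>2 * cos (z * of_real (t - s)))) (at s)" for s
    unfolding of_real_diff
    by (rule has_vector_derivative_real_field) (auto intro!: derivative_eq_intros simp: power2_eq_square)
  show "((\<lambda>s. sin (z * of_real (t - s)) / z * (cV s *v sol (\<lambda>r. cV r - mat (z\<^sup>2)) a b s) $ i) has_integral
     sol (\<lambda>r. cV r - mat (z\<^sup>2)) a b t $ i - (cos (z * of_real t) * a $ i + sin (z * of_real t) / z * b $ i)) {0..t}"
    using Green_sol[OF d1 d2 t, of a b i] by (simp add: algebra_simps)
  show "((\<lambda>s. cos (z * of_real (t - s)) * (cV s *v sol (\<lambda>r. cV r - mat (z\<^sup>2)) a b s) $ i) has_integral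
     sol' (\<lambda>r. cV r - mat (z\<^sup>2)) a b t $ i - (cos (z * of_real t) * b $ i - z * sin (z * of_real t) * a $ i)) {0..t}"
    using Green_sol[OF d3 d4 t, of a b i] by (simp add: algebra_simps)
qed

text \<open>Let \<open>M\<close> be the maximum of \<open>exp (- |Im z| t) * norm (y t)\<close>. The integral equation bounds the distance to the free
  solution by \<open>M / 2\<close> in the same weighted norm, hence \<open>M\<close> is at most twice the size of the free solution.\<close>

lemma sol_free_approximation:
  fixes z :: complex and a b :: "complex ^ 'n"
  assumes z: "z \<noteq> 0" and large: "2 * real CARD('n) * total_v \<le> cmod z" and t: "0 \<le> t" "t \<le> 1"
  shows "norm (sol (\<lambda>r. cV r - mat (z\<^sup>2)) a b t - (cos (z * of_real t) *s a + (sin (z * of_real t) / z) *s b))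
     \<le> 2 * real CARD('n) * total_v / cmod z * (norm a + norm b / cmod z) * exp (\<bar>Im z\<bar> * t)"
proof -
  define y where "y = sol (\<lambda>r. cV r - mat (z\<^sup>2)) a b"
  define \<beta> where "\<beta> = \<bar>Im z\<bar>"
  define P where "P = norm a + norm b / cmod z"
  define y0 where "y0 t = cos (z * of_real t) *s a + (sin (z * of_real t) / z) *s b" for t
  have Q: "locally_integrable (\<lambda>r. cV r - mat (z\<^sup>2))" by (rule locally_integrable_shifted[OF locally_integrable_cV])
  have zp: "cmod z > 0" using z by simp
  have "continuous_on {0..1} (\<lambda>s. exp (- \<beta> * s) * norm (y s))"
    unfolding y_def by (intro continuous_intros continuous_on_sol[OF Q])
  from continuous_attains_sup[OF compact_Icc _ this] obtain s0 where
    s0: "s0 \<in> {0..1}" "\<forall>s\<in>{0..1}. exp (- \<beta> * s) * norm (y s) \<le> exp (- \<beta> * s0) * norm (y s0)" by auto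
  define M where "M = exp (- \<beta> * s0) * norm (y s0)"
  have M0: "M \<ge> 0" by (simp add: M_def)
  have yM: "norm (y s) \<le> M * exp (\<beta> * s)" if "s \<in> {0..1}" for s
  proof -
    have "norm (y s) = (exp (- \<beta> * s) * norm (y s)) * exp (\<beta> * s)" by (simp add: exp_minus)
    also have "\<dots> \<le> M * exp (\<beta> * s)" using s0(2) that by (intro mult_right_mono) (auto simp: M_def)
    finally show ?thesis .
  qed
  have D: "norm (y t - y0 t) \<le> (real CARD('n) * total_v / cmod z) * M * exp (\<beta> * t)" if t: "t \<in> {0..1}" for t
  proof -
    have comp: "cmod ((y t - y0 t) $ i) \<le> (M * exp (\<beta> * t) / cmod z) * total_v" for i
    proof -
      have t0: "0 \<le> t" using t by simp
      note h = variation_of_constants(1)[OF z t0, of a b i, folded y_def]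
      have "(y t - y0 t) $ i = integral {0..t} (\<lambda>s. sin (z * of_real (t - s)) / z * (cV s *v y s) $ i)"
        unfolding integral_unique[OF h] by (simp add: y0_def)
      also have "cmod \<dots> \<le> integral {0..t} (\<lambda>s. (M * exp (\<beta> * t) / cmod z) * v s)"
      proof (rule integral_norm_bound_integral[OF has_integral_integrable[OF h] integrable_on_mult_right[OF v_integrable]])
        fix s assume s: "s \<in> {0..t}"
        have s1: "s \<in> {0..1}" using s t by auto
        have "cmod ((cV s *v y s) $ i) \<le> v s * (M * exp (\<beta> * s))"
          using Finite_Cartesian_Product.norm_nth_le[of "cV s *v y s" i] norm_matrix_le[of s "y s"] mult_left_mono[OF yM[OF s1] v_nonneg[of s]] by linarith
        moreover have "cmod (sin (z * of_real (t - s)) / z) \<le> exp (\<beta> * (t - s)) / cmod z"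
          unfolding norm_divide \<beta>_def using s by (intro divide_right_mono norm_sin_cos_le) auto
        ultimately have "cmod (sin (z * of_real (t - s)) / z * (cV s *v y s) $ i) \<le> (exp (\<beta> * (t - s)) / cmod z) * (v s * (M * exp (\<beta> * s)))"
          unfolding norm_mult by (intro mult_mono) auto
        also have "\<dots> = (M * (exp (\<beta> * (t - s)) * exp (\<beta> * s)) / cmod z) * v s" by simp
        also have "exp (\<beta> * (t - s)) * exp (\<beta> * s) = exp (\<beta> * t)" by (simp add: exp_add[symmetric] algebra_simps)
        finally show "norm (sin (z * of_real (t - s)) / z * (cV s *v y s) $ i) \<le> (M * exp (\<beta> * t) / cmod z) * v s" .
      qed
      also have "\<dots> = (M * exp (\<beta> * t) / cmod z) * integral {0..t} v" by simp
      also have "\<dots> \<le> (M * exp (\<beta> * t) / cmod z) * total_v"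
        using t M0 by (intro mult_left_mono integral_v_le) auto
      finally show ?thesis .
    qed
    have "norm (y t - y0 t) \<le> (\<Sum>i\<in>UNIV. cmod ((y t - y0 t) $ i))" by (rule norm_le_sum_components)
    also have "\<dots> \<le> (\<Sum>i\<in>(UNIV :: 'n set). (M * exp (\<beta> * t) / cmod z) * total_v)" by (intro sum_mono comp)
    finally show ?thesis by (simp add: mult_ac)
  qed
  have y0P: "norm (y0 t) \<le> P * exp (\<beta> * t)" if "t \<in> {0..1}" for t
  proof -
    have "norm (y0 t) \<le> cmod (cos (z * of_real t)) * norm a + cmod (sin (z * of_real t)) / cmod z * norm b"
      unfolding y0_def using norm_triangle_ineq[of "cos (z * of_real t) *s a" "(sin (z * of_real t) / z) *s b"]
      by (simp only: norm_vector_scalar norm_divide)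
    also have "\<dots> \<le> exp (\<beta> * t) * norm a + exp (\<beta> * t) / cmod z * norm b"
      unfolding \<beta>_def using that by (intro add_mono mult_right_mono divide_right_mono norm_sin_cos_le) auto
    finally show ?thesis by (simp add: P_def algebra_simps)
  qed
  have N2: "real CARD('n) * total_v / cmod z \<le> 1 / 2" using large zp by (simp add: field_simps)
  have "M \<le> 2 * P"
  proof -
    have "norm (y s0) \<le> norm (y s0 - y0 s0) + norm (y0 s0)" using norm_triangle_ineq[of "y s0 - y0 s0" "y0 s0"] by simp
    also have "\<dots> \<le> (real CARD('n) * total_v / cmod z) * M * exp (\<beta> * s0) + P * exp (\<beta> * s0)"
      by (intro add_mono D y0P s0(1))
    also have "\<dots> \<le> (1 / 2) * M * exp (\<beta> * s0) + P * exp (\<beta> * s0)"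
      by (intro add_right_mono mult_right_mono N2 M0) simp
    finally have "norm (y s0) \<le> (M / 2 + P) * exp (\<beta> * s0)" by (simp add: algebra_simps)
    hence "M \<le> exp (- \<beta> * s0) * ((M / 2 + P) * exp (\<beta> * s0))" by (subst M_def, intro mult_left_mono) auto
    also have "\<dots> = M / 2 + P" by (simp add: exp_minus)
    finally show ?thesis by simp
  qed
  have "norm (y t - y0 t) \<le> (real CARD('n) * total_v / cmod z) * M * exp (\<beta> * t)" by (rule D) (use t in simp)
  also have "\<dots> \<le> (real CARD('n) * total_v / cmod z) * (2 * P) * exp (\<beta> * t)"
    using total_v_nonneg by (intro mult_right_mono mult_left_mono \<open>M \<le> 2 * P\<close>) auto
  finally show ?thesis by (simp add: y_def y0_def P_def \<beta>_def mult_ac)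
qed

text \<open>The free approximation is put into the integral equations for the value and the slope. The main terms combine by
  \<open>sin (z (1 - s)) cos (z s) + cos (z (1 - s)) sin (z s) = sin z\<close>, which does not depend on \<open>s\<close>, so that only the mean of the
  diagonal entry enters.\<close>

lemma diagonal_entry_asymptotics:
  fixes z :: complex
  assumes z: "z \<noteq> 0" and large: "2 * real CARD('n) * total_v \<le> cmod z"
  shows "cmod ((sol (\<lambda>r. cV r - mat (z\<^sup>2)) (axis i 1) 0 1 $ i + sol' (\<lambda>r. cV r - mat (z\<^sup>2)) 0 (axis i 1) 1 $ i)
      - (2 * cos z + of_real (integral {0..1} (\<lambda>t. V t $ i $ i)) / z * sin z))
    \<le> 4 * real CARD('n) * total_v\<^sup>2 * exp \<bar>Im z\<bar> / (cmod z)\<^sup>2"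
proof -
  define \<beta> where "\<beta> = \<bar>Im z\<bar>"
  define e where "e = (axis i 1 :: complex ^ 'n)"
  define C where "C = sol (\<lambda>r. cV r - mat (z\<^sup>2)) e 0"
  define S where "S = sol (\<lambda>r. cV r - mat (z\<^sup>2)) 0 e"
  define S' where "S' = sol' (\<lambda>r. cV r - mat (z\<^sup>2)) 0 e"
  define d where "d = integral {0..1} (\<lambda>t. V t $ i $ i)"
  define K where "K = 2 * real CARD('n) * total_v"
  have zp: "cmod z > 0" using z by simp
  have K0: "K \<ge> 0" using total_v_nonneg by (simp add: K_def)
  have ee: "norm e = 1" "e $ i = 1" by (simp_all add: e_def norm_axis_1)
  note hC = variation_of_constants(1)[OF z zero_le_one, of e 0 i, folded C_def]
  note hS = variation_of_constants(2)[OF z zero_le_one, of 0 e i, folded S_def S'_def]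
  have Ve: "(cV s *v e) $ i = of_real (V s $ i $ i)" for s
    by (simp add: e_def matrix_vector_mult_def cV_entry axis_def if_distrib[of "\<lambda>x. _ * x"] cong: if_cong)
  have "(\<lambda>t. cV t $ i $ i) integrable_on {0..1}"
    by (rule set_lebesgue_integral_eq_integral(1)[OF absolutely_integrable_entry[OF locally_integrableD[OF locally_integrable_cV]]])
  from integrable_linear[OF this bounded_linear_Re] have "(\<lambda>t. V t $ i $ i) integrable_on {0..1}" by (simp add: o_def cV_entry)
  from has_integral_linear[OF integrable_integral[OF this] bounded_linear_of_real[where 'a = complex]]
  have hV: "((\<lambda>s. complex_of_real (V s $ i $ i)) has_integral of_real d) {0..1}" by (simp add: o_def d_def)
  define G where "G s = sin (z * of_real (1 - s)) / z * (cV s *v C s) $ i + cos (z * of_real (1 - s)) * (cV s *v S s) $ i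
     - sin z / z * of_real (V s $ i $ i)" for s
  have hG: "(G has_integral (C 1 $ i - (cos (z * of_real 1) * e $ i + sin (z * of_real 1) / z * 0 $ i)
     + (S' 1 $ i - (cos (z * of_real 1) * e $ i - z * sin (z * of_real 1) * 0 $ i)) - sin z / z * of_real d)) {0..1}"
    unfolding G_def by (intro has_integral_diff has_integral_add hC hS has_integral_mult_right hV)
  have val: "C 1 $ i - (cos (z * of_real 1) * e $ i + sin (z * of_real 1) / z * 0 $ i)
     + (S' 1 $ i - (cos (z * of_real 1) * e $ i - z * sin (z * of_real 1) * 0 $ i)) - sin z / z * of_real d
     = (C 1 $ i + S' 1 $ i) - (2 * cos z + of_real d / z * sin z)"
    using ee z by (simp add: field_simps)
  have Gb: "cmod (G s) \<le> (2 * K * exp \<beta> / (cmod z)\<^sup>2) * v s" if s: "s \<in> {0..1}" for s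
  proof -
    have s01: "0 \<le> s" "s \<le> 1" using s by auto
    define DC where "DC = C s - cos (z * of_real s) *s e"
    define DS where "DS = S s - (sin (z * of_real s) / z) *s e"
    have "norm DC \<le> K / cmod z * (norm e + norm (0 :: complex ^ 'n) / cmod z) * exp (\<beta> * s)"
      using sol_free_approximation[OF z large s01, of e 0] by (simp add: DC_def C_def K_def \<beta>_def)
    hence DC: "norm DC \<le> K / cmod z * exp (\<beta> * s)" by (simp add: ee)
    have "norm DS \<le> K / cmod z * (norm (0 :: complex ^ 'n) + norm e / cmod z) * exp (\<beta> * s)"
      using sol_free_approximation[OF z large s01, of 0 e] by (simp add: DS_def S_def K_def \<beta>_def)
    hence DS: "norm DS \<le> K / (cmod z)\<^sup>2 * exp (\<beta> * s)" by (simp add: ee power2_eq_square)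
    have Cs: "(cV s *v C s) $ i = cos (z * of_real s) * of_real (V s $ i $ i) + (cV s *v DC) $ i"
    proof -
      have "C s = cos (z * of_real s) *s e + DC" by (simp add: DC_def)
      thus ?thesis by (simp add: matrix_vector_right_distrib vector_scalar_commute Ve)
    qed
    have Ss: "(cV s *v S s) $ i = sin (z * of_real s) / z * of_real (V s $ i $ i) + (cV s *v DS) $ i"
    proof -
      have "S s = (sin (z * of_real s) / z) *s e + DS" by (simp add: DS_def)
      thus ?thesis by (simp add: matrix_vector_right_distrib vector_scalar_commute Ve)
    qed
    have "z = z * of_real (1 - s) + z * of_real s" by (simp add: algebra_simps)
    hence add: "sin z = sin (z * of_real (1 - s)) * cos (z * of_real s) + cos (z * of_real (1 - s)) * sin (z * of_real s)"
      using sin_add[of "z * of_real (1 - s)" "z * of_real s"] by simp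
    have "G s = sin (z * of_real (1 - s)) / z * (cV s *v DC) $ i + cos (z * of_real (1 - s)) * (cV s *v DS) $ i"
      unfolding G_def Cs Ss add using z by (simp add: field_simps)
    also have "cmod \<dots> \<le> exp (\<beta> * (1 - s)) / cmod z * (v s * (K / cmod z * exp (\<beta> * s)))
        + exp (\<beta> * (1 - s)) * (v s * (K / (cmod z)\<^sup>2 * exp (\<beta> * s)))"
    proof (rule norm_triangle_le, rule add_mono)
      have 1: "cmod ((cV s *v DC) $ i) \<le> v s * (K / cmod z * exp (\<beta> * s))"
        using Finite_Cartesian_Product.norm_nth_le[of "cV s *v DC" i] norm_matrix_le[of s DC] mult_left_mono[OF DC v_nonneg[of s]] by linarith
      have 2: "cmod ((cV s *v DS) $ i) \<le> v s * (K / (cmod z)\<^sup>2 * exp (\<beta> * s))"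
        using Finite_Cartesian_Product.norm_nth_le[of "cV s *v DS" i] norm_matrix_le[of s DS] mult_left_mono[OF DS v_nonneg[of s]] by linarith
      show "cmod (sin (z * of_real (1 - s)) / z * (cV s *v DC) $ i) \<le> exp (\<beta> * (1 - s)) / cmod z * (v s * (K / cmod z * exp (\<beta> * s)))"
        unfolding norm_mult norm_divide \<beta>_def using s01 1 K0
        by (intro mult_mono divide_right_mono norm_sin_cos_le) (auto simp: \<beta>_def)
      show "cmod (cos (z * of_real (1 - s)) * (cV s *v DS) $ i) \<le> exp (\<beta> * (1 - s)) * (v s * (K / (cmod z)\<^sup>2 * exp (\<beta> * s)))"
        unfolding norm_mult \<beta>_def using s01 2 K0
        by (intro mult_mono norm_sin_cos_le) (auto simp: \<beta>_def)
    qed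
    also have "\<dots> = (2 * K * (exp (\<beta> * (1 - s)) * exp (\<beta> * s)) / (cmod z)\<^sup>2) * v s" by (simp add: power2_eq_square)
    also have "exp (\<beta> * (1 - s)) * exp (\<beta> * s) = exp \<beta>" by (simp add: exp_add[symmetric] algebra_simps)
    finally show ?thesis .
  qed
  have "cmod (integral {0..1} G) \<le> integral {0..1} (\<lambda>s. (2 * K * exp \<beta> / (cmod z)\<^sup>2) * v s)"
    by (rule integral_norm_bound_integral[OF has_integral_integrable[OF hG] integrable_on_mult_right[OF v_integrable] Gb])
  also have "\<dots> = (2 * K * exp \<beta> / (cmod z)\<^sup>2) * total_v" by (simp add: total_v_def)
  finally show ?thesis
    unfolding integral_unique[OF hG] val
    by (simp add: C_def S'_def e_def d_def K_def \<beta>_def power2_eq_square mult_ac)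
qed

lemma transfer_trace_asymptotics:
  fixes z :: complex
  assumes z: "z \<noteq> 0" and large: "2 * real CARD('n) * total_v \<le> cmod z"
  shows "cmod ((\<Sum>j\<in>UNIV. transfer (z\<^sup>2) j j)
      - (2 * real CARD('n) * cos z + of_real (\<Sum>i\<in>UNIV. integral {0..1} (\<lambda>t. V t $ i $ i)) / z * sin z))
    \<le> (2 * real CARD('n) * total_v)\<^sup>2 * exp \<bar>Im z\<bar> / (cmod z)\<^sup>2"
proof -
  define T where "T i = sol (\<lambda>r. cV r - mat (z\<^sup>2)) (axis i 1) 0 1 $ i + sol' (\<lambda>r. cV r - mat (z\<^sup>2)) 0 (axis i 1) 1 $ i" for i
  define d where "d i = integral {0..1} (\<lambda>t. V t $ i $ i)" for i
  have "(\<Sum>j\<in>UNIV. transfer (z\<^sup>2) j j) = (\<Sum>i\<in>UNIV. T i)"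
    unfolding sum_over_sum_type T_def sum.distrib by (simp add: transfer_def coord_def basis_value_def basis_slope_def)
  moreover have "2 * real CARD('n) * cos z + of_real (\<Sum>i\<in>UNIV. d i) / z * sin z = (\<Sum>i\<in>UNIV. 2 * cos z + of_real (d i) / z * sin z)"
    by (simp add: sum.distrib sum_distrib_right sum_divide_distrib)
  ultimately have "(\<Sum>j\<in>UNIV. transfer (z\<^sup>2) j j) - (2 * real CARD('n) * cos z + of_real (\<Sum>i\<in>UNIV. d i) / z * sin z)
     = (\<Sum>i\<in>UNIV. T i - (2 * cos z + of_real (d i) / z * sin z))" by (simp add: sum_subtractf)
  also have "cmod \<dots> \<le> (\<Sum>i\<in>(UNIV :: 'n set). 4 * real CARD('n) * total_v\<^sup>2 * exp \<bar>Im z\<bar> / (cmod z)\<^sup>2)"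
    unfolding T_def d_def by (intro order_trans[OF norm_sum] sum_mono diagonal_entry_asymptotics z large)
  also have "\<dots> = (2 * real CARD('n) * total_v)\<^sup>2 * exp \<bar>Im z\<bar> / (cmod z)\<^sup>2" by (simp add: power2_eq_square)
  finally show ?thesis by (simp add: d_def)
qed

end

section \<open>A contour integral\<close>

lemma exp_ge_3: "exp (2::real) \<ge> 3"
  using exp_ge_add_one_self[of "2::real"] by simp

text \<open>The circle crosses the real axis halfway between two zeros of the sine. Near the axis \<open>Re z\<close> stays close to such a midpoint and
  \<open>cos (2 Re z) \<le> 0\<close>; away from it the exponential dominates.\<close>

lemma norm_sin_on_circle:
  assumes r: "cmod z = pi * (real n + 1/2)" and n: "n \<ge> 1"
  shows "exp \<bar>Im z\<bar> / 6 \<le> cmod (sin z)"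
proof -
  define x y where "x = Re z" and "y = Im z"
  define r where "r = pi * (real n + 1/2)"
  have r4: "r \<ge> 4"
  proof -
    have "4 \<le> pi * (3/2)" using pi_gt3 by simp
    also have "\<dots> \<le> pi * (real n + 1/2)" using n by (intro mult_left_mono) auto
    finally show ?thesis by (simp add: r_def)
  qed
  have xy: "x\<^sup>2 + y\<^sup>2 = r\<^sup>2" using cmod_power2[of z] assms by (simp add: x_def y_def r_def)
  have sq: "(cmod (sin z))\<^sup>2 = (exp (2 * y) + inverse (exp (2 * y)) - 2 * cos (2 * x)) / 4"
    unfolding norm_sin_squared by (simp add: x_def y_def)
  have even: "exp (2 * y) + inverse (exp (2 * y)) = exp (2 * \<bar>y\<bar>) + inverse (exp (2 * \<bar>y\<bar>))"
    by (cases "y \<ge> 0") (auto simp: exp_minus[symmetric])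
  have "(exp \<bar>y\<bar> / 6)\<^sup>2 \<le> (cmod (sin z))\<^sup>2"
  proof -
    have e36: "(exp \<bar>y\<bar> / 6)\<^sup>2 = exp (2 * \<bar>y\<bar>) / 36" by (simp add: power2_eq_square flip: exp_add)
    define E where "E = exp (2 * \<bar>y\<bar>)"
    define i where "i = inverse (exp (2 * \<bar>y\<bar>))"
    have pos: "i \<ge> 0" "E \<ge> 0" by (simp_all add: E_def i_def)
    show ?thesis
    proof (cases "\<bar>y\<bar> \<ge> 1")
      case True
      hence "exp (2::real) \<le> exp (2 * \<bar>y\<bar>)" by simp
      hence "E \<ge> 3" using exp_ge_3 unfolding E_def by (rule order_trans[rotated])
      moreover have "cos (2 * x) \<le> 1" by simp
      ultimately have "18 * cos (2 * x) \<le> 18" "24 \<le> 8 * E" by simp_all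
      hence "18 * cos (2 * x) \<le> 8 * E + 9 * i" using pos(1) by linarith
      hence "E / 36 \<le> (E + i - 2 * cos (2 * x)) / 4" by (simp add: field_simps)
      thus ?thesis by (simp only: sq even e36 E_def i_def)
    next
      case False
      \<comment> \<open>The distance of \<open>|Re z|\<close> from \<open>r\<close> is at most \<open>1/4\<close>, as \<open>r \<ge> 4\<close>.\<close>
      define d where "d = r - \<bar>x\<bar>"
      have "x\<^sup>2 \<le> r\<^sup>2" using xy zero_le_power2[of y] by linarith
      hence xr: "\<bar>x\<bar> \<le> r" using r4 abs_le_square_iff[of x r] by simp
      have "d * (r + \<bar>x\<bar>) = y\<^sup>2" using xy by (simp add: d_def algebra_simps power2_eq_square)
      also have "\<dots> \<le> 1" using False by (simp add: abs_square_le_1)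
      finally have "d * (r + \<bar>x\<bar>) \<le> 1" .
      moreover have "d * 4 \<le> d * (r + \<bar>x\<bar>)" using r4 xr by (intro mult_left_mono) (auto simp: d_def)
      ultimately have d: "0 \<le> d" "d \<le> 1/4" using xr by (auto simp: d_def)
      have "cos (2 * x) = cos (2 * \<bar>x\<bar>)" by (cases "x \<ge> 0") auto
      also have "2 * \<bar>x\<bar> = (pi - 2 * d) + real n * (2 * pi)" by (simp add: d_def r_def algebra_simps)
      also have "cos \<dots> = cos (pi - 2 * d)"
        using cos.plus_of_nat[of "pi - 2 * d" n] by (simp add: algebra_simps)
      also have "\<dots> = - cos (2 * d)" by (simp add: cos_diff)
      also have "\<dots> \<le> 0" using d pi_gt3 by (simp add: cos_ge_zero)
      finally have "cos (2 * x) \<le> 0" .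
      hence "18 * cos (2 * x) \<le> 8 * E + 9 * i" using pos by linarith
      hence "E / 36 \<le> (E + i - 2 * cos (2 * x)) / 4" by (simp add: field_simps)
      thus ?thesis by (simp only: sq even e36 E_def i_def)
    qed
  qed
  thus ?thesis unfolding y_def by (rule power2_le_imp_le) simp
qed

text \<open>Integrate \<open>(f z - N cos z) / sin z\<close> over the circle of radius \<open>\<pi> (n + 1/2)\<close>. By the asymptotics the integrand is \<open>q / (2 z)\<close> up to
  \<open>O(1 / |z|\<^sup>2)\<close>, so the integral tends to \<open>\<pi> \<i> q\<close>. Its residue at \<open>k \<pi>\<close> is \<open>(-1)\<^sup>k f (k \<pi>) - N\<close>, whose real part is at most \<open>0\<close> by the
  bound on \<open>f\<close> at these points.\<close>

lemma coefficient_nonpos_from_trace_bound: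
  fixes f :: "complex \<Rightarrow> complex" and N q K \<rho> :: real
  assumes f: "f holomorphic_on UNIV"
    and bd: "\<And>k::int. cmod (f (of_real (of_int k * pi))) \<le> N"
    and as: "\<And>z. cmod z \<ge> \<rho> \<Longrightarrow> cmod (f z - (of_real N * cos z + of_real q / (2 * z) * sin z)) \<le> K * exp \<bar>Im z\<bar> / (cmod z)\<^sup>2"
  shows "q \<le> 0"
proof -
  define r where "r n = pi * (real n + 1/2)" for n
  define F where "F z = (f z - of_real N * cos z) / sin z" for z
  have K0: "K \<ge> 0"
  proof -
    define m where "m = max \<rho> 1"
    have m: "m \<ge> \<rho>" "m > 0" by (auto simp: m_def)
    have "0 \<le> K * exp \<bar>Im (of_real m)\<bar> / (cmod (of_real m))\<^sup>2"
      using as[of "of_real m"] m by (intro order_trans[OF norm_ge_zero]) auto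
    thus ?thesis using m by (simp add: zero_le_divide_iff)
  qed
  have main: "q \<le> 12 * K / r n" if n: "n \<ge> 1" and nr: "r n \<ge> \<rho>" for n
  proof -
    have rp: "r n > 0" by (simp add: r_def)
    define I where "I = {k::int. \<bar>k\<bar> \<le> int n}"
    have "I = {- int n..int n}" by (auto simp: I_def)
    hence fI: "finite I" by simp
    define pts where "pts = (\<lambda>k::int. complex_of_real (of_int k * pi)) ` I"
    have sinpts: "sin p = 0" if "p \<in> pts" for p using that by (auto simp: pts_def sin_eq_0)
    define S where "S = ball (0::complex) (pi * (real n + 1))"
    have zero: "z \<in> pts" if zS: "z \<in> S" and z0: "sin z = 0" for z
    proof -
      obtain k where k: "z = of_real (of_int k * pi)" using z0 by (auto simp: sin_eq_0)
      have "\<bar>real_of_int k\<bar> * pi < pi * (real n + 1)" using zS by (simp add: S_def k norm_mult abs_mult)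
      hence "\<bar>real_of_int k\<bar> < real n + 1" by (simp add: mult.commute)
      hence "\<bar>k\<bar> \<le> int n" by linarith
      thus ?thesis using k by (auto simp: pts_def I_def)
    qed
    have hol: "F holomorphic_on S - pts" unfolding F_def
      by (intro holomorphic_intros holomorphic_on_subset[OF f]) (use zero in auto)
    have sinz: "sin z \<noteq> 0" if z: "cmod z = r n" for z
      using norm_sin_on_circle[OF z[unfolded r_def] n] by auto
    have sub: "path_image (circlepath 0 (r n)) \<subseteq> S - pts"
    proof
      fix z assume "z \<in> path_image (circlepath 0 (r n))"
      hence z: "cmod z = r n" using rp by (simp add: path_image_circlepath)
      have "z \<in> S" using z by (simp add: S_def r_def)
      moreover have "z \<notin> pts" using sinz[OF z] sinpts[of z] by blast
      ultimately show "z \<in> S - pts" by blast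
    qed
    have CI: "contour_integral (circlepath 0 (r n)) F = 2 * pi * \<i> * (\<Sum>p\<in>pts. winding_number (circlepath 0 (r n)) p * residue F p)"
    proof (rule Residue_theorem[OF _ _ _ hol _ _ sub])
      show "\<forall>z. z \<notin> S \<longrightarrow> winding_number (circlepath 0 (r n)) z = 0"
      proof (intro allI impI winding_number_zero_outside[of _ "cball 0 (r n)"])
        fix z assume "z \<notin> S"
        hence "pi * real n + pi \<le> cmod z" by (simp add: S_def algebra_simps)
        moreover have "r n = pi * real n + pi / 2" by (simp add: r_def algebra_simps)
        ultimately have "r n < cmod z" using pi_gt_zero by linarith
        thus "z \<notin> cball 0 (r n)" by simp
        show "path_image (circlepath 0 (r n)) \<subseteq> cball 0 (r n)" using rp by auto
      qed auto
    qed (use fI in \<open>auto simp: S_def pts_def\<close>)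
    define \<Sigma> where "\<Sigma> = (\<Sum>p\<in>pts. winding_number (circlepath 0 (r n)) p * residue F p)"
    have "Re \<Sigma> \<le> 0" unfolding \<Sigma>_def Re_sum
    proof (rule sum_nonpos)
      fix p assume "p \<in> pts"
      from this obtain k :: int where k: "\<bar>k\<bar> \<le> int n" "p = of_real (of_int k * pi)" by (auto simp: pts_def I_def)
      have "\<bar>real_of_int k\<bar> \<le> real n" using k(1) by linarith
      hence "\<bar>real_of_int k\<bar> * pi \<le> real n * pi" by (rule mult_right_mono) simp
      moreover have "r n = real n * pi + pi / 2" by (simp add: r_def algebra_simps)
      ultimately have "\<bar>real_of_int k\<bar> * pi < r n" using pi_gt_zero by linarith
      hence w: "winding_number (circlepath 0 (r n)) p = 1"
        by (intro winding_number_circlepath) (simp add: k norm_mult abs_mult)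
      have cp: "cos p = of_real (cos (of_int k * pi))" unfolding k(2) by (simp only: cos_of_real)
      have c1: "cos (of_int k * pi) = 1 \<or> cos (of_int k * pi) = (-1::real)"
        using cos_npi_int[of k] by (cases "even k") (simp_all add: mult.commute)
      have sp: "sin p = 0" using sinpts \<open>p \<in> pts\<close> by blast
      have cne: "cos p \<noteq> 0" using c1 unfolding cp of_real_eq_0_iff by (elim disjE) (simp_all only: HOL.simp_thms one_neq_zero neg_equal_0_iff_equal)
      have "residue F p = (f p - of_real N * cos p) / cos p"
      proof (rule residue_simple'[where s = "ball p 1"])
        have "sin w \<noteq> 0" if w: "w \<in> ball p 1 - {p}" for w
        proof
          assume "sin w = 0"
          then obtain m :: int where m: "w = of_real (of_int m * pi)" by (auto simp: sin_eq_0)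
          have "dist p w = \<bar>real_of_int (k - m)\<bar> * pi"
            unfolding m k(2) dist_of_real by (simp add: dist_real_def left_diff_distrib[symmetric] abs_mult)
          hence near: "\<bar>real_of_int (k - m)\<bar> * pi < 1" using w by simp
          have "\<bar>real_of_int (k - m)\<bar> * 1 \<le> \<bar>real_of_int (k - m)\<bar> * pi"
            using pi_gt3 by (intro mult_left_mono) auto
          hence "\<bar>real_of_int (k - m)\<bar> * 1 < 1" using near by (rule le_less_trans)
          hence "\<bar>real_of_int (k - m)\<bar> < 1" by (simp only: mult_1_right)
          hence "\<bar>k - m\<bar> < 1" by (simp only: of_int_abs[symmetric] of_int_less_1_iff)
          hence "k = m" by simp
          thus False using w m k(2) by simp
        qed
        thus "F holomorphic_on ball p 1 - {p}" unfolding F_def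
          by (intro holomorphic_intros holomorphic_on_subset[OF f]) auto
        have "((\<lambda>w. (sin w - sin p) / (w - p)) \<longlongrightarrow> cos p) (at p)"
          using DERIV_sin[of p] by (simp only: has_field_derivative_iff)
        hence d: "((\<lambda>w. sin w / (w - p)) \<longlongrightarrow> cos p) (at p)" by (simp add: sp)
        have "continuous_on UNIV (\<lambda>w. f w - of_real N * cos w)"
          by (intro holomorphic_on_imp_continuous_on holomorphic_intros f)
        hence c: "((\<lambda>w. f w - of_real N * cos w) \<longlongrightarrow> f p - of_real N * cos p) (at p)"
          by (simp add: continuous_on_eq_continuous_at isCont_def)
        have "((\<lambda>w. (f w - of_real N * cos w) / (sin w / (w - p))) \<longlongrightarrow> (f p - of_real N * cos p) / cos p) (at p)"
          by (rule tendsto_divide[OF c d cne])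
        thus "((\<lambda>w. F w * (w - p)) \<longlongrightarrow> (f p - of_real N * cos p) / cos p) (at p)"
          by (simp add: F_def)
      qed auto
      hence "residue F p = f p / cos p - of_real N" using cne by (simp add: diff_divide_distrib)
      moreover have "cmod (cos p) = 1" unfolding cp norm_of_real using c1 by (elim disjE) (simp_all only: abs_one abs_minus_cancel)
      hence "Re (f p / cos p) \<le> cmod (f p)"
        using complex_Re_le_cmod[of "f p / cos p"] by (simp add: norm_divide)
      ultimately show "Re (winding_number (circlepath 0 (r n)) p * residue F p) \<le> 0"
        using w bd[of k] by (simp add: k(2))
    qed
    define G where "G z = F z - of_real q / (2 * z)" for z
    have int1: "(F has_contour_integral (2 * pi * \<i> * \<Sigma>)) (circlepath 0 (r n))"
    proof -
      have "F contour_integrable_on circlepath 0 (r n)"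
        by (intro contour_integrable_continuous_circlepath holomorphic_on_imp_continuous_on
             holomorphic_on_subset[OF hol sub])
      from has_contour_integral_integral[OF this] show ?thesis unfolding CI \<Sigma>_def .
    qed
    have int2: "((\<lambda>z. of_real q / (2 * z)) has_contour_integral (2 * pi * \<i> * (of_real q / 2))) (circlepath 0 (r n))"
    proof -
      have "((\<lambda>z. (of_real q / 2) / (z - 0)) has_contour_integral (2 * of_real pi * \<i> * (of_real q / 2))) (circlepath 0 (r n))"
        by (rule Cauchy_integral_circlepath_simple[of "\<lambda>_. of_real q / 2"]) (use rp in auto)
      thus ?thesis by simp
    qed
    have cG: "(G has_contour_integral (2 * pi * \<i> * \<Sigma> - 2 * pi * \<i> * (of_real q / 2))) (circlepath 0 (r n))"
      unfolding G_def[abs_def] by (rule has_contour_integral_diff[OF int1 int2])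
    have bG: "cmod (G z) \<le> 6 * K / (r n)\<^sup>2" if z: "cmod (z - 0) = r n" for z
    proof -
      have z': "cmod z = r n" using z by simp
      have s: "exp \<bar>Im z\<bar> / 6 \<le> cmod (sin z)" using norm_sin_on_circle[of z n] z' n by (simp add: r_def)
      have "G z = (f z - (of_real N * cos z + of_real q / (2 * z) * sin z)) / sin z"
        using sinz[OF z'] by (simp add: G_def F_def field_simps)
      hence "cmod (G z) = cmod (f z - (of_real N * cos z + of_real q / (2 * z) * sin z)) / cmod (sin z)"
        by (simp only: norm_divide)
      also have "\<dots> \<le> (K * exp \<bar>Im z\<bar> / (r n)\<^sup>2) / cmod (sin z)"
        by (rule divide_right_mono[OF as[of z, unfolded z', OF nr]]) simp
      also have "\<dots> \<le> (K * exp \<bar>Im z\<bar> / (r n)\<^sup>2) / (exp \<bar>Im z\<bar> / 6)"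
        by (intro divide_left_mono s) (use K0 in \<open>auto intro!: mult_pos_pos simp: sinz[OF z']\<close>)
      also have "\<dots> = 6 * K / (r n)\<^sup>2" by simp
      finally show ?thesis .
    qed
    have "0 \<le> 6 * K / (r n)\<^sup>2" using K0 by simp
    hence "cmod (2 * pi * \<i> * \<Sigma> - 2 * pi * \<i> * (of_real q / 2)) \<le> 6 * K / (r n)\<^sup>2 * (2 * pi * r n)"
      by (rule has_contour_integral_bound_circlepath[OF cG _ rp bG])
    also have "6 * K / (r n)\<^sup>2 * (2 * pi * r n) = 2 * pi * (6 * K / r n)" using rp by (simp add: power2_eq_square)
    also have "2 * pi * \<i> * \<Sigma> - 2 * pi * \<i> * (of_real q / 2) = 2 * pi * \<i> * (\<Sigma> - of_real q / 2)"
      by (simp add: algebra_simps)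
    also have "cmod (2 * pi * \<i> * (\<Sigma> - of_real q / 2)) = 2 * pi * cmod (\<Sigma> - of_real q / 2)"
      by (simp add: norm_mult)
    finally have "cmod (\<Sigma> - of_real q / 2) \<le> 6 * K / r n" by (rule mult_left_le_imp_le) simp
    moreover have "q / 2 - Re \<Sigma> \<le> cmod (\<Sigma> - of_real q / 2)"
      using abs_Re_le_cmod[of "\<Sigma> - of_real q / 2"] by simp
    ultimately show ?thesis using \<open>Re \<Sigma> \<le> 0\<close> by (simp add: field_simps)
  qed
  have lim: "(\<lambda>n. 12 * K / r n) \<longlonglongrightarrow> 0" unfolding r_def by real_asymp
  have "filterlim r at_top sequentially" unfolding r_def by real_asymp
  hence "eventually (\<lambda>n. r n \<ge> \<rho>) sequentially" by (simp add: filterlim_at_top)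
  hence "eventually (\<lambda>n. q \<le> 12 * K / r n) sequentially"
    using eventually_ge_at_top[of 1] by eventually_elim (use main in auto)
  from tendsto_lowerbound[OF lim this] show ?thesis by simp
qed

section \<open>The mean of the potential\<close>

context potential
begin

lemma transfer_holomorphic: "(\<lambda>z. transfer z j j) holomorphic_on UNIV"
proof (cases j)
  case (Inl i)
  show ?thesis unfolding transfer_def coord_def Inl sum.case
    by (rule holomorphic_sol(1)[OF locally_integrable_cV zero_le_one])
next
  case (Inr i)
  show ?thesis unfolding transfer_def coord_def Inr sum.case
    by (rule holomorphic_sol(2)[OF locally_integrable_cV zero_le_one])
qed

text \<open>The function \<open>f z = tr (transfer (z\<^sup>2)) / 2\<close> is entire, and the points \<open>k \<pi>\<close> correspond to the energies \<open>(k \<pi>)\<^sup>2 \<ge> 0\<close>.\<close>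

lemma mean_trace_nonpos:
  assumes bd: "\<And>l. l \<ge> 0 \<Longrightarrow> cmod (\<Sum>j\<in>UNIV. transfer (of_real l) j j) \<le> 2 * real CARD('n)"
  shows "(\<Sum>i\<in>UNIV. integral {0..1} (\<lambda>t. V t $ i $ i)) \<le> 0"
proof -
  define q where "q = (\<Sum>i\<in>UNIV. integral {0..1} (\<lambda>t. V t $ i $ i))"
  define N where "N = real CARD('n)"
  define f where "f z = (\<Sum>j\<in>UNIV. transfer (z\<^sup>2) j j) / 2" for z
  have "q \<le> 0"
  proof (rule coefficient_nonpos_from_trace_bound[where f = f and N = N and K = "(2 * N * total_v)\<^sup>2" and \<rho> = "max 1 (2 * N * total_v)"])
    have "(\<lambda>z. transfer (z\<^sup>2) j j) holomorphic_on UNIV" for j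
      using holomorphic_on_compose[of "\<lambda>z. z\<^sup>2" UNIV "\<lambda>w. transfer w j j"]
        holomorphic_on_subset[OF transfer_holomorphic subset_UNIV]
      by (simp add: o_def holomorphic_on_power holomorphic_on_ident)
    thus "f holomorphic_on UNIV" unfolding f_def by (intro holomorphic_intros) auto
    show "cmod (f (of_real (of_int k * pi))) \<le> N" for k
      using bd[of "(of_int k * pi)\<^sup>2"] by (simp add: f_def N_def norm_divide)
    fix z :: complex assume zr: "max 1 (2 * N * total_v) \<le> cmod z"
    hence z: "z \<noteq> 0" and large: "2 * N * total_v \<le> cmod z" by auto
    have "f z - (of_real N * cos z + of_real q / (2 * z) * sin z)
       = ((\<Sum>j\<in>UNIV. transfer (z\<^sup>2) j j) - (2 * of_real N * cos z + of_real q / z * sin z)) / 2"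
      using z by (simp add: f_def field_simps)
    hence "cmod (f z - (of_real N * cos z + of_real q / (2 * z) * sin z))
       = cmod ((\<Sum>j\<in>UNIV. transfer (z\<^sup>2) j j) - (2 * of_real N * cos z + of_real q / z * sin z)) / 2"
      by (simp only: norm_divide) simp
    also have "\<dots> \<le> cmod ((\<Sum>j\<in>UNIV. transfer (z\<^sup>2) j j) - (2 * of_real N * cos z + of_real q / z * sin z))" by simp
    also have "\<dots> \<le> (2 * N * total_v)\<^sup>2 * exp \<bar>Im z\<bar> / (cmod z)\<^sup>2"
      using transfer_trace_asymptotics[OF z large[unfolded N_def]] by (simp add: q_def N_def)
    finally show "cmod (f z - (of_real N * cos z + of_real q / (2 * z) * sin z)) \<le> (2 * N * total_v)\<^sup>2 * exp \<bar>Im z\<bar> / (cmod z)\<^sup>2" .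
  qed
  thus ?thesis by (simp add: q_def)
qed

text \<open>The bound holds at points arbitrarily close to \<open>l\<close>, and the transfer matrix is continuous in the energy.\<close>

lemma trace_bound_on_mult_spectrum:
  assumes l: "l \<in> mult_spectrum CARD('n) V"
  shows "cmod (\<Sum>j\<in>UNIV. transfer (of_real l) j j) \<le> 2 * real CARD('n)"
proof (rule ccontr)
  assume neg: "\<not> ?thesis"
  obtain \<mu> n U where rep: "spectral_representation V \<mu> n U"
    and pos: "\<And>e. e > 0 \<Longrightarrow> emeasure \<mu> {x. \<bar>x - l\<bar> < e \<and> n x = 2 * CARD('n)} > 0"
    using l by (auto simp: mult_spectrum_def)
  interpret spectral V \<mu> n U by unfold_locales (rule rep)
  define F where "F x = cmod (\<Sum>j\<in>UNIV. transfer (of_real x) j j)" for x :: real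
  have "continuous_on UNIV (\<lambda>x::real. transfer (of_real x) j j)" for j
    by (rule continuous_on_compose2[OF holomorphic_on_imp_continuous_on[OF transfer_holomorphic]]) (auto intro!: continuous_intros)
  hence "continuous_on UNIV F" unfolding F_def by (intro continuous_intros) auto
  hence "open {x. 2 * real CARD('n) < F x}" by (intro open_Collect_less continuous_on_const)
  moreover have "l \<in> {x. 2 * real CARD('n) < F x}" using neg by (simp add: F_def)
  ultimately have "\<exists>e>0. \<forall>x. dist x l < e \<longrightarrow> x \<in> {x. 2 * real CARD('n) < F x}"
    by (rule open_dist[THEN iffD1, THEN bspec])
  then obtain e where e: "e > 0" "\<forall>x. dist x l < e \<longrightarrow> x \<in> {x. 2 * real CARD('n) < F x}" by (elim exE conjE)
  obtain x where x: "\<bar>x - l\<bar> < e \<and> F x \<le> 2 * real CARD('n)"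
    using transfer_trace_bound[OF pos[OF e(1)]] unfolding F_def by (rule exE)
  have "2 * real CARD('n) < F x" using e(2) x by (auto simp: dist_real_def)
  with x show False by simp
qed

lemma V_integral_entry: "integral {0..1} V $ i $ j = integral {0..1} (\<lambda>t. V t $ i $ j)"
proof -
  have "V integrable_on {0..1}"
    by (rule integrable_componentwise) (auto simp: Basis_vec_def inner_axis V_entry_integrable)
  from has_integral_linear[OF integrable_integral[OF this] bounded_linear_compose[OF bounded_linear_vec_nth[of j] bounded_linear_vec_nth[of i]]]
  show ?thesis by (intro integral_unique[symmetric]) (simp add: o_def)
qed

text \<open>Test the quadratic form with the constant function \<open>axis i 1\<close>.\<close>

lemma mean_diagonal_nonneg:
  assumes pos: "\<And>f g. schroedinger V f g \<Longrightarrow> 0 \<le> Re (ip g f)"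
  shows "0 \<le> integral {0..1} (\<lambda>t. V t $ i $ i)"
proof -
  define e where "e = (axis i 1 :: real ^ 'n)"
  have cx0: "cx 0 = (0 :: complex ^ 'n)" by (simp add: vec_eq_iff)
  have "\<exists>X\<ge>0. ((\<lambda>t. (- 0 + V t *v e) \<bullet> e) has_integral X) {0..1}"
  proof (rule periodic_test_function[OF pos, where p' = "\<lambda>t. 0" and K = 0])
    show "weak_derivatives (\<lambda>t. cx e) (\<lambda>t. cx 0) (\<lambda>t. cx 0)"
      unfolding cx0 by (rule weak_derivatives_C2) auto
  qed simp_all
  then obtain X where X: "X \<ge> 0 \<and> ((\<lambda>t. (- 0 + V t *v e) \<bullet> e) has_integral X) {0..1}" by (rule exE)
  have "(V t *v e) \<bullet> e = (V t *v e) $ i" for t by (simp add: e_def inner_axis)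
  moreover have "(V t *v e) $ i = V t $ i $ i" for t
    by (simp add: e_def matrix_vector_mult_def axis_def if_distrib[of "\<lambda>x. _ * x"] cong: if_cong)
  ultimately have "(- 0 + V t *v e) \<bullet> e = V t $ i $ i" for t by simp
  thus ?thesis using X integral_unique[OF X[THEN conjunct2]] by simp
qed

end

theorem corollary1p5:
  fixes V :: "real \<Rightarrow> real ^ 'n::{finite,linorder} ^ 'n::{finite,linorder}"
  assumes "CARD('n) \<ge> 2"
    and "V \<in> periodic_potentials"
    and "normalized V"
    and "spectrum V = complex_of_real ` {0..}"
    and "mult_spectrum CARD('n) V = {0..}"
  shows "AE t in lebesgue. V t = 0"
proof -
  interpret potential V by unfold_locales (rule assms(2))
  have "(0::real) \<in> mult_spectrum CARD('n) V" unfolding assms(5) by simp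
  then obtain \<mu> n U where rep: "spectral_representation V \<mu> n U" by (auto simp: mult_spectrum_def)
  interpret spectral V \<mu> n U by unfold_locales (rule rep)
  have "\<forall>z\<in>spectrum V. 0 \<le> Re z" using assms(4) by auto
  hence "AE x in \<mu>. 0 \<le> x" by (rule spectral_measure_nonneg)
  hence pos: "0 \<le> Re (ip g f)" if "schroedinger V f g" for f g using that by (rule schroedinger_nonneg)
  obtain d where d: "integral {0..1} V = (\<chi> i j. if i = j then d i else 0)"
    using assms(3) by (auto simp: normalized_def)
  define D where "D i = integral {0..1} (\<lambda>t. V t $ i $ i)" for i
  have D0: "D i \<ge> 0" for i unfolding D_def by (rule mean_diagonal_nonneg[OF pos])
  have "(\<Sum>i\<in>UNIV. D i) \<le> 0" unfolding D_def
    by (rule mean_trace_nonpos, rule trace_bound_on_mult_spectrum) (simp add: assms(5))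
  hence "(\<Sum>i\<in>UNIV. D i) = 0" using D0 by (intro antisym sum_nonneg) auto
  hence Dz: "D i = 0" for i using sum_nonneg_eq_0_iff[of UNIV D] D0 by simp
  have "integral {0..1} (\<lambda>t. V t $ i $ j) = 0" for i j
  proof (cases "i = j")
    case True
    thus ?thesis using Dz[of i] by (simp add: D_def)
  next
    case False
    thus ?thesis unfolding V_integral_entry[symmetric] d by simp
  qed
  hence mean: "((\<lambda>t. V t $ i $ j) has_integral 0) {0..1}" for i j
    using integrable_integral[OF V_entry_integrable[of i j 0 1]] by simp
  show ?thesis by (rule V_vanishes_if_mean_zero[OF pos mean])
qed

end
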